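(* Let $C=0.63$. There exists $c>0$ such that, if $G=\mathrm{Sym}(n)$ or $G=\mathrm{Alt}(n)$ and $S$ is a set of generators of $G$ containing an element $g$ with $|\mathrm{supp}(g)|\le Cn$, then $$\mathrm{diam}(\Gamma(G,S))\le O(n^{c}).$$
   Context: $\mathrm{Sym}(n)$ and $\mathrm{Alt}(n)$ are the symmetric and alternating groups acting on $\Omega=\{1,\dots,n\}$. For $g\in \mathrm{Sym}(n)$, $\mathrm{supp}(g)=\{\gamma\in\Omega \mid \gamma^g\ne\gamma\}$, where $\gamma^g$ is the image of $\gamma$ under $g$. For a group $G$ and a set $S$ of generators of $G$, $\Gamma(G,S)$ is the (undirected) Cayley graph with vertex set $G$ and edge set $\{\{g,sg\}\mid g\in G, s\in S\}$. Its diameter $\mathrm{diam}(\Gamma(G,S))$ is the maximum distance among its vertices; equivalently, it is the maximum over $g\in G$ of the length $m$ of a shortest expression $g=s_1^{i_1}\cdots s_m^{i_m}$ with $s_k\in S$ and $i_k\in\{-1,1\}$. *)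

theory Defs
  imports
    "HOL-Algebra.Sym_Groups"
    "HOL-Library.Extended_Real"
    Complex_Main
begin

text \<open>An undirected graph is a pair of a vertex set and a set of unordered edges;
  an edge \<open>{v}\<close> is a loop.\<close>

type_synonym 'a ugraph = "'a set \<times> 'a set set"

definition walk :: "'a ugraph \<Rightarrow> 'a \<Rightarrow> 'a list \<Rightarrow> 'a \<Rightarrow> bool" where
  "walk \<Gamma> u xs v \<longleftrightarrow>
     xs \<noteq> [] \<and> hd xs = u \<and> last xs = v \<and> set xs \<subseteq> fst \<Gamma> \<and>
     successively (\<lambda>x y. {x, y} \<in> snd \<Gamma>) xs"

text \<open>A walk is recorded by its list of vertices, so its length (number of edges) is one
  less than the length of that list. The infimum of the empty set is \<open>\<infinity>\<close>: vertices in
  different components are at infinite distance.\<close>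

definition gdist :: "'a ugraph \<Rightarrow> 'a \<Rightarrow> 'a \<Rightarrow> enat" where
  "gdist \<Gamma> u v = (INF xs \<in> {xs. walk \<Gamma> u xs v}. enat (length xs - 1))"

definition gdiam :: "'a ugraph \<Rightarrow> enat" where
  "gdiam \<Gamma> = (SUP u \<in> fst \<Gamma>. SUP v \<in> fst \<Gamma>. gdist \<Gamma> u v)"

text \<open>In \<^const>\<open>sym_group\<close> the product is \<open>(\<circ>)\<close>, whereas for permutations acting on the right
  (image of \<open>x\<close> under \<open>g\<close> written as a superscript) the product \<open>s g\<close> applies \<open>s\<close> first.
  Inversion is an isomorphism from the Cayley graph \<open>{g, s g}\<close> of a group onto the Cayley
  graph, with respect to the same set, of the opposite group, so the diameter does not
  depend on this convention.\<close>

definition cayley_graph :: "('a, 'b) monoid_scheme \<Rightarrow> 'a set \<Rightarrow> 'a ugraph" where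
  "cayley_graph G S =
     (carrier G, {{g, s \<otimes>\<^bsub>G\<^esub> g} | g s. g \<in> carrier G \<and> s \<in> S})"

definition supp :: "nat \<Rightarrow> (nat \<Rightarrow> nat) \<Rightarrow> nat set" where
  "supp n g = {x \<in> {1..n}. g x \<noteq> x}"

end

theory Submission
  imports Defs "HOL-Analysis.Convex"
begin

text \<open>Let \<open>g\<close> be a word moving at most \<open>0.63 n\<close> points, \<open>h\<close> a random word of polynomial length in the
  generators, \<open>b = h^-1 g h\<close> and \<open>u\<close> the commutator of \<open>g\<close> with \<open>b^-1 g b\<close>. Random words are equidistributed
  on \<open>k\<close>-tuples for every fixed \<open>k\<close>, so for a fixed number of steps \<open>h\<close> may be revealed lazily, like a uniformly
  random bijection: every newly met point is fixed by \<open>g\<close> with probability \<open>p\<close> (the density of fixed points) and otherwise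
  lies on a new cycle of \<open>g\<close>. The expected density of points on a \<open>u\<close>-orbit of length at most 5 is thereby bounded
  below by a polynomial in \<open>p\<close>. This polynomial exceeds \<open>p\<close> by a fixed proportion of \<open>1 - p\<close> as long as
  \<open>0.37 \<le> p\<close>, so for a suitable \<open>h\<close> the element \<open>u ^^ 60\<close> moves fewer points than \<open>g\<close> by a constant factor.
  It is kept nontrivial by prescribing \<open>h\<close> on boundedly many points so that \<open>u\<close> has an orbit of length 7.
  Points of \<open>g\<close> on cycles of length 2 or 3 behave differently: if there are many, \<open>g\<^sup>2\<close> or \<open>g\<^sup>3\<close> already moves fewer
  points, unless it is trivial, in which case the exploration is repeated for elements of order 2 or 3.
  After \<open>O(ln n)\<close> rounds, each multiplying the length by a constant, the support is bounded;
  a commutator of two conjugates whose supports meet in one point is then a 3-cycle, and the 3-cycles give everything.\<close>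

text \<open>The mixing bound is polynomial in the number of objects acted on. The group may have
  \<open>n!\<close> elements, but there are at most \<open>n ^ j\<close> tuples of length
  \<open>j\<close>; this is why \<open>h\<close> is inspected at boundedly many points only and why
  only orbits of bounded length are counted. Since a lower bound for an expectation suffices, any
  branch of the exploration may be given up, and what remains is a finite certificate checked by
  evaluation. The gain must be proportional to \<open>1 - p\<close>: the polynomial and
  \<open>p\<close> meet at \<open>p = 1\<close>, and only a proportional gain shrinks sparse
  supports geometrically. The constant 0.63 comes from elements without short cycles: at moved
  density \<open>a = 0.63\<close> the polynomial of \<open>tree_long\<close> is about 0.3707,
  against \<open>1 - a = 0.37\<close>. Orders 2 and 3 leave more room. A large expected number of
  fixed points of \<open>u ^^ 60\<close> does not rule out the identity. So there are two
  explorations: one merely yields some \<open>h0\<close> with the orbit of length 7, the other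
  averages over those \<open>h\<close> that agree with \<open>h0\<close> along 60 iterates of
  \<open>u\<close> on it.\<close>

section \<open>Symbolic exploration of a word\<close>

text \<open>A permutation \<open>h\<close> maps positions (side \<open>False\<close>) to labels (side \<open>True\<close>). \<open>Forward\<close> and \<open>Backward\<close> apply
  \<open>g\<close> and its inverse on the current side, \<open>Cross\<close> changes sides along \<open>h\<close>; the conjugate of \<open>g\<close> by \<open>h\<close> is thus
  \<open>Cross, Forward, Cross\<close>. \<open>Apart\<close> and \<open>Close\<close> compare the current point with the starting point.\<close>

datatype step = Forward | Backward | Cross | Apart | Close

datatype tree = Closed | Dead | Branch tree tree

text \<open>A tree records the answers for which an exploration is followed: at each newly met point, the left branch
  is taken if \<open>g\<close> fixes it and the right branch if not.

  A vertex \<open>(s, f, i, d)\<close> stands for the point \<open>(g ^^ d) (\<rho> i)\<close> on side \<open>s\<close>, where \<open>f\<close> tells whether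
  the \<open>i\<close>-th root \<open>\<rho> i\<close> is fixed by \<open>g\<close>. The parameter \<open>r\<close> is the order of \<open>g\<close> if that is 2 or 3; for \<open>r = 0\<close> the moved
  points met lie on cycles of length at least 4. In that case offsets start at 10, so that the truncated subtraction in
  \<open>ret\<close> is harmless, and different offsets on a cycle are known to give different points only if they differ by at most 3.\<close>

type_synonym vertex = "bool \<times> bool \<times> nat \<times> nat"

definition base :: "nat \<Rightarrow> nat" where
  "base r = (if r = 0 then 10 else 0)"

fun adv :: "nat \<Rightarrow> vertex \<Rightarrow> vertex" where
  "adv r (s, f, i, d) = (s, f, i, if f then d else if r = 0 then Suc d else Suc d mod r)"

fun ret :: "nat \<Rightarrow> vertex \<Rightarrow> vertex" where
  "ret r (s, f, i, d) = (s, f, i, if f then d else if r = 0 then d - 1 else (d + r - 1) mod r)"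

fun in_window :: "nat \<Rightarrow> vertex \<Rightarrow> bool" where
  "in_window r (s, f, i, d) = (f \<or> r \<noteq> 0 \<or> 0 < d \<and> d < 20)"

fun apart :: "nat \<Rightarrow> vertex \<Rightarrow> vertex \<Rightarrow> bool" where
  "apart r (s, f, i, d) (s', f', i', d') =
     (s \<noteq> s' \<or> i \<noteq> i' \<or> \<not> f \<and> d \<noteq> d' \<and> (r \<noteq> 0 \<or> d \<le> d' + 3 \<and> d' \<le> d + 3))"

text \<open>\<open>m\<close> lists the known values of \<open>h\<close> as pairs (position, label),
  so a label is looked up in the swapped pairs.\<close>

definition mate :: "(vertex \<times> vertex) list \<Rightarrow> vertex \<Rightarrow> vertex option" where
  "mate m c = (if fst c then map_of (map prod.swap m) c else map_of m c)"

definition fresh :: "nat \<Rightarrow> (vertex \<times> vertex) list \<Rightarrow> vertex \<Rightarrow> bool \<Rightarrow> vertex" where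
  "fresh r m c f = (\<not> fst c, f, Suc (length m), base r)"

definition add_pair :: "vertex \<Rightarrow> vertex \<Rightarrow> (vertex \<times> vertex) list \<Rightarrow> (vertex \<times> vertex) list" where
  "add_pair c c' m = (if fst c then (c', c) # m else (c, c') # m)"

text \<open>A missing entry in \<open>m\<close> does not yet make \<open>c\<close> a new point:
  distant offsets on one cycle may name the same point. Only a point provably different from all
  queried ones has an undetermined image.\<close>

definition separated :: "nat \<Rightarrow> (vertex \<times> vertex) list \<Rightarrow> vertex \<Rightarrow> bool" where
  "separated r m c = list_all (\<lambda>e. apart r c (if fst c then snd e else fst e)) m"

text \<open>\<open>Dead\<close> is accepted everywhere because only a lower bound is claimed. A
  crossing at a point with known image uses up no branching of the tree. A failed
  \<open>Close\<close> needs no proof of inequality: should the points coincide after all, the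
  concrete run in \<open>closes\<close> succeeds even earlier.\<close>

fun valid_from :: "nat \<Rightarrow> vertex \<Rightarrow> step list \<Rightarrow> vertex \<Rightarrow> (vertex \<times> vertex) list \<Rightarrow> tree \<Rightarrow> bool" where
  "valid_from r c0 w c m Dead = True"
| "valid_from r c0 [] c m Closed = False"
| "valid_from r c0 [] c m (Branch a b) = False"
| "valid_from r c0 (Forward # w) c m t = (if in_window r c then valid_from r c0 w (adv r c) m t else False)"
| "valid_from r c0 (Backward # w) c m t = (if in_window r c then valid_from r c0 w (ret r c) m t else False)"
| "valid_from r c0 (Cross # w) c m Closed = (case mate m c of Some c' \<Rightarrow> valid_from r c0 w c' m Closed | None \<Rightarrow> False)"
| "valid_from r c0 (Cross # w) c m (Branch a b) =
     (case mate m c of Some c' \<Rightarrow> valid_from r c0 w c' m (Branch a b)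
      | None \<Rightarrow> if separated r m c then
          (if valid_from r c0 w (fresh r m c True) (add_pair c (fresh r m c True) m) a
           then valid_from r c0 w (fresh r m c False) (add_pair c (fresh r m c False) m) b else False) else False)"
| "valid_from r c0 (Apart # w) c m t = (if apart r c c0 then valid_from r c0 w c m t else False)"
| "valid_from r c0 (Close # w) c m Closed = (if c = c0 then True else valid_from r c0 w c m Closed)"
| "valid_from r c0 (Close # w) c m (Branch a b) = (if c = c0 then False else valid_from r c0 w c m (Branch a b))"

definition start :: "nat \<Rightarrow> bool \<Rightarrow> vertex" where
  "start r f = (False, f, 0, base r)"

fun valid :: "nat \<Rightarrow> step list \<Rightarrow> tree \<Rightarrow> bool" where
  "valid r w (Branch a b) = (valid_from r (start r True) w (start r True) [] a \<and> valid_from r (start r False) w (start r False) [] b)"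
| "valid r w t = False"

text \<open>With \<open>c = b^-1 g b\<close> this spells \<open>c^-1 g^-1 c g\<close>, rightmost
  letter first; each of the four letters \<open>b\<close> or \<open>b^-1\<close> takes three
  steps.\<close>

definition round_steps :: "step list" where
  "round_steps = [Forward, Cross, Forward, Cross, Forward, Cross, Backward, Cross,
     Backward, Cross, Forward, Cross, Backward, Cross, Backward, Cross]"

text \<open>The probability of reaching \<open>Closed\<close> if a new point is fixed with
  probability \<open>P\<close> and is a usable moved point with probability \<open>Q\<close>.
  \<open>P + Q < 1\<close> is allowed: the deficit pays for points to be avoided and, if
  \<open>r = 0\<close>, for moved points on cycles of length 2 or 3.\<close>

fun val :: "tree \<Rightarrow> real \<Rightarrow> real \<Rightarrow> real" where
  "val Closed P Q = 1"
| "val Dead P Q = 0"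
| "val (Branch a b) P Q = P * val a P Q + Q * val b P Q"

fun closes :: "('a \<Rightarrow> 'a) \<Rightarrow> ('a \<Rightarrow> 'a) \<Rightarrow> bool \<times> 'a \<Rightarrow> step list \<Rightarrow> bool \<times> 'a \<Rightarrow> bool" where
  "closes g h c0 [] c = False"
| "closes g h c0 (Forward # w) c = closes g h c0 w (fst c, g (snd c))"
| "closes g h c0 (Backward # w) c = closes g h c0 w (fst c, inv' g (snd c))"
| "closes g h c0 (Cross # w) c = closes g h c0 w (\<not> fst c, if fst c then inv' h (snd c) else h (snd c))"
| "closes g h c0 (Apart # w) c = (c \<noteq> c0 \<and> closes g h c0 w c)"
| "closes g h c0 (Close # w) c = (c = c0 \<or> closes g h c0 w c)"

lemma val_nonneg: "0 \<le> P \<Longrightarrow> 0 \<le> Q \<Longrightarrow> 0 \<le> val t P Q"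
  by (induction t) auto

lemma val_le_1: "0 \<le> P \<Longrightarrow> 0 \<le> Q \<Longrightarrow> P + Q \<le> 1 \<Longrightarrow> val t P Q \<le> 1"
proof (induction t)
  case (Branch a b)
  then have "P * val a P Q + Q * val b P Q \<le> P * 1 + Q * 1" by (intro add_mono mult_left_mono) auto
  then show ?case using Branch by simp
qed auto

lemma val_mono:
  "0 \<le> P \<Longrightarrow> 0 \<le> Q \<Longrightarrow> P \<le> p \<Longrightarrow> Q \<le> q \<Longrightarrow> val t P Q \<le> val t p q"
  by (induction t) (auto intro!: add_mono mult_mono val_nonneg)

fun height :: "tree \<Rightarrow> nat" where
  "height Closed = 0"
| "height Dead = 0"
| "height (Branch a b) = Suc (max (height a) (height b))"

text \<open>Every branching on a path loses at most the total change of the two probabilities, and a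
  path has at most \<open>height t\<close> of them. This carries the bound from the ideal densities
  to those left after exclusions.\<close>

lemma val_lipschitz:
  assumes "0 \<le> P" "0 \<le> Q" "P \<le> p" "Q \<le> q" "p + q \<le> 1"
  shows "val t p q - val t P Q \<le> real (height t) * ((p - P) + (q - Q))"
proof (induction t)
  case (Branch a b)
  let ?e = "(p - P) + (q - Q)" and ?h = "real (max (height a) (height b))"
  have e: "?e \<ge> 0" using assms by simp
  have a: "val a p q - val a P Q \<le> ?h * ?e" "val b p q - val b P Q \<le> ?h * ?e"
    using Branch e by (meson max.cobounded1 max.cobounded2 mult_right_mono of_nat_mono order.trans)+
  have v1: "val a p q \<le> 1" "val b p q \<le> 1" using assms by (auto intro!: val_le_1)
  have "val (Branch a b) p q - val (Branch a b) P Q =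
      (p - P) * val a p q + (q - Q) * val b p q + P * (val a p q - val a P Q) + Q * (val b p q - val b P Q)"
    by (simp add: algebra_simps)
  also have "\<dots> \<le> (p - P) * 1 + (q - Q) * 1 + P * (?h * ?e) + Q * (?h * ?e)"
    using assms by (intro add_mono mult_left_mono v1 a) auto
  also have "\<dots> = ?e + (P + Q) * (?h * ?e)" by (simp add: algebra_simps)
  also have "\<dots> \<le> ?e + 1 * (?h * ?e)" using assms e by (intro add_left_mono mult_right_mono) auto
  finally show ?case by (simp add: algebra_simps)
qed auto

section \<open>Counting permutations along an exploration\<close>

lemma funpow_inv_cancel:
  assumes "bij g"
  shows "(inv' g ^^ d) ((g ^^ d) x) = x" "(g ^^ d) ((inv' g ^^ d) x) = x"
proof -
  show "(inv' g ^^ d) ((g ^^ d) x) = x"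
    using assms by (induction d arbitrary: x) (auto simp: funpow_swap1 bij_is_inj)
  show "(g ^^ d) ((inv' g ^^ d) x) = x"
    using assms by (induction d arbitrary: x) (auto simp: funpow_swap1 bij_is_surj surj_f_inv_f)
qed

lemma permutes_funpow_in: "p permutes S \<Longrightarrow> x \<in> S \<Longrightarrow> (p ^^ d) x \<in> S"
  by (induction d) (auto simp: permutes_in_image)

text \<open>\<open>D\<close> is a lower bound for \<open>n ^ j\<close> times the number of members of the family that send a given \<open>j\<close>-tuple to
  another one, \<open>A\<close> contains the points excluded from this (where the family is prescribed), and \<open>K\<close> bounds the number of
  points that have to be avoided when a new point is chosen.\<close>

locale exploration =
  fixes n :: nat and g :: "nat \<Rightarrow> nat" and r :: nat and I :: "'i set" and hh :: "'i \<Rightarrow> nat \<Rightarrow> nat"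
    and A :: "bool \<Rightarrow> nat set" and k K :: nat and D P Q :: real
  assumes g: "g permutes {1..n}" and n: "n > 0"
    and fin: "finite I" and hperm: "\<And>i. i \<in> I \<Longrightarrow> hh i permutes {1..n}"
    and r: "r = 0 \<or> (r = 2 \<or> r = 3) \<and> g ^^ r = id"
    and D: "D \<ge> 0"
    and unif: "\<And>xs ys. distinct xs \<Longrightarrow> distinct ys \<Longrightarrow> length xs = length ys \<Longrightarrow> length xs \<le> k \<Longrightarrow>
        set xs \<subseteq> {1..n} - A False \<Longrightarrow> set ys \<subseteq> {1..n} - A True \<Longrightarrow>
        D \<le> real n ^ length xs * real (card {i \<in> I. map (hh i) xs = ys})"
    and finA: "\<And>s. finite (A s)"
    and K: "\<And>s. Suc k * 441 + 21 * card (A s) \<le> K"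
    and P: "P \<ge> 0" "real n * P + real K \<le> real (card {x \<in> {1..n}. g x = x})"
    and Q: "Q \<ge> 0" "real n * Q + real K \<le> real (card {x \<in> {1..n}. g x \<noteq> x \<and>
        (r = 0 \<longrightarrow> (g ^^ 2) x \<noteq> x \<and> (g ^^ 3) x \<noteq> x)})"
begin

definition good :: "nat \<Rightarrow> bool" where
  "good x \<longleftrightarrow> g x \<noteq> x \<and> (r = 0 \<longrightarrow> (g ^^ 2) x \<noteq> x \<and> (g ^^ 3) x \<noteq> x)"

definition pt :: "(nat \<Rightarrow> nat) \<Rightarrow> vertex \<Rightarrow> nat" where
  "pt \<rho> = (\<lambda>(s, f, i, d). (g ^^ d) (\<rho> i))"

lemma pt_simp [simp]: "pt \<rho> (s, f, i, d) = (g ^^ d) (\<rho> i)"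
  by (simp add: pt_def)

lemma bij_g: "bij g" and inj_g: "inj g"
  using g by (auto intro: permutes_bij permutes_inj)

lemma inj_pow: "inj (g ^^ d)"
  using inj_g by (rule inj_fn)

lemma good_pow: "good ((g ^^ d) x) \<longleftrightarrow> good x"
proof -
  have "(g ^^ e) ((g ^^ d) x) = (g ^^ d) x \<longleftrightarrow> (g ^^ e) x = x" for e
  proof -
    have "(g ^^ e) ((g ^^ d) x) = (g ^^ d) ((g ^^ e) x)"
      by (metis add.commute comp_apply funpow_add)
    then show ?thesis using inj_eq[OF inj_pow[of d], of "(g ^^ e) x" x] by (simp only:)
  qed
  from this[of 1] this[of 2] this[of 3] show ?thesis by (simp add: good_def)
qed

text \<open>For \<open>r = 3\<close>, \<open>good\<close> only says that \<open>g\<close> moves the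
  point; a point fixed by both \<open>g ^^ 2\<close> and \<open>g ^^ 3\<close> would be fixed by
  \<open>g\<close>.\<close>

lemma good_low:
  assumes "good x" "e > 0" "e \<le> 3" "r \<noteq> 0 \<longrightarrow> e < r"
  shows "(g ^^ e) x \<noteq> x"
proof
  assume eq: "(g ^^ e) x = x"
  have 1: "g x \<noteq> x" using assms by (simp add: good_def)
  have cs: "e = 1 \<or> e = 2 \<or> e = 3" using assms(2,3) by linarith
  consider "e = 1" | "e = 2" "r = 0" | "e = 3" "r = 0" | "e = 2" "r = 3"
    using cs assms(4) r by fastforce
  then show False
  proof cases
    case 4
    then have "(g ^^ 3) x = x" using r by simp
    moreover have "(g ^^ 3) x = g ((g ^^ 2) x)" by (simp add: numeral_eq_Suc)
    ultimately show False using eq 4 1 by simp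
  next
    case 1
    then show False using eq \<open>g x \<noteq> x\<close> by simp
  next
    case 2
    then show False using assms(1) eq unfolding good_def by blast
  next
    case 3
    then show False using assms(1) eq unfolding good_def by blast
  qed
qed

text \<open>Each root reserves the stretch of its orbit with offsets 0 to 20. Stretches of different
  roots on one side are disjoint and miss \<open>A\<close>, so vertices with different roots stand
  for different points even if both roots lie on one cycle of \<open>g\<close>. \<open>sd\<close>
  and \<open>tp\<close> give the side and the type of each root.\<close>

definition consistent where
  "consistent m V \<rho> sd tp \<longleftrightarrow>
     (\<forall>s f i d. (s, f, i, d) \<in> V \<longrightarrow> i \<le> length m \<and> s = sd i \<and> f = tp i \<and> d \<le> 20 \<and> (r \<noteq> 0 \<longrightarrow> d < r)
        \<and> (f \<longrightarrow> d = base r)) \<and>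
     (\<forall>i \<le> length m. \<rho> i \<in> {1..n} \<and> (tp i \<longrightarrow> g (\<rho> i) = \<rho> i) \<and> (\<not> tp i \<longrightarrow> good (\<rho> i)) \<and>
        (\<forall>d\<le>20. (g ^^ d) (\<rho> i) \<notin> A (sd i))) \<and>
     (\<forall>i \<le> length m. \<forall>j \<le> length m. i \<noteq> j \<longrightarrow> sd i = sd j \<longrightarrow>
        (\<forall>d\<le>20. \<forall>d'\<le>20. (g ^^ d) (\<rho> i) \<noteq> (g ^^ d') (\<rho> j))) \<and>
     (\<forall>e \<in> set m. \<not> fst (fst e) \<and> fst (snd e)) \<and>
     fst ` set m \<subseteq> V \<and> snd ` set m \<subseteq> V \<and>
     distinct (map (pt \<rho> \<circ> fst) m) \<and> distinct (map (pt \<rho> \<circ> snd) m)"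

lemma
  assumes "consistent m V \<rho> sd tp"
  shows consistent_vertex: "(s, f, i, d) \<in> V \<Longrightarrow> i \<le> length m \<and> s = sd i \<and> f = tp i \<and> d \<le> 20 \<and> (r \<noteq> 0 \<longrightarrow> d < r) \<and> (f \<longrightarrow> d = base r)"
    and consistent_root: "i \<le> length m \<Longrightarrow> \<rho> i \<in> {1..n} \<and> (tp i \<longrightarrow> g (\<rho> i) = \<rho> i) \<and> (\<not> tp i \<longrightarrow> good (\<rho> i)) \<and>
        (\<forall>d\<le>20. (g ^^ d) (\<rho> i) \<notin> A (sd i))"
    and consistent_sep: "i \<le> length m \<Longrightarrow> j \<le> length m \<Longrightarrow> i \<noteq> j \<Longrightarrow> sd i = sd j \<Longrightarrow> d \<le> 20 \<Longrightarrow> d' \<le> 20 \<Longrightarrow>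
        (g ^^ d) (\<rho> i) \<noteq> (g ^^ d') (\<rho> j)"
    and consistent_side: "e \<in> set m \<Longrightarrow> \<not> fst (fst e) \<and> fst (snd e)"
    and consistent_subset: "fst ` set m \<subseteq> V" "snd ` set m \<subseteq> V"
    and consistent_distinct: "distinct (map (pt \<rho> \<circ> fst) m)" "distinct (map (pt \<rho> \<circ> snd) m)"
proof -
  note I = assms[unfolded consistent_def]
  note I2 = I[THEN conjunct2] note I3 = I2[THEN conjunct2] note I4 = I3[THEN conjunct2]
  note I5 = I4[THEN conjunct2] note I6 = I5[THEN conjunct2] note I7 = I6[THEN conjunct2]
  show "(s, f, i, d) \<in> V \<Longrightarrow> i \<le> length m \<and> s = sd i \<and> f = tp i \<and> d \<le> 20 \<and> (r \<noteq> 0 \<longrightarrow> d < r) \<and> (f \<longrightarrow> d = base r)"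
    by (rule I[THEN conjunct1, rule_format])
  show "i \<le> length m \<Longrightarrow> \<rho> i \<in> {1..n} \<and> (tp i \<longrightarrow> g (\<rho> i) = \<rho> i) \<and> (\<not> tp i \<longrightarrow> good (\<rho> i)) \<and>
        (\<forall>d\<le>20. (g ^^ d) (\<rho> i) \<notin> A (sd i))"
    by (rule I2[THEN conjunct1, THEN spec, THEN mp])
  show "i \<le> length m \<Longrightarrow> j \<le> length m \<Longrightarrow> i \<noteq> j \<Longrightarrow> sd i = sd j \<Longrightarrow> d \<le> 20 \<Longrightarrow> d' \<le> 20 \<Longrightarrow>
        (g ^^ d) (\<rho> i) \<noteq> (g ^^ d') (\<rho> j)"
    by (rule I3[THEN conjunct1, rule_format])
  show "e \<in> set m \<Longrightarrow> \<not> fst (fst e) \<and> fst (snd e)" by (rule I4[THEN conjunct1, THEN bspec])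
  show "fst ` set m \<subseteq> V" by (rule I5[THEN conjunct1])
  show "snd ` set m \<subseteq> V" by (rule I6[THEN conjunct1])
  show "distinct (map (pt \<rho> \<circ> fst) m)" by (rule I7[THEN conjunct1])
  show "distinct (map (pt \<rho> \<circ> snd) m)" by (rule I7[THEN conjunct2])
qed

lemma pow_fixed: "g x = x \<Longrightarrow> (g ^^ d) x = x"
  by (induction d) auto

lemma pow_in: "x \<in> {1..n} \<Longrightarrow> (g ^^ d) x \<in> {1..n}"
  using g by (rule permutes_funpow_in)

lemma pow_mod: "r \<noteq> 0 \<Longrightarrow> (g ^^ (d mod r)) x = (g ^^ d) x"
  using r by (intro funpow_mod_eq) auto

lemma pt_in:
  assumes "consistent m V \<rho> sd tp" "v \<in> V"
  shows "pt \<rho> v \<in> {1..n} - A (fst v)"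
proof -
  obtain s f i d where v: "v = (s, f, i, d)" by (cases v)
  have "i \<le> length m" "s = sd i" "d \<le> 20" using consistent_vertex[OF assms(1)] assms(2) v by blast+
  then show ?thesis using consistent_root[OF assms(1), of i] pow_in[of "\<rho> i" d] by (simp add: v)
qed

text \<open>Different roots are told apart by their reserved stretches, different offsets from one
  root by the absence of short cycles.\<close>

lemma apart_pt:
  assumes "consistent m V \<rho> sd tp" "p \<in> V" "q \<in> V" "apart r p q" "fst p = fst q"
  shows "pt \<rho> p \<noteq> pt \<rho> q"
proof -
  obtain s f i d where p: "p = (s, f, i, d)" by (cases p)
  obtain s' f' j e where q: "q = (s', f', j, e)" by (cases q)
  note vp = consistent_vertex[OF assms(1) assms(2)[unfolded p]] and vq = consistent_vertex[OF assms(1) assms(3)[unfolded q]]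
  show ?thesis
  proof (cases "i = j")
    case False
    then show ?thesis using consistent_sep[OF assms(1)] vp vq assms(5) p q by auto
  next
    case True
    with assms(4,5) p q have f: "\<not> f" "d \<noteq> e" "r \<noteq> 0 \<or> d \<le> e + 3 \<and> e \<le> d + 3" by auto
    have gd: "good (\<rho> i)" using consistent_root[OF assms(1), of i] vp f by auto
    have *: "(g ^^ a) (\<rho> i) \<noteq> (g ^^ b) (\<rho> i)" if "a < b" "r \<noteq> 0 \<longrightarrow> b < r" "r = 0 \<longrightarrow> b \<le> a + 3" for a b
    proof
      assume "(g ^^ a) (\<rho> i) = (g ^^ b) (\<rho> i)"
      also have "(g ^^ b) (\<rho> i) = (g ^^ (a + (b - a))) (\<rho> i)" using that by simp
      also have "\<dots> = (g ^^ a) ((g ^^ (b - a)) (\<rho> i))" by (simp only: funpow_add comp_apply)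
      finally have "\<rho> i = (g ^^ (b - a)) (\<rho> i)" by (rule injD[OF inj_pow])
      then have "(g ^^ (b - a)) (\<rho> i) = \<rho> i" by (rule sym)
      moreover have "b - a \<le> 3" using that r by auto
      ultimately show False using good_low[OF gd, of "b - a"] that by fastforce
    qed
    have "(g ^^ d) (\<rho> i) \<noteq> (g ^^ e) (\<rho> i)"
    proof (cases "d < e")
      case True
      have "r \<noteq> 0 \<longrightarrow> e < r" "r = 0 \<longrightarrow> e \<le> d + 3" using f(3) vq by blast+
      then show ?thesis using * True by blast
    next
      case False
      have "r \<noteq> 0 \<longrightarrow> d < r" "r = 0 \<longrightarrow> d \<le> e + 3" "e < d"
        using f(2,3) vp False by (blast, blast, simp)
      then have "(g ^^ e) (\<rho> i) \<noteq> (g ^^ d) (\<rho> i)" using * by blast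
      then show ?thesis by (rule not_sym)
    qed
    then show ?thesis unfolding p q pt_simp \<open>i = j\<close> .
  qed
qed

lemma consistentI:
  assumes "\<And>s f i d. (s, f, i, d) \<in> V \<Longrightarrow> i \<le> length m \<and> s = sd i \<and> f = tp i \<and> d \<le> 20 \<and> (r \<noteq> 0 \<longrightarrow> d < r)
        \<and> (f \<longrightarrow> d = base r)"
    and "\<And>i. i \<le> length m \<Longrightarrow> \<rho> i \<in> {1..n} \<and> (tp i \<longrightarrow> g (\<rho> i) = \<rho> i) \<and> (\<not> tp i \<longrightarrow> good (\<rho> i)) \<and>
        (\<forall>d\<le>20. (g ^^ d) (\<rho> i) \<notin> A (sd i))"
    and "\<And>i j d d'. i \<le> length m \<Longrightarrow> j \<le> length m \<Longrightarrow> i \<noteq> j \<Longrightarrow> sd i = sd j \<Longrightarrow> d \<le> 20 \<Longrightarrow> d' \<le> 20 \<Longrightarrow>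
        (g ^^ d) (\<rho> i) \<noteq> (g ^^ d') (\<rho> j)"
    and "\<And>e. e \<in> set m \<Longrightarrow> \<not> fst (fst e) \<and> fst (snd e)"
    and "fst ` set m \<subseteq> V" "snd ` set m \<subseteq> V"
    and "distinct (map (pt \<rho> \<circ> fst) m)" "distinct (map (pt \<rho> \<circ> snd) m)"
  shows "consistent m V \<rho> sd tp"
  unfolding consistent_def
  apply (intro conjI)
  subgoal by (intro allI impI) (rule assms(1))
  subgoal by (intro allI impI, rule assms(2))
  subgoal by (intro allI impI) (rule assms(3))
  subgoal by (intro ballI) (rule assms(4))
  subgoal by (rule assms(5))
  subgoal by (rule assms(6))
  subgoal by (rule assms(7))
  subgoal by (rule assms(8))
  done

lemma consistent_cong:
  assumes inv: "consistent m (insert c V) \<rho> sd tp"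
    and new: "\<And>s f i d. c' = (s, f, i, d) \<Longrightarrow> i \<le> length m \<and> s = sd i \<and> f = tp i \<and> d \<le> 20 \<and> (r \<noteq> 0 \<longrightarrow> d < r)
        \<and> (f \<longrightarrow> d = base r)"
    and sub: "fst ` set m \<subseteq> V" "snd ` set m \<subseteq> V"
  shows "consistent m (insert c' V) \<rho> sd tp"
proof (rule consistentI)
  fix s f i d assume "(s, f, i, d) \<in> insert c' V"
  then show "i \<le> length m \<and> s = sd i \<and> f = tp i \<and> d \<le> 20 \<and> (r \<noteq> 0 \<longrightarrow> d < r) \<and> (f \<longrightarrow> d = base r)"
    using new[of s f i d] consistent_vertex[OF inv, of s f i d] by (metis insert_iff)
next
  show "fst ` set m \<subseteq> insert c' V" "snd ` set m \<subseteq> insert c' V" using sub by auto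
qed (use consistent_root[OF inv] consistent_sep[OF inv] consistent_side[OF inv] consistent_distinct[OF inv] in blast)+

lemma consistent_step:
  assumes inv: "consistent m (insert c V) \<rho> sd tp" and "in_window r c"
    and sub: "fst ` set m \<subseteq> V" "snd ` set m \<subseteq> V"
  shows "consistent m (insert (adv r c) V) \<rho> sd tp" "pt \<rho> (adv r c) = g (pt \<rho> c)" "fst (adv r c) = fst c"
    and "consistent m (insert (ret r c) V) \<rho> sd tp" "pt \<rho> (ret r c) = inv' g (pt \<rho> c)" "fst (ret r c) = fst c"
proof -
  obtain s f i d where c: "c = (s, f, i, d)" by (cases c)
  have v: "i \<le> length m \<and> s = sd i \<and> f = tp i \<and> d \<le> 20 \<and> (r \<noteq> 0 \<longrightarrow> d < r) \<and> (f \<longrightarrow> d = base r)"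
    using consistent_vertex[OF inv] c by blast
  have r3: "r \<le> 3" using r by auto
  have fx: "f \<Longrightarrow> g (\<rho> i) = \<rho> i" using consistent_root[OF inv] v by blast
  have ig: "inv' g (g x) = x" "g (inv' g x) = x" for x
    using bij_g by (auto simp: bij_is_inj bij_is_surj surj_f_inv_f)
  show "fst (adv r c) = fst c" "fst (ret r c) = fst c" by (simp_all add: c)
  show "consistent m (insert (adv r c) V) \<rho> sd tp"
    by (rule consistent_cong[OF inv _ sub]) (use v \<open>in_window r c\<close> r3 in \<open>auto simp: c split: if_splits intro: less_imp_le[OF less_le_trans[OF mod_less_divisor]]\<close>)
  show "consistent m (insert (ret r c) V) \<rho> sd tp"
    by (rule consistent_cong[OF inv _ sub]) (use v \<open>in_window r c\<close> r3 in \<open>auto simp: c split: if_splits intro: less_imp_le[OF less_le_trans[OF mod_less_divisor]]\<close>)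
  show "pt \<rho> (adv r c) = g (pt \<rho> c)"
    using pow_mod[of "Suc d" "\<rho> i"] pow_fixed[OF fx, of d] fx by (auto simp: c)
  show "pt \<rho> (ret r c) = inv' g (pt \<rho> c)"
  proof -
    consider "f" | "\<not> f" "r = 0" "d > 0" | "\<not> f" "r \<noteq> 0" using \<open>in_window r c\<close> by (auto simp: c)
    then have "g (pt \<rho> (ret r c)) = pt \<rho> c"
    proof cases
      case 2
      then show ?thesis by (cases d) (auto simp: c)
    next
      case 3
      then have "pt \<rho> (ret r c) = (g ^^ (d + r - 1)) (\<rho> i)" using pow_mod by (simp add: c)
      then have "g (pt \<rho> (ret r c)) = (g ^^ Suc (d + r - 1)) (\<rho> i)" by simp
      also have "Suc (d + r - 1) = d + r" using 3 by simp
      also have "(g ^^ (d + r)) (\<rho> i) = (g ^^ d) (\<rho> i)"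
        using 3 pow_mod[of "d + r"] pow_mod[of d] by simp
      finally show ?thesis by (simp add: c)
    qed (use pow_fixed[OF fx] fx in \<open>auto simp: c\<close>)
    then show ?thesis using ig(1)[of "pt \<rho> (ret r c)"] by (simp only:)
  qed
qed


definition vertices :: "vertex \<Rightarrow> (vertex \<times> vertex) list \<Rightarrow> vertex set" where
  "vertices c0 m = insert c0 (fst ` set m \<union> snd ` set m)"

text \<open>The root of a new point \<open>z\<close> lies \<open>base r\<close> steps behind it.
  These are the \<open>z\<close> whose stretch would meet an earlier one or the excluded set; each
  offset has 21 values, whence \<open>441 = 21 * 21\<close> and \<open>21\<close> in the bound on
  \<open>K\<close>.\<close>

definition avoid :: "nat \<Rightarrow> (nat \<Rightarrow> nat) \<Rightarrow> bool \<Rightarrow> nat set" where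
  "avoid l \<rho> s = (\<lambda>(i, d, d'). (g ^^ base r) ((inv' g ^^ d) ((g ^^ d') (\<rho> i)))) ` ({..l} \<times> {..20} \<times> {..20}) \<union>
     (\<lambda>(d, a). (g ^^ base r) ((inv' g ^^ d) a)) ` ({..20} \<times> A s)"

lemma card_avoid_le:
  assumes "l \<le> k"
  shows "card (avoid l \<rho> s) \<le> K" "finite (avoid l \<rho> s)"
proof -
  show "finite (avoid l \<rho> s)" using finA by (auto simp: avoid_def)
  have "card (avoid l \<rho> s) \<le> card ({..l} \<times> {..20::nat} \<times> {..20::nat}) + card ({..20::nat} \<times> A s)"
    unfolding avoid_def by (rule order.trans[OF card_Un_le add_mono]; rule card_image_le; use finA in simp)
  also have "\<dots> \<le> Suc k * 441 + 21 * card (A s)" using assms by (simp add: card_cartesian_product)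
  finally show "card (avoid l \<rho> s) \<le> K" using K[of s] by linarith
qed

lemma card_outside_avoid:
  assumes "l \<le> k" "real n * p + real K \<le> real (card {x \<in> {1..n}. R x})"
  shows "real n * p \<le> real (card ({x \<in> {1..n}. R x} - avoid l \<rho> s))"
proof -
  have "card {x \<in> {1..n}. R x} \<le> card ({x \<in> {1..n}. R x} - avoid l \<rho> s) + card (avoid l \<rho> s)"
    using diff_card_le_card_Diff[OF card_avoid_le(2)[OF assms(1)], of "{x \<in> {1..n}. R x}" \<rho> s] by linarith
  then show ?thesis using assms(2) card_avoid_le(1)[OF assms(1), of \<rho> s] by linarith
qed

lemma base_le: "base r \<le> 20" "r \<noteq> 0 \<Longrightarrow> base r < r"
  by (auto simp: base_def)

lemma mate_Some:
  assumes "mate m c = Some c'" "\<forall>e\<in>set m. \<not> fst (fst e) \<and> fst (snd e)"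
  shows "(if fst c then (c', c) else (c, c')) \<in> set m" "fst c' = (\<not> fst c)"
proof -
  show 1: "(if fst c then (c', c) else (c, c')) \<in> set m"
    using assms(1) by (auto simp: mate_def split: if_splits dest: map_of_SomeD)
  show "fst c' = (\<not> fst c)" using 1 assms(2) by (auto split: if_splits)
qed

definition add_root :: "(nat \<Rightarrow> nat) \<Rightarrow> nat \<Rightarrow> nat \<Rightarrow> nat \<Rightarrow> nat" where
  "add_root \<rho> l z = \<rho>(Suc l := (inv' g ^^ base r) z)"

lemma consistent_fresh:
  assumes inv: "consistent m (insert c (vertices c0 m)) \<rho> sd tp" and separated: "separated r m c"
    and z: "z \<in> {1..n}" "z \<notin> avoid (length m) \<rho> (\<not> fst c)" "f \<longrightarrow> g z = z" "\<not> f \<longrightarrow> good z"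
  defines "c' \<equiv> fresh r m c f" and "\<rho>' \<equiv> add_root \<rho> (length m) z"
  shows "pt \<rho>' c' = z" "\<And>v. v \<in> insert c (vertices c0 m) \<Longrightarrow> pt \<rho>' v = pt \<rho> v"
    and "consistent (add_pair c c' m) (insert c' (vertices c0 (add_pair c c' m))) \<rho>' (sd(Suc (length m) := \<not> fst c)) (tp(Suc (length m) := f))"
proof -
  let ?l = "length m" and ?b = "(inv' g ^^ base r) z"
  have gb: "(g ^^ base r) ?b = z" by (rule funpow_inv_cancel[OF bij_g])
  show c'z: "pt \<rho>' c' = z" by (simp add: c'_def \<rho>'_def fresh_def add_root_def gb)
  show eq: "pt \<rho>' v = pt \<rho> v" if "v \<in> insert c (vertices c0 m)" for v
  proof -
    obtain s f i d where v: "v = (s, f, i, d)" by (cases v)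
    then have "i \<le> ?l" using consistent_vertex[OF inv] that by blast
    then show ?thesis by (simp add: v \<rho>'_def add_root_def)
  qed
  have zpow: "z = (g ^^ base r) ((inv' g ^^ d) x)" if "(g ^^ d) ?b = x" for d x
    using that funpow_inv_cancel(1)[OF bij_g, of d ?b] gb by simp
  have win: "(g ^^ d) ?b \<noteq> (g ^^ d') (\<rho> i)" if "i \<le> ?l" "d \<le> 20" "d' \<le> 20" for i d d'
  proof
    assume "(g ^^ d) ?b = (g ^^ d') (\<rho> i)"
    from zpow[OF this] have "z \<in> avoid ?l \<rho> (\<not> fst c)"
      unfolding avoid_def using that by (intro UnI1 image_eqI[of _ _ "(i, d, d')"]) auto
    with z show False by blast
  qed
  have winA: "(g ^^ d) ?b \<notin> A (\<not> fst c)" if "d \<le> 20" for d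
  proof
    assume a: "(g ^^ d) ?b \<in> A (\<not> fst c)"
    have "z \<in> avoid ?l \<rho> (\<not> fst c)"
      unfolding avoid_def using that a zpow[OF refl, of d]
      by (intro UnI2 image_eqI[of _ _ "(d, (g ^^ d) ?b)"]) auto
    with z show False by blast
  qed
  have bin: "?b \<in> {1..n}" by (rule permutes_funpow_in[OF permutes_inv[OF g] z(1)])
  have bfix: "f \<Longrightarrow> g ?b = ?b"
  proof -
    assume f
    then have "g z = z" using z(3) by blast
    then have "(g ^^ base r) z = z" by (rule pow_fixed)
    then have "?b = z" using funpow_inv_cancel(1)[OF bij_g, of "base r" z] by simp
    with \<open>g z = z\<close> show ?thesis by simp
  qed
  have bgood: "\<not> f \<Longrightarrow> good ?b" using z(4) good_pow[of "base r" ?b] gb by simp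
  have sides: "\<forall>e\<in>set m. \<not> fst (fst e) \<and> fst (snd e)" using consistent_side[OF inv] by blast
  have len: "length (add_pair c c' m) = Suc ?l" by (simp add: add_pair_def)
  have fc': "fst c' = (\<not> fst c)" by (simp add: c'_def fresh_def)
  have inV: "fst e \<in> vertices c0 m" "snd e \<in> vertices c0 m" if "e \<in> set m" for e
    using that by (auto simp: vertices_def)
  have m1: "map (pt \<rho>' \<circ> fst) m = map (pt \<rho> \<circ> fst) m" "map (pt \<rho>' \<circ> snd) m = map (pt \<rho> \<circ> snd) m"
    using eq inV by auto
  have newz: "z \<noteq> pt \<rho> v" if "v \<in> vertices c0 m" for v
  proof -
    obtain s f i d where v: "v = (s, f, i, d)" by (cases v)
    then have "i \<le> ?l" "d \<le> 20" using consistent_vertex[OF inv] that by blast+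
    then show ?thesis using win[of i "base r" d] base_le gb by (simp add: v)
  qed
  have newc: "pt \<rho> c \<noteq> pt \<rho> (if fst c then snd e else fst e)" if "e \<in> set m" for e
    by (rule apart_pt[OF inv]) (use that inV[OF that] separated sides in \<open>auto simp: separated_def list_all_iff\<close>)
  show "consistent (add_pair c c' m) (insert c' (vertices c0 (add_pair c c' m))) \<rho>' (sd(Suc ?l := \<not> fst c)) (tp(Suc ?l := f))"
  proof (rule consistentI, unfold len)
    fix s f' i d assume "(s, f', i, d) \<in> insert c' (vertices c0 (add_pair c c' m))"
    then have "(s, f', i, d) = c' \<or> (s, f', i, d) \<in> insert c (vertices c0 m)"
      by (auto simp: vertices_def add_pair_def split: if_splits)
    then show "i \<le> Suc ?l \<and> s = (sd(Suc ?l := \<not> fst c)) i \<and> f' = (tp(Suc ?l := f)) i \<and> d \<le> 20 \<and>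
       (r \<noteq> 0 \<longrightarrow> d < r) \<and> (f' \<longrightarrow> d = base r)"
    proof
      assume "(s, f', i, d) = c'"
      then show ?thesis using base_le by (simp add: c'_def fresh_def)
    next
      assume "(s, f', i, d) \<in> insert c (vertices c0 m)"
      from consistent_vertex[OF inv this] show ?thesis by (simp add: le_SucI)
    qed
  next
    fix i assume i: "i \<le> Suc ?l"
    show "\<rho>' i \<in> {1..n} \<and> ((tp(Suc ?l := f)) i \<longrightarrow> g (\<rho>' i) = \<rho>' i) \<and> (\<not> (tp(Suc ?l := f)) i \<longrightarrow> good (\<rho>' i)) \<and>
        (\<forall>d\<le>20. (g ^^ d) (\<rho>' i) \<notin> A ((sd(Suc ?l := \<not> fst c)) i))"
    proof (cases "i = Suc ?l")
      case True
      then show ?thesis using bin bfix bgood winA by (simp add: \<rho>'_def add_root_def)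
    next
      case False
      then show ?thesis using consistent_root[OF inv, of i] i by (simp add: \<rho>'_def add_root_def)
    qed
  next
    fix i j d d' :: nat assume ij: "i \<le> Suc ?l" "j \<le> Suc ?l" "i \<noteq> j"
      "(sd(Suc ?l := \<not> fst c)) i = (sd(Suc ?l := \<not> fst c)) j" and d: "d \<le> 20" "d' \<le> 20"
    consider "i = Suc ?l" "j \<le> ?l" | "j = Suc ?l" "i \<le> ?l" | "i \<le> ?l" "j \<le> ?l" using ij by linarith
    then show "(g ^^ d) (\<rho>' i) \<noteq> (g ^^ d') (\<rho>' j)"
    proof cases
      case 1
      then show ?thesis using win[of j d d'] d by (simp add: \<rho>'_def add_root_def)
    next
      case 2
      then show ?thesis using not_sym[OF win[of i d' d]] d by (simp add: \<rho>'_def add_root_def)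
    next
      case 3
      then show ?thesis using consistent_sep[OF inv, of i j d d'] ij d by (simp add: \<rho>'_def add_root_def)
    qed
  next
    fix e assume "e \<in> set (add_pair c c' m)"
    then show "\<not> fst (fst e) \<and> fst (snd e)" using sides fc' by (auto simp: add_pair_def split: if_splits)
  next
    show "fst ` set (add_pair c c' m) \<subseteq> insert c' (vertices c0 (add_pair c c' m))"
      "snd ` set (add_pair c c' m) \<subseteq> insert c' (vertices c0 (add_pair c c' m))" by (auto simp: vertices_def)
  next
    have nz: "z \<notin> set (map (pt \<rho> \<circ> fst) m)" "z \<notin> set (map (pt \<rho> \<circ> snd) m)"
      unfolding set_map image_iff comp_apply using newz inV by blast+
    have nc: "pt \<rho> c \<notin> set (map (pt \<rho> \<circ> (if fst c then snd else fst)) m)"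
      unfolding set_map image_iff comp_apply using newc by (cases "fst c"; simp only: if_True if_False; blast)
    have cc: "pt \<rho>' c = pt \<rho> c" by (rule eq) simp
    show "distinct (map (pt \<rho>' \<circ> fst) (add_pair c c' m))"
    proof (cases "fst c")
      case True
      then have "map (pt \<rho>' \<circ> fst) (add_pair c c' m) = z # map (pt \<rho> \<circ> fst) m"
        by (simp only: add_pair_def if_True list.map comp_apply fst_conv c'z m1)
      then show ?thesis using consistent_distinct(1)[OF inv] nz by (simp only: distinct.simps) simp
    next
      case False
      then have "map (pt \<rho>' \<circ> fst) (add_pair c c' m) = pt \<rho> c # map (pt \<rho> \<circ> fst) m"
        by (simp only: add_pair_def if_False list.map comp_apply fst_conv cc m1)
      then show ?thesis using consistent_distinct(1)[OF inv] nc False by (simp only: distinct.simps if_False) simp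
    qed
    show "distinct (map (pt \<rho>' \<circ> snd) (add_pair c c' m))"
    proof (cases "fst c")
      case False
      then have "map (pt \<rho>' \<circ> snd) (add_pair c c' m) = z # map (pt \<rho> \<circ> snd) m"
        by (simp only: add_pair_def if_False list.map comp_apply snd_conv c'z m1)
      then show ?thesis using consistent_distinct(2)[OF inv] nz by (simp only: distinct.simps) simp
    next
      case True
      then have "map (pt \<rho>' \<circ> snd) (add_pair c c' m) = pt \<rho> c # map (pt \<rho> \<circ> snd) m"
        by (simp only: add_pair_def if_True list.map comp_apply snd_conv cc m1)
      then show ?thesis using consistent_distinct(2)[OF inv] nc True by (simp only: distinct.simps if_True) simp
    qed
  qed
qed

definition agree :: "(nat \<Rightarrow> nat) \<Rightarrow> (vertex \<times> vertex) list \<Rightarrow> 'i \<Rightarrow> bool" where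
  "agree \<rho> m i \<longleftrightarrow> (\<forall>e\<in>set m. hh i (pt \<rho> (fst e)) = pt \<rho> (snd e))"

lemma card_agree:
  assumes "consistent m V \<rho> sd tp" "length m \<le> k"
  shows "D \<le> real n ^ length m * real (card {i \<in> I. agree \<rho> m i})"
proof -
  let ?xs = "map (pt \<rho> \<circ> fst) m" and ?ys = "map (pt \<rho> \<circ> snd) m"
  have "pt \<rho> (fst e) \<in> {1..n} - A False" "pt \<rho> (snd e) \<in> {1..n} - A True" if "e \<in> set m" for e
  proof -
    have "fst e \<in> V" "snd e \<in> V" using consistent_subset[OF assms(1)] that by blast+
    then show "pt \<rho> (fst e) \<in> {1..n} - A False" "pt \<rho> (snd e) \<in> {1..n} - A True"
      using pt_in[OF assms(1), of "fst e"] pt_in[OF assms(1), of "snd e"] consistent_side[OF assms(1) that] by simp_all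
  qed
  then have "set ?xs \<subseteq> {1..n} - A False" "set ?ys \<subseteq> {1..n} - A True"
    unfolding set_map image_subset_iff comp_apply by blast+
  then have "D \<le> real n ^ length ?xs * real (card {i \<in> I. map (hh i) ?xs = ?ys})"
    using assms(2) by (intro unif consistent_distinct[OF assms(1)]) simp_all
  also have "{i \<in> I. map (hh i) ?xs = ?ys} = {i \<in> I. agree \<rho> m i}"
    by (simp add: agree_def)
  finally show ?thesis by simp
qed

text \<open>Only a crossing at a new point splits the family. Its members are sorted by the answer
  \<open>z\<close>, for which at least \<open>n * P\<close> fixed and \<open>n * Q\<close> good
  points are admissible. Prescribing \<open>z\<close> lengthens the tuple by one and costs a factor
  \<open>n\<close>; summing over \<open>z\<close> recovers it and reproduces the recursion of
  \<open>val\<close>.\<close>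

theorem explore:
  assumes "valid_from r c0 w c m t" "consistent m (insert c (vertices c0 m)) \<rho> sd tp" "length m + length w \<le> k" "fst c0 = False"
  shows "D * val t P Q \<le> real n ^ length m *
    real (card {i \<in> I. agree \<rho> m i \<and> closes g (hh i) (False, pt \<rho> c0) w (fst c, pt \<rho> c)})"
  using assms(1-3)
proof (induction w arbitrary: c m t \<rho> sd tp)
  case Nil
  then show ?case by (cases t) auto
next
  case (Cons x w)
  note inv = Cons.prems(2)
  have sub: "fst ` set m \<subseteq> vertices c0 m" "snd ` set m \<subseteq> vertices c0 m" by (auto simp: vertices_def)
  have k: "length m + length w \<le> k" "length m \<le> k" using Cons.prems(3) by simp_all
  have mono: "real n ^ length m * real (card {i \<in> I. R i}) \<le> real n ^ length m * real (card {i \<in> I. R' i})"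
    if "\<And>i. i \<in> I \<Longrightarrow> R i \<Longrightarrow> R' i" for R R'
    using that fin by (intro mult_left_mono of_nat_mono card_mono) auto
  show ?case
  proof (cases "t = Dead")
    case False
    show ?thesis
    proof (cases x)
      case Forward
      then have "in_window r c" "valid_from r c0 w (adv r c) m t"
        using Cons.prems(1) False by (cases t; simp split: if_splits)+
      from Cons.IH[OF this(2) consistent_step(1)[OF inv this(1) sub] k(1)] consistent_step(2,3)[OF inv this(1) sub]
      show ?thesis by (simp add: Forward)
    next
      case Backward
      then have "in_window r c" "valid_from r c0 w (ret r c) m t"
        using Cons.prems(1) False by (cases t; simp split: if_splits)+
      from Cons.IH[OF this(2) consistent_step(4)[OF inv this(1) sub] k(1)] consistent_step(5,6)[OF inv this(1) sub]
      show ?thesis by (simp add: Backward)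
    next
      case Apart
      then have ap: "apart r c c0" and o: "valid_from r c0 w c m t"
        using Cons.prems(1) False by (cases t; simp split: if_splits)+
      have "(fst c, pt \<rho> c) \<noteq> (False, pt \<rho> c0)"
        using apart_pt[OF inv _ _ ap] assms(4) by (auto simp: vertices_def)
      then show ?thesis using Cons.IH[OF o inv k(1)] by (simp add: Apart)
    next
      case Close
      show ?thesis
      proof (cases "c = c0")
        case True
        then have "t = Closed" using Cons.prems(1) False Close by (cases t) simp_all
        then show ?thesis using card_agree[OF inv k(2)] True assms(4) by (simp add: Close)
      next
        case False
        then have "valid_from r c0 w c m t" using Cons.prems(1) \<open>t \<noteq> Dead\<close> Close by (cases t) simp_all
        from Cons.IH[OF this inv k(1)] show ?thesis
          by (rule order.trans) (auto intro!: mono simp: Close)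
      qed
    next
      case Cross
      show ?thesis
      proof (cases "mate m c")
        case (Some c')
        then have o: "valid_from r c0 w c' m t" using Cons.prems(1) False Cross by (cases t) simp_all
        have sd: "\<forall>e\<in>set m. \<not> fst (fst e) \<and> fst (snd e)" using consistent_side[OF inv] by blast
        note mt = mate_Some[OF Some sd]
        have "c' \<in> vertices c0 m" using mt(1) by (force simp: vertices_def split: if_splits)
        then have inv': "consistent m (insert c' (vertices c0 m)) \<rho> sd tp"
          using consistent_vertex[OF inv] by (intro consistent_cong[OF inv _ sub]) blast
        show ?thesis
        proof (rule order.trans[OF Cons.IH[OF o inv' k(1)] mono], elim conjE, intro conjI)
          fix i assume i: "i \<in> I" "agree \<rho> m i" "closes g (hh i) (False, pt \<rho> c0) w (fst c', pt \<rho> c')"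
          have "inv' (hh i) (hh i (pt \<rho> c')) = pt \<rho> c'"
            using permutes_inverses(2)[OF hperm[OF i(1)]] by simp
          then have "(if fst c then inv' (hh i) (pt \<rho> c) else hh i (pt \<rho> c)) = pt \<rho> c'"
            using i(2) mt(1) unfolding agree_def by (auto split: if_splits)
          then show "closes g (hh i) (False, pt \<rho> c0) (x # w) (fst c, pt \<rho> c)"
            using i(3) mt(2) by (cases "fst c") (simp_all add: Cross)
        qed
      next
        case None
        then obtain a b where t: "t = Branch a b" using Cons.prems(1) False Cross by (cases t) simp_all
        have fr: "separated r m c" and o: "valid_from r c0 w (fresh r m c f) (add_pair c (fresh r m c f) m) (if f then a else b)" for f
          using Cons.prems(1) None by (auto simp: t Cross split: if_splits)
        let ?N = "length m" and ?s = "\<not> fst c"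
        define T where "T = {i \<in> I. agree \<rho> m i \<and> closes g (hh i) (False, pt \<rho> c0) (x # w) (fst c, pt \<rho> c)}"
        define nxt where "nxt i = (if fst c then inv' (hh i) (pt \<rho> c) else hh i (pt \<rho> c))" for i
        define Z where "Z f = {x \<in> {1..n}. if f then g x = x else good x} - avoid ?N \<rho> ?s" for f
        have finT: "finite T" using fin by (simp add: T_def)
        have finZ: "finite (Z f)" for f by (simp add: Z_def)
        have E: "D * val (if f then a else b) P Q \<le> real n ^ Suc ?N * real (card {i \<in> T. nxt i = z})"
          if z: "z \<in> Z f" for f z
        proof -
          let ?c = "fresh r m c f" and ?\<rho> = "add_root \<rho> ?N z"
          have z': "z \<in> {1..n}" "z \<notin> avoid ?N \<rho> ?s" "f \<longrightarrow> g z = z" "\<not> f \<longrightarrow> good z"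
            using z by (auto simp: Z_def split: if_splits)
          note new = consistent_fresh[OF inv fr z']
          have len: "length (add_pair c ?c m) = Suc ?N" by (simp add: add_pair_def)
          have kk: "length (add_pair c ?c m) + length w \<le> k" using Cons.prems(3) by (simp add: add_pair_def)
          have "D * val (if f then a else b) P Q \<le> real n ^ length (add_pair c ?c m) *
            real (card {i \<in> I. agree ?\<rho> (add_pair c ?c m) i \<and> closes g (hh i) (False, pt ?\<rho> c0) w (fst ?c, pt ?\<rho> ?c)})"
            by (rule Cons.IH[OF o new(3) kk])
          also have "\<dots> \<le> real n ^ Suc ?N * real (card {i \<in> T. nxt i = z})"
            unfolding len
          proof (intro mult_left_mono of_nat_mono card_mono subsetI)
            fix i assume i: "i \<in> {i \<in> I. agree ?\<rho> (add_pair c ?c m) i \<and> closes g (hh i) (False, pt ?\<rho> c0) w (fst ?c, pt ?\<rho> ?c)}"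
            have "pt ?\<rho> (fst e) = pt \<rho> (fst e)" "pt ?\<rho> (snd e) = pt \<rho> (snd e)" if "e \<in> set m" for e
              using new(2)[of "fst e"] new(2)[of "snd e"] that by (auto simp: vertices_def)
            then have ag: "agree \<rho> m i" using i by (auto simp: agree_def add_pair_def split: if_splits)
            have c: "pt ?\<rho> c = pt \<rho> c" "pt ?\<rho> c0 = pt \<rho> c0" using new(2)[of c] new(2)[of c0] by (simp_all add: vertices_def)
            have "if fst c then hh i z = pt \<rho> c else hh i (pt \<rho> c) = z"
              using i new(1) c(1) by (auto simp: agree_def add_pair_def split: if_splits)
            then have nx: "nxt i = z"
              using permutes_inverses(2)[OF hperm[of i], of z] i by (simp add: nxt_def split: if_splits)
            then show "i \<in> {i \<in> T. nxt i = z}"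
              using i ag c(2) new(1) by (cases "fst c"; simp add: T_def Cross nxt_def; simp add: fresh_def)
          qed (use finT in simp_all)
          finally show ?thesis .
        qed
        have disj: "Z True \<inter> Z False = {}" by (auto simp: Z_def good_def)
        have "(\<Sum>z\<in>Z True \<union> Z False. card {i \<in> T. nxt i = z}) = card (\<Union>z\<in>Z True \<union> Z False. {i \<in> T. nxt i = z})"
          using finT finZ by (subst card_UN_disjoint) auto
        also have "\<dots> \<le> card T" using finT by (intro card_mono) auto
        finally have cT: "(\<Sum>z\<in>Z True. card {i \<in> T. nxt i = z}) + (\<Sum>z\<in>Z False. card {i \<in> T. nxt i = z}) \<le> card T"
          using finZ disj by (simp add: sum.union_disjoint)
        have zc: "real n * P \<le> real (card (Z True))" "real n * Q \<le> real (card (Z False))"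
          using card_outside_avoid[OF k(2) P(2)] card_outside_avoid[OF k(2) Q(2)] by (simp_all add: Z_def good_def)
        have av: "D * val a P Q \<ge> 0" "D * val b P Q \<ge> 0" using D val_nonneg[OF P(1) Q(1)] by simp_all
        have "real n * (D * val t P Q) = (real n * P) * (D * val a P Q) + (real n * Q) * (D * val b P Q)"
          by (simp add: t algebra_simps)
        also have "\<dots> \<le> real (card (Z True)) * (D * val a P Q) + real (card (Z False)) * (D * val b P Q)"
          by (intro add_mono mult_right_mono zc av)
        also have "\<dots> = (\<Sum>z\<in>Z True. D * val a P Q) + (\<Sum>z\<in>Z False. D * val b P Q)" by simp
        also have "\<dots> \<le> (\<Sum>z\<in>Z True. real n ^ Suc ?N * real (card {i \<in> T. nxt i = z})) +
            (\<Sum>z\<in>Z False. real n ^ Suc ?N * real (card {i \<in> T. nxt i = z}))"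
          using E[of _ True] E[of _ False] by (intro add_mono sum_mono) auto
        also have "\<dots> = real n ^ Suc ?N *
            real ((\<Sum>z\<in>Z True. card {i \<in> T. nxt i = z}) + (\<Sum>z\<in>Z False. card {i \<in> T. nxt i = z}))"
          by (simp add: sum_distrib_left distrib_left)
        also have "\<dots> \<le> real n ^ Suc ?N * real (card T)" using cT by (intro mult_left_mono of_nat_mono) auto
        finally have "real n * (D * val t P Q) \<le> real n * (real n ^ ?N * real (card T))" by (simp add: mult.assoc)
        then show ?thesis using n by (simp add: T_def)
      qed
    qed
  qed simp
qed

end

section \<open>Averaging over starting points and over the family\<close>

context exploration begin

text \<open>The starting point is treated like the answer to a crossing: it supplies the first
  branching of the tree.\<close>

theorem explore_start:
  assumes t: "valid r w t" and k: "length w \<le> k"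
  shows "real n * D * val t P Q \<le> (\<Sum>x\<in>{1..n}. real (card {i \<in> I. closes g (hh i) (False, x) w (False, x)}))"
proof (cases t)
  case (Branch a b)
  have o: "valid_from r (start r f) w (start r f) [] (if f then a else b)" for f
    using t by (cases f) (simp_all add: Branch)
  \<comment> \<open>There is no earlier root yet. The dummy root 0 lies outside
    \<open>{1..n}\<close> and is fixed by \<open>g\<close>, so within \<open>{1..n}\<close> only
    points leading into \<open>A False\<close> are removed.\<close>
  define Z where "Z f = {x \<in> {1..n}. if f then g x = x else good x} - avoid 0 (\<lambda>_. 0) False" for f
  let ?c = "\<lambda>x. real (card {i \<in> I. closes g (hh i) (False, x) w (False, x)})"
  have E: "D * val (if f then a else b) P Q \<le> ?c z" if z: "z \<in> Z f" for f z
  proof -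
    let ?b = "(inv' g ^^ base r) z"
    have gb: "(g ^^ base r) ?b = z" by (rule funpow_inv_cancel[OF bij_g])
    have z1: "z \<in> {1..n}" "z \<notin> avoid 0 (\<lambda>_. 0) False" using z by (auto simp: Z_def)
    have winA: "(g ^^ d) ?b \<notin> A False" if "d \<le> 20" for d
    proof
      assume a: "(g ^^ d) ?b \<in> A False"
      have "z = (g ^^ base r) ((inv' g ^^ d) ((g ^^ d) ?b))"
        using funpow_inv_cancel(1)[OF bij_g, of d ?b] gb by simp
      then have "z \<in> avoid 0 (\<lambda>_. 0) False"
        unfolding avoid_def using that a by (intro UnI2 image_eqI[of _ _ "(d, (g ^^ d) ?b)"]) auto
      with z1 show False by blast
    qed
    have bin: "?b \<in> {1..n}" by (rule permutes_funpow_in[OF permutes_inv[OF g] z1(1)])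
    have bfix: "f \<longrightarrow> g ?b = ?b"
    proof
      assume f
      then have "g z = z" using z by (simp add: Z_def)
      moreover from this have "(g ^^ base r) z = z" by (rule pow_fixed)
      then have "?b = z" using funpow_inv_cancel(1)[OF bij_g, of "base r" z] by simp
      ultimately show "g ?b = ?b" by simp
    qed
    have bgood: "\<not> f \<longrightarrow> good ?b" using z good_pow[of "base r" ?b] gb by (cases f) (simp_all add: Z_def)
    have inv: "consistent [] (insert (start r f) (vertices (start r f) [])) (\<lambda>_. ?b) (\<lambda>_. False) (\<lambda>_. f)"
      by (rule consistentI) (use base_le winA bin bfix bgood in \<open>simp_all add: start_def vertices_def\<close>)
    have "pt (\<lambda>_. ?b) (start r f) = z" by (simp add: start_def gb)
    with explore[OF o inv] k show ?thesis by (simp add: start_def agree_def)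
  qed
  have fin: "finite (Z f)" for f by (simp add: Z_def)
  have disj: "Z True \<inter> Z False = {}" by (auto simp: Z_def good_def)
  have zc: "real n * P \<le> real (card (Z True))" "real n * Q \<le> real (card (Z False))"
    using card_outside_avoid[OF _ P(2), of 0] card_outside_avoid[OF _ Q(2), of 0] by (simp_all add: Z_def good_def)
  have av: "D * val a P Q \<ge> 0" "D * val b P Q \<ge> 0" using D val_nonneg[OF P(1) Q(1)] by simp_all
  have "real n * D * val t P Q = (real n * P) * (D * val a P Q) + (real n * Q) * (D * val b P Q)"
    by (simp add: Branch algebra_simps)
  also have "\<dots> \<le> real (card (Z True)) * (D * val a P Q) + real (card (Z False)) * (D * val b P Q)"
    by (intro add_mono mult_right_mono zc av)
  also have "\<dots> = (\<Sum>z\<in>Z True. D * val a P Q) + (\<Sum>z\<in>Z False. D * val b P Q)" by simp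
  also have "\<dots> \<le> sum ?c (Z True) + sum ?c (Z False)"
    using E[of _ True] E[of _ False] by (intro add_mono sum_mono) auto
  also have "\<dots> = sum ?c (Z True \<union> Z False)" using fin disj by (simp add: sum.union_disjoint)
  also have "\<dots> \<le> sum ?c {1..n}" by (intro sum_mono2) (auto simp: Z_def)
  finally show ?thesis .
qed (use t in simp_all)

corollary explore_exists:
  assumes "valid r w t" "length w \<le> k" "I \<noteq> {}"
  obtains i where "i \<in> I" "real n * D * val t P Q \<le> real (card I) * real (card {x \<in> {1..n}. closes g (hh i) (False, x) w (False, x)})"
proof -
  let ?R = "\<lambda>i x. closes g (hh i) (False, x) w (False, x)"
  have "(\<Sum>x\<in>{1..n}. card {i \<in> I. ?R i x}) = (\<Sum>i\<in>I. card {x \<in> {1..n}. ?R i x})"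
    by (rule sum_multicount_gen) (use fin in simp_all)
  then have s: "real n * D * val t P Q \<le> (\<Sum>i\<in>I. real (card {x \<in> {1..n}. ?R i x}))"
    using explore_start[OF assms(1,2)] by (simp only: of_nat_sum[symmetric])
  have "\<exists>i\<in>I. real n * D * val t P Q \<le> real (card I) * real (card {x \<in> {1..n}. ?R i x})"
  proof (rule ccontr)
    assume "\<not> ?thesis"
    then have "real (card I) * real (card {x \<in> {1..n}. ?R i x}) < real n * D * val t P Q" if "i \<in> I" for i
      using that by (simp add: not_le)
    then have "(\<Sum>i\<in>I. real (card I) * real (card {x \<in> {1..n}. ?R i x})) < (\<Sum>i\<in>I. real n * D * val t P Q)"
      using fin assms(3) by (intro sum_strict_mono)
    also have "\<dots> = real (card I) * (real n * D * val t P Q)" by simp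
    also have "\<dots> \<le> real (card I) * (\<Sum>i\<in>I. real (card {x \<in> {1..n}. ?R i x}))" by (intro mult_left_mono s) simp
    finally show False by (simp add: sum_distrib_left)
  qed
  then show thesis using that by blast
qed

end

section \<open>Equidistribution of random words\<close>

text \<open>Cauchy-Schwarz for the differences \<open>a t - a e\<close>: the one at \<open>e\<close>
  vanishes, so the factor is \<open>card T - 1\<close>, and the spare copy of the sum of squares is
  the defect.\<close>

lemma square_sum_defect:
  fixes a :: "'t \<Rightarrow> real"
  assumes "finite T" "e \<in> T"
  shows "(\<Sum>t\<in>T. a t)\<^sup>2 \<le> real (card T) * (\<Sum>t\<in>T. (a t)\<^sup>2) - (\<Sum>t\<in>T. (a t - a e)\<^sup>2)"
proof -
  define b where "b t = a t - a e" for t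
  define c where "c = real (card T)"
  have "b e = 0" by (simp add: b_def)
  then have 1: "sum b (T - {e}) = sum b T" "sum (\<lambda>t. (b t)\<^sup>2) (T - {e}) = sum (\<lambda>t. (b t)\<^sup>2) T"
    using assms by (simp_all add: sum_diff1)
  have "c \<ge> 1" using assms by (cases "card T") (auto simp: c_def card_eq_0_iff)
  then have "(sum b T)\<^sup>2 \<le> (c - 1) * (\<Sum>t\<in>T. (b t)\<^sup>2)"
    using sum_squared_le_sum_of_squares[of b "T - {e}"] assms 1 by (simp add: c_def of_nat_diff mult.commute)
  moreover have "sum a T = sum b T + c * a e"
    by (simp add: b_def c_def sum_subtractf)
  moreover have "(\<Sum>t\<in>T. (a t)\<^sup>2) = (\<Sum>t\<in>T. (b t)\<^sup>2) + 2 * a e * sum b T + c * (a e)\<^sup>2"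
  proof -
    have "(\<Sum>t\<in>T. (a t)\<^sup>2) = (\<Sum>t\<in>T. (b t)\<^sup>2 + 2 * a e * b t + (a e)\<^sup>2)"
      by (rule sum.cong) (auto simp: b_def power2_eq_square algebra_simps)
    then show ?thesis by (simp add: sum.distrib sum_distrib_left c_def)
  qed
  ultimately show ?thesis unfolding b_def[symmetric] c_def[symmetric]
    by (simp add: power2_eq_square algebra_simps)
qed

text \<open>Every point of \<open>X\<close> is reached from \<open>x0\<close> by a path of at most \<open>card X\<close> steps from \<open>T\<close>, in the only form
  in which this is needed.\<close>

definition spreads :: "('t \<Rightarrow> 'x \<Rightarrow> 'x) \<Rightarrow> 't set \<Rightarrow> 'x set \<Rightarrow> 'x \<Rightarrow> bool" where
  "spreads act T X x0 \<longleftrightarrow> (\<forall>f D. D \<ge> 0 \<longrightarrow> (\<forall>t\<in>T. \<forall>z\<in>X. \<bar>f (act t z) - f z\<bar> \<le> (D::real)) \<longrightarrow>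
     (\<forall>y\<in>X. \<bar>f y - f x0\<bar> \<le> real (card X) * D))"

lemma spreads_mono: "spreads act T X x0 \<Longrightarrow> T \<subseteq> T' \<Longrightarrow> spreads act T' X x0"
  unfolding spreads_def by blast

text \<open>The stationary letter \<open>e\<close> turns every jump of \<open>f\<close> along a
  letter into a loss of energy. As \<open>f\<close> has sum zero it takes both signs, so by
  \<open>spreads\<close> it is at most \<open>2 * card X * D\<close> in absolute value,
  \<open>D\<close> being the largest jump. Hence the energy is at most
  \<open>4 * card X ^ 3 * D^2\<close>, while the loss is at least \<open>D^2\<close>.\<close>

lemma contraction:
  fixes f :: "'x \<Rightarrow> real"
  assumes X: "finite X" "x0 \<in> X" and T: "finite T" "e \<in> T" and bij: "\<And>t. t \<in> T \<Longrightarrow> bij_betw (act t) X X"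
    and e: "\<And>z. z \<in> X \<Longrightarrow> act e z = z" and spreads: "spreads act T X x0" and f: "sum f X = 0"
  defines "M \<equiv> 4 * real (card X) ^ 3 * (real (card T))\<^sup>2"
  shows "(\<Sum>z\<in>X. (\<Sum>t\<in>T. f (act t z))\<^sup>2) \<le> (real (card T))\<^sup>2 * (1 - 1 / M) * (\<Sum>z\<in>X. (f z)\<^sup>2)"
proof -
  let ?N = "real (card X)" and ?T = "real (card T)"
  define d where "d = (\<lambda>(t, z). \<bar>f (act t z) - f z\<bar>)"
  define D where "D = Max (d ` (T \<times> X))"
  have fin: "finite (d ` (T \<times> X))" "d ` (T \<times> X) \<noteq> {}" using X T by auto
  have le: "\<bar>f (act t z) - f z\<bar> \<le> D" if "t \<in> T" "z \<in> X" for t z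
  proof -
    have "d (t, z) \<le> D" unfolding D_def using fin that by (intro Max_ge) auto
    then show ?thesis by (simp add: d_def)
  qed
  obtain t1 z1 where tz: "t1 \<in> T" "z1 \<in> X" "D = \<bar>f (act t1 z1) - f z1\<bar>"
    using Max_in[OF fin] unfolding D_def[symmetric] by (auto simp: d_def)
  have D0: "D \<ge> 0" using tz by simp
  have osc: "\<bar>f y - f x0\<bar> \<le> ?N * D" if "y \<in> X" for y
    using spreads D0 le that unfolding spreads_def by blast
  have bound: "\<bar>f z\<bar> \<le> 2 * ?N * D" if z: "z \<in> X" for z
  proof -
    have "\<exists>y\<in>X. f y \<le> 0"
    proof (rule ccontr)
      assume "\<not> ?thesis"
      then have "sum f X > 0" using X by (intro sum_pos) auto
      with f show False by simp
    qed
    moreover have "\<exists>y\<in>X. f y \<ge> 0"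
    proof (rule ccontr)
      assume "\<not> ?thesis"
      then have "sum (\<lambda>y. - f y) X > 0" using X by (intro sum_pos) auto
      with f show False by (simp add: sum_negf)
    qed
    ultimately obtain y y' where "y \<in> X" "f y \<le> 0" "y' \<in> X" "f y' \<ge> 0" by blast
    then show ?thesis using osc[of y] osc[of y'] osc[OF z] by linarith
  qed
  have N: "?N > 0" using X by (auto simp: card_gt_0_iff)
  have Tp: "?T > 0" using T by (auto simp: card_gt_0_iff)
  have "(\<Sum>z\<in>X. (f z)\<^sup>2) \<le> (\<Sum>z\<in>X. (2 * ?N * D)\<^sup>2)"
    using bound by (intro sum_mono abs_le_square_iff[THEN iffD1]) (auto simp: abs_mult D0)
  also have "\<dots> = 4 * ?N ^ 3 * D\<^sup>2" by (simp add: power2_eq_square power3_eq_cube)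
  finally have energy: "(\<Sum>z\<in>X. (f z)\<^sup>2) / (4 * ?N ^ 3) \<le> D\<^sup>2"
    using N by (simp add: pos_divide_le_eq mult.commute)
  have "D\<^sup>2 \<le> (\<Sum>t\<in>T. (f (act t z1) - f (act e z1))\<^sup>2)"
    using tz e T by (subst power2_abs[of "f (act t1 z1) - f z1", folded tz(3)])
      (auto intro!: member_le_sum[where f = "\<lambda>t. (f (act t z1) - f z1)\<^sup>2"])
  also have "\<dots> \<le> (\<Sum>z\<in>X. \<Sum>t\<in>T. (f (act t z) - f (act e z))\<^sup>2)"
    using tz X by (intro member_le_sum[where f = "\<lambda>z. \<Sum>t\<in>T. (f (act t z) - f (act e z))\<^sup>2"]) (auto intro: sum_nonneg)
  finally have defect: "D\<^sup>2 \<le> (\<Sum>z\<in>X. \<Sum>t\<in>T. (f (act t z) - f (act e z))\<^sup>2)" .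
  have "(\<Sum>z\<in>X. (\<Sum>t\<in>T. f (act t z))\<^sup>2) \<le>
      (\<Sum>z\<in>X. ?T * (\<Sum>t\<in>T. (f (act t z))\<^sup>2) - (\<Sum>t\<in>T. (f (act t z) - f (act e z))\<^sup>2))"
    by (intro sum_mono square_sum_defect T)
  also have "\<dots> = ?T * (\<Sum>t\<in>T. \<Sum>z\<in>X. (f (act t z))\<^sup>2) - (\<Sum>z\<in>X. \<Sum>t\<in>T. (f (act t z) - f (act e z))\<^sup>2)"
    by (simp add: sum_subtractf sum_distrib_left) (rule sum.swap)
  also have "(\<Sum>t\<in>T. \<Sum>z\<in>X. (f (act t z))\<^sup>2) = ?T * (\<Sum>z\<in>X. (f z)\<^sup>2)"
  proof -
    have "(\<Sum>z\<in>X. (f (act t z))\<^sup>2) = (\<Sum>z\<in>X. (f z)\<^sup>2)" if "t \<in> T" for t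
      using sum.reindex_bij_betw[OF bij[OF that], of "\<lambda>z. (f z)\<^sup>2"] .
    then show ?thesis by simp
  qed
  also have "?T * (?T * (\<Sum>z\<in>X. (f z)\<^sup>2)) - (\<Sum>z\<in>X. \<Sum>t\<in>T. (f (act t z) - f (act e z))\<^sup>2)
      \<le> ?T * (?T * (\<Sum>z\<in>X. (f z)\<^sup>2)) - (\<Sum>z\<in>X. (f z)\<^sup>2) / (4 * ?N ^ 3)"
    using defect energy by linarith
  also have "\<dots> = ?T\<^sup>2 * (1 - 1 / M) * (\<Sum>z\<in>X. (f z)\<^sup>2)"
    using N Tp by (simp add: M_def field_simps power2_eq_square)
  finally show ?thesis .
qed

text \<open>A spanning tree grown from \<open>x0\<close> uses fewer than \<open>card X\<close> generators. This makes the mixing time polynomial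
  although the generating set itself may be as large as \<open>n!\<close>.\<close>

lemma spreads_exists:
  assumes X: "finite X" "x0 \<in> X"
    and gen: "\<And>C. C \<subseteq> X \<Longrightarrow> x0 \<in> C \<Longrightarrow> (\<And>s c. s \<in> S \<Longrightarrow> c \<in> C \<Longrightarrow> act s c \<in> C) \<Longrightarrow> C = X"
    and S: "\<And>s z. s \<in> S \<Longrightarrow> z \<in> X \<Longrightarrow> act s z \<in> X"
  obtains T where "T \<subseteq> S" "finite T" "card T \<le> card X" "spreads act T X x0"
proof -
  have cp: "card X > 0" using X card_gt_0_iff by blast
  have "\<exists>C T. C \<subseteq> X \<and> card C = Suc j \<and> x0 \<in> C \<and> T \<subseteq> S \<and> finite T \<and> card T \<le> j \<and>
     (\<forall>f D. D \<ge> 0 \<longrightarrow> (\<forall>t\<in>T. \<forall>z\<in>X. \<bar>f (act t z) - f z\<bar> \<le> (D::real)) \<longrightarrow> (\<forall>y\<in>C. \<bar>f y - f x0\<bar> \<le> real j * D))"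
    if "j < card X" for j
    using that
  proof (induction j)
    case 0
    show ?case by (rule exI[of _ "{x0}"], rule exI[of _ "{}"]) (use X in auto)
  next
    case (Suc j)
    obtain C T where C: "C \<subseteq> X" "card C = Suc j" "x0 \<in> C" and T: "T \<subseteq> S" "finite T" "card T \<le> j"
      and fD': "\<forall>f D. D \<ge> 0 \<longrightarrow> (\<forall>t\<in>T. \<forall>z\<in>X. \<bar>f (act t z) - f z\<bar> \<le> (D::real)) \<longrightarrow> (\<forall>y\<in>C. \<bar>f y - f x0\<bar> \<le> real j * D)"
      using Suc.IH[OF Suc_lessD[OF Suc.prems]] by (elim exE conjE)
    note fD = fD'[rule_format]
    have "C \<noteq> X" using C Suc.prems by auto
    then obtain s c where sc: "s \<in> S" "c \<in> C" "act s c \<notin> C" using gen[OF C(1) C(3)] by blast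
    have cX: "c \<in> X" using sc C by blast
    have finC: "finite C" using C X finite_subset by blast
    show ?case
    proof (intro exI[of _ "insert (act s c) C"] exI[of _ "insert s T"] conjI allI impI ballI)
      show "insert (act s c) C \<subseteq> X" using C S sc by blast
      show "card (insert (act s c) C) = Suc (Suc j)" using C sc finC by simp
      show "card (insert s T) \<le> Suc j" using T by (simp add: card_insert_if)
      fix f and D :: real and y
      assume D: "D \<ge> 0" and b: "\<forall>t\<in>insert s T. \<forall>z\<in>X. \<bar>f (act t z) - f z\<bar> \<le> D" and y: "y \<in> insert (act s c) C"
      have old: "\<bar>f y - f x0\<bar> \<le> real j * D" if "y \<in> C" for y
        by (rule fD[OF D _ that]) (use b in blast)
      have "\<bar>f (act s c) - f c\<bar> \<le> D" using b cX by blast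
      then have "\<bar>f (act s c) - f x0\<bar> \<le> real (Suc j) * D" using old[OF sc(2)] by (simp add: algebra_simps)
      moreover have "\<bar>f y - f x0\<bar> \<le> real (Suc j) * D" if "y \<in> C" using old[OF that] D by (simp add: algebra_simps)
      ultimately show "\<bar>f y - f x0\<bar> \<le> real (Suc j) * D" using y by blast
    qed (use C T sc in auto)
  qed
  moreover have "card X - 1 < card X" using cp by simp
  ultimately obtain C T where C: "C \<subseteq> X" "card C = Suc (card X - 1)" and T: "T \<subseteq> S" "finite T" "card T \<le> card X - 1"
      and fD': "\<forall>f D. D \<ge> 0 \<longrightarrow> (\<forall>t\<in>T. \<forall>z\<in>X. \<bar>f (act t z) - f z\<bar> \<le> (D::real)) \<longrightarrow> (\<forall>y\<in>C. \<bar>f y - f x0\<bar> \<le> real (card X - 1) * D)"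
    by metis
  note fD = fD'[rule_format]
  have CX: "C = X" using C X(1) cp by (intro card_subset_eq) simp_all
  have "spreads act T X x0"
    unfolding spreads_def
  proof (intro allI impI ballI)
    fix f and D :: real and y
    assume D: "D \<ge> 0" and b: "\<forall>t\<in>T. \<forall>z\<in>X. \<bar>f (act t z) - f z\<bar> \<le> D" and y: "y \<in> X"
    have "\<bar>f y - f x0\<bar> \<le> real (card X - 1) * D" by (rule fD[OF D]) (use b y CX in blast)+
    also have "\<dots> \<le> real (card X) * D" using D by (intro mult_right_mono) auto
    finally show "\<bar>f y - f x0\<bar> \<le> real (card X) * D" .
  qed
  moreover have "card T \<le> card X" using T(3) by simp
  ultimately show thesis using that T(1,2) by blast
qed

definition word_lists :: "'t set \<Rightarrow> nat \<Rightarrow> 't list set" where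
  "word_lists T l = {ws. set ws \<subseteq> T \<and> length ws = l}"

lemma word_lists: "finite T \<Longrightarrow> finite (word_lists T l)" "finite T \<Longrightarrow> card (word_lists T l) = card T ^ l"
  unfolding word_lists_def by (auto simp: finite_lists_length_eq card_lists_length_eq)

lemma sum_word_lists_Suc: "(\<Sum>ws\<in>word_lists T (Suc l). f ws) = (\<Sum>ws\<in>word_lists T l. \<Sum>t\<in>T. f (t # ws))"
proof -
  have "word_lists T (Suc l) = (\<lambda>(ws, t). t # ws) ` (word_lists T l \<times> T)"
    by (auto simp: word_lists_def image_iff length_Suc_conv)
  then have "(\<Sum>ws\<in>word_lists T (Suc l). f ws) = (\<Sum>(ws, t)\<in>word_lists T l \<times> T. f (t # ws))"
    by (simp add: sum.reindex inj_on_def case_prod_unfold)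
  then show ?thesis by (simp add: sum.cartesian_product)
qed

context
  fixes X :: "'x set" and x0 and T :: "'t set" and e and act :: "'t \<Rightarrow> 'x \<Rightarrow> 'x" and M :: real
  assumes X: "finite X" "x0 \<in> X" and T: "finite T" "e \<in> T" and bij: "\<And>t. t \<in> T \<Longrightarrow> bij_betw (act t) X X"
    and e: "\<And>z. z \<in> X \<Longrightarrow> act e z = z" and spreads: "spreads act T X x0"
    and M: "M = 4 * real (card X) ^ 3 * (real (card T))\<^sup>2"
begin

lemma M_ge_1: "M \<ge> 1"
proof -
  have "real (card X) \<ge> 1" "real (card T) \<ge> 1"
    using X T by (auto simp: Suc_le_eq card_gt_0_iff)
  then have "1 * 1 \<le> real (card X) ^ 3 * (real (card T))\<^sup>2" by (intro mult_mono) auto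
  then show ?thesis by (simp add: M)
qed

lemma energy_decay:
  assumes "sum f X = 0"
  shows "(\<Sum>x\<in>X. (\<Sum>ws\<in>word_lists T l. f (foldr act ws x))\<^sup>2) \<le> ((real (card T))\<^sup>2 * (1 - 1 / M)) ^ l * (\<Sum>x\<in>X. (f x)\<^sup>2)"
  using assms
proof (induction l arbitrary: f)
  case 0
  have "word_lists T 0 = {[]}" by (auto simp: word_lists_def)
  then show ?case by simp
next
  case (Suc l)
  let ?q = "(real (card T))\<^sup>2 * (1 - 1 / M)"
  define g where "g z = (\<Sum>t\<in>T. f (act t z))" for z
  have "sum g X = (\<Sum>t\<in>T. \<Sum>z\<in>X. f (act t z))" unfolding g_def by (rule sum.swap)
  also have "\<dots> = 0" using sum.reindex_bij_betw[OF bij, of _ f] Suc.prems by (intro sum.neutral) simp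
  finally have g: "sum g X = 0" .
  have q: "?q \<ge> 0" using M_ge_1 by simp
  have "(\<Sum>x\<in>X. (\<Sum>ws\<in>word_lists T (Suc l). f (foldr act ws x))\<^sup>2) = (\<Sum>x\<in>X. (\<Sum>ws\<in>word_lists T l. g (foldr act ws x))\<^sup>2)"
    by (simp add: sum_word_lists_Suc g_def)
  also have "\<dots> \<le> ?q ^ l * (\<Sum>x\<in>X. (g x)\<^sup>2)" by (rule Suc.IH[OF g])
  also have "\<dots> \<le> ?q ^ l * (?q * (\<Sum>x\<in>X. (f x)\<^sup>2))"
    unfolding g_def using contraction[OF X T bij e spreads Suc.prems] q
    by (intro mult_left_mono) (simp_all add: M)
  finally show ?case by (simp add: mult_ac)
qed

text \<open>The energy estimate for the indicator of \<open>y\<close> minus the uniform density,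
  whose energy is at most 1. The factor \<open>(card X)^2\<close> in the length turns the absolute
  error into a relative one.\<close>

lemma equidistribution:
  assumes x: "x \<in> X" and y: "y \<in> X" and d: "d > 0" and l: "M * (real (card X))\<^sup>2 * d\<^sup>2 \<le> real l"
  shows "\<bar>real (card {ws \<in> word_lists T l. foldr act ws x = y}) * real (card X) - real (card T) ^ l\<bar> \<le> real (card T) ^ l / d"
proof -
  let ?N = "real (card X)" and ?T = "real (card T)"
  define f where "f z = (if z = y then 1 else 0) - 1 / ?N" for z
  have ne: "X \<noteq> {}" using y by blast
  have N: "?N \<ge> 1" using X by (auto simp: Suc_le_eq card_gt_0_iff)
  have "sum f X = 0" using X y N ne by (simp add: f_def sum_subtractf)
  note dec = energy_decay[OF this, of l]
  have "(f z)\<^sup>2 \<le> (if z = y then 1 - 2 / ?N else 0) + 1 / ?N\<^sup>2" for z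
    using N by (auto simp: f_def power2_eq_square field_simps)
  then have "(\<Sum>z\<in>X. (f z)\<^sup>2) \<le> (\<Sum>z\<in>X. (if z = y then 1 - 2 / ?N else 0) + 1 / ?N\<^sup>2)"
    by (intro sum_mono)
  also have "\<dots> = 1 - 1 / ?N" using X y N ne by (subst sum.distrib) (simp add: power2_eq_square field_simps)
  also have "\<dots> \<le> 1" using N by simp
  finally have f1: "(\<Sum>z\<in>X. (f z)\<^sup>2) \<le> 1" .
  have q: "0 \<le> 1 - 1 / M" using M_ge_1 by simp
  \<comment> \<open>Bernoulli's inequality and \<open>(1 - 1 / M) * (1 + 1 / M) \<le> 1\<close>
    bound the decay by \<open>1 / (1 + l / M)\<close>: far from sharp, but polynomial in
    \<open>l\<close> without logarithms.\<close>
  have "(1 - 1 / M) ^ l * (1 + real l / M) \<le> (1 - 1 / M) ^ l * (1 + 1 / M) ^ l"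
  proof (rule mult_left_mono)
    have "0 \<le> 1 / M" using M_ge_1 by simp
    then have "-1 \<le> 1 / M" by linarith
    then show "1 + real l / M \<le> (1 + 1 / M) ^ l" using Bernoulli_inequality[of "1 / M" l] by simp
  qed (use q in simp)
  also have "\<dots> = (1 - (1 / M)\<^sup>2) ^ l" by (simp add: power_mult_distrib[symmetric] power2_eq_square algebra_simps)
  also have "\<dots> \<le> 1"
    using M_ge_1 by (intro power_le_one) (auto simp: power_le_one)
  finally have "(1 - 1 / M) ^ l * (1 + real l / M) \<le> 1" .
  moreover have "(?N * d)\<^sup>2 \<le> 1 + real l / M"
    using l M_ge_1 by (simp add: field_simps power_mult_distrib)
  ultimately have th: "(1 - 1 / M) ^ l * (?N * d)\<^sup>2 \<le> 1"
    using q by (meson mult_left_mono order.trans zero_le_power)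
  let ?F = "\<lambda>x. \<Sum>ws\<in>word_lists T l. f (foldr act ws x)"
  have F: "?F x = real (card {ws \<in> word_lists T l. foldr act ws x = y}) - ?T ^ l / ?N"
    using word_lists[OF T(1), of l] by (simp add: f_def sum_subtractf sum.If_cases Collect_conj_eq[symmetric] Int_def)
  have "(?F x)\<^sup>2 \<le> (\<Sum>x\<in>X. (?F x)\<^sup>2)"
    using X x by (intro member_le_sum[where f = "\<lambda>x. (?F x)\<^sup>2"]) auto
  also have "\<dots> \<le> (?T\<^sup>2 * (1 - 1 / M)) ^ l * 1"
    using dec f1 q by (meson mult_left_mono order.trans zero_le_power mult_nonneg_nonneg zero_le_power2)
  also have "\<dots> = (?T ^ l)\<^sup>2 * (1 - 1 / M) ^ l"
    by (simp add: power_mult_distrib power_mult[symmetric] mult.commute)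
  finally have "(?F x)\<^sup>2 * (?N * d)\<^sup>2 \<le> (?T ^ l)\<^sup>2 * ((1 - 1 / M) ^ l * (?N * d)\<^sup>2)"
    unfolding mult.assoc[symmetric] by (rule mult_right_mono) simp
  also have "\<dots> \<le> (?T ^ l)\<^sup>2 * 1" by (intro mult_left_mono th) simp
  finally have "(?F x * (?N * d))\<^sup>2 \<le> (?T ^ l)\<^sup>2" by (simp add: power_mult_distrib)
  then have "\<bar>?F x * (?N * d)\<bar> \<le> ?T ^ l" by (simp add: abs_le_square_iff[symmetric])
  then have "\<bar>?F x * ?N\<bar> * d \<le> ?T ^ l" using d by (simp add: abs_mult mult.assoc)
  moreover have "?F x * ?N = real (card {ws \<in> word_lists T l. foldr act ws x = y}) * ?N - ?T ^ l"
    unfolding F using N by (simp add: field_simps)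
  ultimately show ?thesis using d by (simp add: pos_le_divide_eq)
qed

end

section \<open>Words in the generators\<close>

definition tuples :: "nat \<Rightarrow> nat \<Rightarrow> nat list set" where
  "tuples n j = {xs. distinct xs \<and> length xs = j \<and> set xs \<subseteq> {1..n}}"

lemma finite_tuples: "finite (tuples n j)"
  by (rule finite_subset[OF _ finite_lists_length_eq[of "{1..n}" j]]) (auto simp: tuples_def)

lemma card_tuples_le: "card (tuples n j) \<le> n ^ j"
proof -
  have "card (tuples n j) \<le> card {xs. set xs \<subseteq> {1..n} \<and> length xs = j}"
    by (rule card_mono[OF finite_lists_length_eq]) (auto simp: tuples_def)
  then show ?thesis by (simp add: card_lists_length_eq)
qed

lemma card_tuples_add: "card (tuples n (i + j)) \<le> card (tuples n i) * n ^ j"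
proof -
  have "card (tuples n (i + j)) \<le> card (tuples n i \<times> {xs. set xs \<subseteq> {1..n} \<and> length xs = j})"
  proof (rule card_inj_on_le[where f = "\<lambda>xs. (take i xs, drop i xs)"])
    show "inj_on (\<lambda>xs. (take i xs, drop i xs)) (tuples n (i + j))"
      by (rule inj_onI) (metis append_take_drop_id prod.inject)
    show "(\<lambda>xs. (take i xs, drop i xs)) ` tuples n (i + j) \<subseteq> tuples n i \<times> {xs. set xs \<subseteq> {1..n} \<and> length xs = j}"
      by (auto simp: tuples_def dest: in_set_takeD in_set_dropD)
  qed (simp add: finite_tuples finite_lists_length_eq)
  then show ?thesis by (simp add: card_cartesian_product card_lists_length_eq)
qed

lemma tuples_map: "p permutes {1..n} \<Longrightarrow> xs \<in> tuples n j \<Longrightarrow> map p xs \<in> tuples n j"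
  by (auto simp: tuples_def distinct_map dest: permutes_in_image permutes_inj_on)

lemma permutes_extend:
  fixes A :: "'a set" and xs ys :: "'a list"
  assumes "finite A" "distinct xs" "distinct ys" "length xs = length ys" "set xs \<subseteq> A" "set ys \<subseteq> A"
  shows "\<exists>p :: 'a \<Rightarrow> 'a. p permutes A \<and> map p xs = ys"
  using assms(4,2,3,5,6)
proof (induction xs ys rule: list_induct2)
  case Nil
  show ?case by (intro exI[of _ id] conjI permutes_id) simp
next
  case (Cons x xs y ys)
  then obtain p where p: "p permutes A" "map p xs = ys" by auto
  let ?q = "Transposition.transpose (p x) y \<circ> p"
  have q: "?q permutes A"
    by (rule permutes_compose[OF p(1) permutes_swap_id]) (use Cons.prems p in \<open>auto simp: permutes_in_image\<close>)
  have "map ?q xs = map p xs"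
  proof (rule map_cong[OF refl])
    fix z assume z: "z \<in> set xs"
    then have "p z \<noteq> p x" using Cons.prems permutes_inj[OF p(1)] by (metis distinct.simps(2) injD)
    moreover have "p z \<noteq> y" using z p Cons.prems by auto
    ultimately show "?q z = p z" by simp
  qed
  then have m: "map ?q (x # xs) = y # ys" using p(2) by simp
  show ?case by (rule exI[of _ ?q], rule conjI, rule q, rule m)
qed

text \<open>Balls in the word metric. \<open>bij t\<close> keeps out spurious letters, since
  \<open>inv'\<close> takes arbitrary values on functions that are not bijective.\<close>

fun words :: "('a \<Rightarrow> 'a) set \<Rightarrow> nat \<Rightarrow> ('a \<Rightarrow> 'a) set" where
  "words S 0 = {id}"
| "words S (Suc l) = words S l \<union> {t \<circ> g | t g. (t \<in> S \<or> inv' t \<in> S \<and> bij t) \<and> g \<in> words S l}"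

lemma words_mono: "l \<le> l' \<Longrightarrow> words S l \<subseteq> words S l'"
  by (rule lift_Suc_mono_le[of "words S"]) auto

lemma id_words: "id \<in> words S l"
  using words_mono[of 0 l S] by auto

lemma words_1: "g \<in> S \<Longrightarrow> g \<in> words S 1"
  by (auto intro: exI[of _ g])

lemma words_comp: "p \<in> words S a \<Longrightarrow> q \<in> words S b \<Longrightarrow> p \<circ> q \<in> words S (a + b)"
proof (induction a arbitrary: p)
  case (Suc a)
  show ?case
  proof (cases "p \<in> words S a")
    case True
    then show ?thesis using Suc words_mono[of "a + b" "Suc a + b" S] by auto
  next
    case False
    then obtain t g where t: "p = t \<circ> g" "t \<in> S \<or> inv' t \<in> S \<and> bij t" "g \<in> words S a" using Suc.prems(1) by auto
    then have "p \<circ> q = t \<circ> (g \<circ> q)" "g \<circ> q \<in> words S (a + b)"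
      using Suc.IH[of g] Suc.prems(2) by (simp_all only: comp_assoc)
    then show ?thesis using t by (simp only: add_Suc words.simps) blast
  qed
qed simp

lemma words_bij: "(\<And>s. s \<in> S \<Longrightarrow> bij s) \<Longrightarrow> p \<in> words S a \<Longrightarrow> bij p"
  by (induction a arbitrary: p) (auto intro: bij_comp)

lemma words_inv:
  assumes S: "\<And>s. s \<in> S \<Longrightarrow> bij s" and "p \<in> words S a"
  shows "inv' p \<in> words S a"
  using assms(2)
proof (induction a arbitrary: p)
  case 0
  then have "p = id" by (simp only: words.simps singleton_iff)
  then show ?case by (simp only: words.simps singleton_iff inv_id)
next
  case (Suc a)
  show ?case
  proof (cases "p \<in> words S a")
    case False
    then obtain t g where p: "p = t \<circ> g" and t: "t \<in> S \<or> inv' t \<in> S \<and> bij t" and g: "g \<in> words S a" using Suc.prems by auto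
    have bt: "bij t" using t S by blast
    have "inv' t \<in> words S 1"
      using t bt inv_inv_eq[OF bt] bij_imp_bij_inv[OF bt] by (auto intro!: exI[of _ "inv' t"])
    have "inv' p = inv' g \<circ> inv' t" unfolding p by (rule o_inv_distrib[OF bt words_bij[OF S g]])
    then show ?thesis using words_comp[OF Suc.IH[OF g] \<open>inv' t \<in> words S 1\<close>] by (simp only: Suc_eq_plus1)
  qed (use Suc in auto)
qed

lemma words_funpow: "p \<in> words S a \<Longrightarrow> p ^^ m \<in> words S (m * a)"
  by (induction m) (auto simp: id_words intro: words_comp)

lemma foldr_words:
  fixes ws :: "('a \<Rightarrow> 'a) list"
  assumes "set ws \<subseteq> insert id S"
  shows "foldr (\<circ>) ws id \<in> words S (length ws)"
  using assms
proof (induction ws)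
  case Nil
  have "foldr (\<circ>) [] id = (id :: 'a \<Rightarrow> 'a)" by (simp add: fun_eq_iff)
  then show ?case by (metis id_words)
next
  case (Cons t ws)
  have eq: "foldr (\<circ>) (t # ws) id = t \<circ> foldr (\<circ>) ws id" by (simp only: foldr_Cons comp_apply)
  have ws: "foldr (\<circ>) ws id \<in> words S (length ws)"
    by (rule Cons.IH, rule subset_trans[OF set_subset_Cons Cons.prems])
  have "t \<in> insert id S" by (rule subsetD[OF Cons.prems list.set_intros(1)])
  then have "t = id \<or> t \<in> S" by (simp only: insert_iff)
  then show ?case
  proof
    assume t: "t = id"
    have "foldr (\<circ>) ws id \<in> words S (length (t # ws))" by (rule subsetD[OF words_mono ws]) simp
    moreover have "foldr (\<circ>) (t # ws) id = foldr (\<circ>) ws id" by (rule trans[OF eq]) (simp only: t id_comp)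
    ultimately show ?thesis by (simp only:)
  next
    assume "t \<in> S"
    with ws show ?thesis unfolding eq words.simps length_Cons by blast
  qed
qed

lemma foldr_map: "foldr map ws xs = map (foldr (\<circ>) ws id) xs"
  by (induction ws) auto

section \<open>Generating sets of the symmetric and alternating groups\<close>

locale perm_gens =
  fixes n :: nat and G :: "(nat \<Rightarrow> nat) monoid" and S :: "(nat \<Rightarrow> nat) set"
  assumes G: "G = sym_group n \<or> G = alt_group n" and S: "S \<subseteq> carrier G" and gen: "generate G S = carrier G"
begin

lemma carrier_permutes: "p \<in> carrier G \<Longrightarrow> p permutes {1..n}"
  using G by (auto simp: sym_group_carrier alt_group_carrier)

lemma S_permutes: "s \<in> S \<Longrightarrow> s permutes {1..n}"
  using S carrier_permutes by blast

lemma even_carrier: "p permutes {1..n} \<Longrightarrow> evenperm p \<Longrightarrow> p \<in> carrier G"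
  using G by (auto simp: sym_group_carrier alt_group_carrier)

lemma G_simps: "\<one>\<^bsub>G\<^esub> = id" "x \<otimes>\<^bsub>G\<^esub> y = x \<circ> y" "p \<in> carrier G \<Longrightarrow> inv\<^bsub>G\<^esub> p = inv' p"
  using G by (auto simp: sym_group_one alt_group_one sym_group_mult alt_group_mult
      sym_group_inv_equality alt_group_inv_equality)

lemma bij_S: "s \<in> S \<Longrightarrow> bij s"
  using S_permutes permutes_bij by blast

lemma words_permutes: "p \<in> words S a \<Longrightarrow> p permutes {1..n}"
proof (induction a arbitrary: p)
  case (Suc a)
  have "t permutes {1..n}" if "t \<in> S \<or> inv' t \<in> S \<and> bij t" for t
    using that S_permutes permutes_inv[of "inv' t"] by (auto simp: inv_inv_eq)
  then show ?case using Suc by (auto intro: permutes_compose)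
qed (auto simp: permutes_id)

lemma carrier_words:
  assumes "p \<in> carrier G" shows "\<exists>l. p \<in> words S l"
proof -
  have "p \<in> generate G S" using assms gen by simp
  then show ?thesis
  proof induction
    case one
    show ?case by (rule exI[of _ 0]) (simp only: G_simps words.simps singleton_iff)
  next
    case (incl h)
    then show ?case using words_1 by blast
  next
    case (inv h)
    then have "inv\<^bsub>G\<^esub> h = inv' h" using S G_simps(3) by blast
    moreover have "inv' h \<in> words S 1" using words_inv[OF bij_S words_1[OF inv]] .
    ultimately show ?case by metis
  next
    case (eng h1 h2)
    then show ?case using words_comp G_simps by metis
  qed
qed

text \<open>An injective map of a finite set into itself is onto, so closure under a generator gives
  closure under its inverse.\<close>

lemma closed_carrier:
  assumes C: "C \<subseteq> tuples n j" and cl: "\<And>s c. s \<in> S \<Longrightarrow> c \<in> C \<Longrightarrow> map s c \<in> C" and p: "p \<in> carrier G" and "c \<in> C"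
  shows "map p c \<in> C"
proof -
  have fin: "finite C" using C finite_tuples finite_subset by blast
  have "p \<in> generate G S" using p gen by simp
  then show ?thesis using \<open>c \<in> C\<close>
  proof (induction arbitrary: c)
    case one
    then show ?case by (simp add: G_simps)
  next
    case (incl h)
    then show ?case using cl by blast
  next
    case (inv h)
    have bh: "bij h" using bij_S inv by blast
    have "inj_on (map h) C" using bh by (meson bij_is_inj inj_mapI inj_on_subset top_greatest)
    then have "map h ` C = C" using cl inv(1) by (intro endo_inj_surj[OF fin]) auto
    then obtain c' where c': "c' \<in> C" "c = map h c'" using inv(2) by blast
    have "map (inv' h) c = c'" using c' bh by (simp add: comp_def bij_is_inj)
    then show ?case using c' inv(1) S G_simps(3)[of h] by auto
  next
    case (eng h1 h2)
    then show ?case by (metis G_simps(2) map_map)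
  qed
qed

text \<open>Two points outside \<open>ys\<close> remain free, and their transposition corrects the
  parity for the alternating group.\<close>

lemma transitive:
  assumes "xs \<in> tuples n j" "ys \<in> tuples n j" "j + 2 \<le> n"
  shows "\<exists>p\<in>carrier G. map p xs = ys"
proof -
  obtain p where p: "p permutes {1..n}" "map p xs = ys"
    using permutes_extend[of "{1..n}" xs ys] assms by (auto simp: tuples_def)
  show ?thesis
  proof (cases "evenperm p")
    case True
    then show ?thesis using p even_carrier by blast
  next
    case False
    have "card ({1..n} - set ys) \<ge> 2"
      using assms by (simp add: tuples_def card_Diff_subset distinct_card)
    then obtain B where B: "B \<subseteq> {1..n} - set ys" "card B = 2"
      using obtain_subset_with_card_n by metis
    then obtain a b where "B = {a, b}" "a \<noteq> b" by (auto simp: card_2_iff)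
    with B have ab: "a \<in> {1..n} - set ys" "b \<in> {1..n} - set ys" "a \<noteq> b" by blast+
    let ?q = "Transposition.transpose a b \<circ> p"
    have q: "?q permutes {1..n}" using ab by (intro permutes_compose[OF p(1) permutes_swap_id]) auto
    have "permutation p" using p(1) permutation_permutes by blast
    then have ev: "evenperm ?q" using False ab by (simp add: evenperm_comp permutation_swap_id evenperm_swap)
    have "map ?q xs = map p xs"
    proof (rule map_cong[OF refl])
      fix z assume "z \<in> set xs"
      then have "p z \<in> set ys" using p(2) by auto
      then have "p z \<noteq> a" "p z \<noteq> b" using ab by blast+
      then show "?q z = p z" by simp
    qed
    then have "map ?q xs = ys" using p(2) by (rule trans)
    with even_carrier[OF q ev] show ?thesis by blast
  qed
qed

text \<open>One set \<open>T\<close> serves all tuple lengths up to \<open>k\<close>, because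
  estimates for a tuple and for its extensions will be compared over the same words. With at most
  \<open>n ^ k\<close> tuples and \<open>(k + 2) * n ^ k\<close> letters, the exponent
  \<open>7 * k\<close> splits as 3 for the energy bound, 2 for the squared number of letters and 2
  for the relative error.\<close>

lemma mixing:
  assumes k: "k + 2 \<le> n" and d: "d > 0" and l: "l = 4 * (k + 2)\<^sup>2 * n ^ (7 * k) * d\<^sup>2"
  obtains T where "finite T" "T \<subseteq> insert id S" "T \<noteq> {}"
    "\<And>j xs ys. j \<le> k \<Longrightarrow> xs \<in> tuples n j \<Longrightarrow> ys \<in> tuples n j \<Longrightarrow>
      \<bar>real (card {ws \<in> word_lists T l. map (foldr (\<circ>) ws id) xs = ys}) * real (card (tuples n j)) - real (card T) ^ l\<bar>
        \<le> real (card T) ^ l / real d"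
proof -
  have "\<exists>T. T \<subseteq> S \<and> finite T \<and> card T \<le> n ^ j \<and> spreads map T (tuples n j) [1..<Suc j]" if "j \<le> k" for j
  proof -
    have x0: "[1..<Suc j] \<in> tuples n j" using that k by (auto simp: tuples_def)
    have gen': "C = tuples n j" if C: "C \<subseteq> tuples n j" "[1..<Suc j] \<in> C" "\<And>s c. s \<in> S \<Longrightarrow> c \<in> C \<Longrightarrow> map s c \<in> C" for C
    proof
      show "tuples n j \<subseteq> C"
      proof
        fix ys assume "ys \<in> tuples n j"
        moreover have "j + 2 \<le> n" using \<open>j \<le> k\<close> k by simp
        ultimately obtain p where "p \<in> carrier G" "map p [1..<Suc j] = ys" using transitive[OF x0] by blast
        then show "ys \<in> C" using closed_carrier[OF C(1) C(3) _ C(2)] by blast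
      qed
    qed (rule C(1))
    obtain T where T: "T \<subseteq> S" "finite T" "card T \<le> card (tuples n j)" "spreads map T (tuples n j) [1..<Suc j]"
    proof (rule spreads_exists[of "tuples n j" "[1..<Suc j]" S map])
      show "C = tuples n j" if "C \<subseteq> tuples n j" "[1..<Suc j] \<in> C" "\<And>s c. s \<in> S \<Longrightarrow> c \<in> C \<Longrightarrow> map s c \<in> C" for C
        using that by (rule gen')
      show "map s z \<in> tuples n j" if "s \<in> S" "z \<in> tuples n j" for s z
        by (rule tuples_map[OF S_permutes[OF that(1)] that(2)])
    qed (rule finite_tuples x0 | assumption)+
    have "card T \<le> n ^ j" using T(3) card_tuples_le[of n j] by linarith
    with T show ?thesis by (intro exI[of _ T] conjI)
  qed
  then obtain U where U: "\<And>j. j \<le> k \<Longrightarrow> U j \<subseteq> S \<and> finite (U j) \<and> card (U j) \<le> n ^ j \<and> spreads map (U j) (tuples n j) [1..<Suc j]"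
    by metis
  define T where "T = insert id (\<Union>j\<le>k. U j)"
  have finT: "finite T" using U by (simp add: T_def)
  have n1: "n \<ge> 1" using k by simp
  have "card T \<le> Suc (card (\<Union>j\<le>k. U j))" unfolding T_def by (rule card_insert_le_m1) simp_all
  also have "card (\<Union>j\<le>k. U j) \<le> (\<Sum>j\<le>k. card (U j))" by (rule card_UN_le) simp
  also have "\<dots> \<le> (\<Sum>j\<le>k. n ^ k)"
  proof (rule sum_mono)
    fix j assume "j \<in> {..k}"
    then show "card (U j) \<le> n ^ k" using U[of j] power_increasing[of j k n] n1 by (meson atMost_iff order.trans)
  qed
  also have "Suc (\<Sum>j\<le>k. n ^ k) \<le> (k + 2) * n ^ k" using n1 by simp
  finally have cT: "card T \<le> (k + 2) * n ^ k" by simp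
  show thesis
  proof (rule that[OF finT])
    show "T \<subseteq> insert id S" using U by (auto simp: T_def)
    show "T \<noteq> {}" by (simp add: T_def)
    fix j xs ys assume j: "j \<le> k" and xs: "xs \<in> tuples n j" and ys: "ys \<in> tuples n j"
    have perm: "t permutes {1..n}" if "t \<in> T" for t
      using that U S_permutes permutes_id by (auto simp: T_def)
    have bij: "bij_betw (map t) (tuples n j) (tuples n j)" if "t \<in> T" for t
    proof -
      have "inj_on (map t) (tuples n j)"
        using permutes_inj[OF perm[OF that]] by (meson inj_mapI inj_on_subset top_greatest)
      then show ?thesis using tuples_map[OF perm[OF that]]
        by (intro bij_betw_imageI endo_inj_surj[OF finite_tuples]) auto
    qed
    have spreads: "spreads map T (tuples n j) [1..<Suc j]"
      by (rule spreads_mono[of _ "U j"]) (use U[of j] j in \<open>auto simp: T_def\<close>)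
    have x0: "[1..<Suc j] \<in> tuples n j" using j k by (auto simp: tuples_def)
    let ?M = "4 * real (card (tuples n j)) ^ 3 * (real (card T))\<^sup>2"
    have N: "card (tuples n j) \<le> n ^ k" using card_tuples_le[of n j] power_increasing[OF j n1] by linarith
    have "4 * card (tuples n j) ^ 3 * (card T)\<^sup>2 * (card (tuples n j))\<^sup>2 * d\<^sup>2
        \<le> 4 * (n ^ k) ^ 3 * ((k + 2) * n ^ k)\<^sup>2 * (n ^ k)\<^sup>2 * d\<^sup>2"
      by (intro mult_mono power_mono N cT) simp_all
    also have "\<dots> = l"
    proof -
      have "4 * m ^ 3 * ((k + 2) * m)\<^sup>2 * m\<^sup>2 * d\<^sup>2 = 4 * (k + 2)\<^sup>2 * m ^ 7 * d\<^sup>2" for m :: nat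
      proof -
        have "m ^ 7 = m * m * m * m * m * m * m" by (simp add: eval_nat_numeral)
        then show ?thesis by (simp only: power2_eq_square power3_eq_cube mult_ac)
      qed
      from this[of "n ^ k"] show ?thesis by (simp add: l power_mult[symmetric] mult.commute[of 7 k])
    qed
    finally have "real (4 * card (tuples n j) ^ 3 * (card T)\<^sup>2 * (card (tuples n j))\<^sup>2 * d\<^sup>2) \<le> real l"
      by (rule of_nat_mono)
    then have "?M * (real (card (tuples n j)))\<^sup>2 * (real d)\<^sup>2 \<le> real l" by simp
    then have "\<bar>real (card {ws \<in> word_lists T l. foldr map ws xs = ys}) * real (card (tuples n j)) - real (card T) ^ l\<bar>
        \<le> real (card T) ^ l / real d"
      by (intro equidistribution[where e = id, OF finite_tuples x0 finT _ bij _ spreads refl xs ys]) (use d in \<open>auto simp: T_def\<close>)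
    then show "\<bar>real (card {ws \<in> word_lists T l. map (foldr (\<circ>) ws id) xs = ys}) * real (card (tuples n j)) - real (card T) ^ l\<bar>
        \<le> real (card T) ^ l / real d" by (simp add: foldr_map)
  qed
qed

end

section \<open>The exploration trees\<close>

definition five_rounds :: "step list" where
  "five_rounds = concat (replicate 5 (round_steps @ [Close]))"

definition seven_rounds :: "step list" where
  "seven_rounds = round_steps @ [Apart] @ concat (replicate 6 round_steps) @ [Close]"

abbreviation Fixed where "Fixed t \<equiv> Branch t Dead"
abbreviation Moved where "Moved t \<equiv> Branch Dead t"

text \<open>The trees were found by a computer search through the orbits of length at most 5 (for \<open>r = 0\<close>, only branches of
  probability at least \<open>1 / 100000\<close> at density \<open>0.37\<close> were kept; shorter orbits suffice for \<open>r = 2, 3\<close>). The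
  trees \<open>seven_*\<close> are single branches leading to an orbit of length 7.\<close>

definition tree_long :: tree where
"tree_long = Branch (Branch Closed (Branch Closed (Branch (Branch (Branch Closed (Branch (Branch Closed (Branch (Moved (Moved (Fixed (Fixed (Fixed Closed))))) (Fixed (Moved (Fixed (Moved (Fixed
 Closed))))))) (Branch (Fixed (Branch (Fixed (Moved (Moved (Fixed Closed)))) (Moved (Fixed (Fixed (Fixed Closed)))))) (Fixed (Branch (Moved (Branch (Fixed (Fixed
 Closed)) (Fixed Closed))) (Fixed (Moved (Fixed (Fixed Closed))))))))) (Branch (Branch (Fixed (Moved (Fixed (Moved (Fixed (Fixed Closed)))))) (Moved (Fixed
 (Fixed (Branch (Branch Closed (Fixed (Fixed Closed))) (Fixed (Fixed (Fixed Closed)))))))) (Fixed (Moved (Fixed (Branch (Fixed (Fixed (Fixed Closed))) (Fixed (Branch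
 Closed (Fixed (Fixed Closed)))))))))) (Branch Closed (Branch (Branch (Branch (Branch (Fixed (Fixed (Moved (Fixed Closed)))) (Fixed (Moved (Fixed Closed)))) (Branch
 (Branch (Fixed (Fixed Closed)) (Fixed (Fixed (Fixed (Fixed Closed))))) (Fixed (Fixed Closed)))) (Fixed (Fixed (Branch (Moved (Fixed (Moved (Fixed Closed)))) (Branch
 (Fixed (Fixed (Fixed Closed))) (Fixed (Fixed Closed))))))) (Branch (Branch (Fixed (Branch (Branch (Fixed (Fixed Closed)) (Fixed Closed)) (Fixed (Fixed (Moved (Fixed
 Closed)))))) (Branch (Branch (Branch (Fixed Closed) (Fixed (Fixed (Fixed Closed)))) (Branch Closed (Moved (Fixed (Moved (Fixed (Moved (Fixed Closed)))))))) (Moved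
 (Fixed (Moved (Fixed (Moved (Fixed (Moved (Fixed Closed)))))))))) (Moved (Fixed (Moved (Fixed (Moved (Fixed (Moved (Fixed (Moved (Fixed
 Closed)))))))))))))))) (Branch (Branch (Branch Closed (Branch (Branch Closed (Branch (Branch (Fixed (Moved (Fixed (Moved (Fixed Closed))))) (Moved (Fixed (Fixed
 (Branch Closed (Fixed (Fixed Closed))))))) (Fixed (Moved (Fixed (Branch (Fixed (Fixed Closed)) (Fixed Closed))))))) (Branch (Branch (Branch (Branch (Moved (Moved
 (Fixed Closed))) (Fixed (Moved (Fixed (Fixed Closed))))) (Moved (Fixed (Fixed (Fixed Closed))))) (Fixed (Fixed (Branch (Fixed (Moved (Moved (Fixed Closed))))
 (Moved (Fixed (Fixed (Fixed Closed)))))))) (Fixed (Branch (Moved (Branch (Fixed (Branch Closed (Fixed (Fixed Closed)))) (Fixed Closed))) (Fixed (Branch (Fixed (Fixed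
 (Fixed Closed))) (Fixed (Fixed Closed))))))))) (Branch (Branch (Branch Closed (Branch (Branch Closed (Branch (Moved (Moved (Fixed (Fixed (Fixed Closed))))) (Fixed
 (Moved (Fixed (Moved (Fixed Closed))))))) (Branch (Fixed (Branch (Fixed (Moved (Moved (Fixed Closed)))) (Moved (Fixed (Fixed (Fixed Closed)))))) (Fixed (Branch
 (Moved (Branch (Fixed (Fixed Closed)) (Fixed Closed))) (Fixed (Moved (Fixed (Fixed Closed))))))))) (Branch (Branch (Fixed (Moved (Fixed (Moved (Fixed (Fixed
 Closed)))))) (Moved (Fixed (Fixed (Branch (Branch Closed (Fixed (Fixed Closed))) (Fixed (Fixed (Fixed Closed)))))))) (Fixed (Moved (Fixed (Branch (Fixed (Fixed
 (Fixed Closed))) (Fixed (Branch Closed (Fixed (Fixed Closed)))))))))) (Branch (Branch (Branch (Branch (Moved (Moved (Fixed (Branch Closed (Fixed (Fixed Closed))))))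
 (Fixed (Moved (Fixed (Fixed (Fixed Closed)))))) (Moved (Fixed (Fixed (Fixed (Branch Closed (Fixed (Fixed Closed)))))))) (Fixed (Fixed (Branch (Fixed (Moved (Moved
 (Fixed (Fixed Closed))))) (Moved (Fixed (Fixed (Fixed (Fixed Closed))))))))) (Fixed (Branch (Moved (Branch (Fixed (Branch (Branch Closed (Fixed (Fixed Closed)))
 (Fixed (Fixed (Fixed Closed))))) (Fixed (Branch Closed (Fixed (Fixed Closed)))))) (Fixed (Branch (Fixed (Fixed (Fixed (Fixed Closed)))) (Fixed (Fixed (Branch Closed
 (Fixed (Fixed Closed)))))))))))) (Branch (Branch (Branch (Branch Closed (Branch (Branch (Branch (Moved (Fixed (Moved (Fixed Closed)))) (Moved (Fixed (Fixed
 Closed)))) (Fixed (Fixed (Moved (Moved (Fixed (Fixed Closed))))))) (Fixed (Moved (Fixed (Branch (Fixed (Fixed Closed)) (Fixed Closed))))))) (Branch (Branch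
 (Branch Closed (Branch (Fixed (Moved (Moved (Fixed (Fixed Closed))))) (Fixed (Moved (Fixed (Moved (Fixed Closed))))))) (Branch (Moved (Moved (Fixed (Fixed (Fixed
 (Fixed Closed)))))) (Fixed (Moved (Fixed (Moved (Fixed (Fixed Closed)))))))) (Branch (Fixed (Branch (Fixed (Moved (Moved (Fixed (Fixed Closed))))) (Moved
 (Fixed (Fixed (Fixed (Fixed Closed))))))) (Fixed (Branch (Moved (Branch (Fixed (Fixed (Fixed Closed))) (Fixed (Fixed Closed)))) (Fixed (Moved (Fixed (Fixed (Fixed
 Closed)))))))))) (Branch Closed (Branch (Branch (Branch (Branch (Fixed (Fixed (Moved (Fixed Closed)))) (Fixed (Moved (Fixed Closed)))) (Fixed (Fixed (Moved (Fixed
 (Moved (Fixed Closed))))))) (Branch (Fixed (Branch (Fixed (Branch Closed (Fixed (Fixed Closed)))) (Fixed (Fixed (Fixed (Fixed Closed)))))) (Fixed (Fixed (Branch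
 Closed (Fixed (Fixed Closed))))))) (Branch (Branch (Branch (Fixed (Branch (Fixed (Fixed Closed)) (Fixed Closed))) (Fixed (Fixed (Fixed (Moved (Fixed Closed))))))
 (Branch (Branch (Fixed (Branch Closed (Fixed (Fixed Closed)))) (Branch Closed (Moved (Fixed (Moved (Fixed (Moved (Fixed Closed)))))))) (Moved (Fixed (Moved (Fixed
 (Moved (Fixed (Moved (Fixed Closed)))))))))) (Moved (Fixed (Moved (Fixed (Moved (Fixed (Moved (Fixed (Moved (Fixed Closed)))))))))))))) (Branch (Branch
 (Branch (Branch (Branch (Branch (Moved (Fixed (Moved (Fixed Closed)))) (Moved (Fixed (Fixed Closed)))) (Fixed (Fixed (Moved (Moved (Fixed (Fixed Closed)))))))
 (Fixed (Moved (Fixed (Branch (Fixed (Fixed Closed)) (Fixed Closed)))))) (Fixed (Fixed (Branch (Fixed (Moved (Moved (Fixed (Fixed Closed))))) (Fixed (Moved (Fixed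
 (Moved (Fixed Closed))))))))) (Branch (Fixed (Branch (Fixed (Branch (Moved (Fixed Closed)) (Fixed (Fixed (Moved (Fixed Closed)))))) (Fixed (Fixed (Fixed (Fixed
 (Moved (Fixed Closed)))))))) (Fixed (Fixed (Branch (Branch (Branch (Fixed Closed) (Fixed (Fixed (Fixed Closed)))) (Fixed Closed)) (Fixed (Fixed (Branch (Fixed (Fixed
 Closed)) (Fixed Closed))))))))) (Branch (Branch (Branch (Branch (Branch (Fixed (Fixed (Moved (Fixed Closed)))) (Fixed (Moved (Fixed Closed)))) (Branch (Branch (Fixed
 (Fixed Closed)) (Fixed (Fixed (Fixed (Fixed Closed))))) (Fixed (Fixed Closed)))) (Fixed (Fixed (Branch (Moved (Fixed (Moved (Fixed Closed)))) (Branch (Fixed (Fixed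
 (Fixed Closed))) (Fixed (Fixed Closed))))))) (Branch (Branch (Fixed (Branch (Branch (Fixed (Fixed Closed)) (Fixed Closed)) (Fixed (Fixed (Moved (Fixed Closed))))))
 (Branch (Branch (Branch (Fixed Closed) (Fixed (Fixed (Fixed Closed)))) (Branch Closed (Moved (Fixed (Moved (Fixed (Moved (Fixed Closed)))))))) (Moved (Fixed (Moved
 (Fixed (Moved (Fixed (Moved (Fixed Closed)))))))))) (Moved (Fixed (Moved (Fixed (Moved (Fixed (Moved (Fixed (Moved (Fixed Closed)))))))))))) (Moved
 (Fixed (Moved (Fixed (Moved (Fixed (Moved (Fixed (Moved (Fixed (Moved (Fixed Closed))))))))))))))))"
definition tree_two :: tree where
"tree_two = Branch (Branch Closed (Branch Closed (Moved (Fixed Closed)))) (Branch (Branch Closed (Moved (Fixed Closed))) (Branch (Moved (Fixed Closed)) (Fixed (Fixed Closed))))"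
definition tree_three :: tree where
"tree_three = Branch (Branch Closed (Branch Closed (Branch (Branch (Branch Closed (Fixed (Fixed Closed))) (Moved (Fixed (Moved (Moved (Moved (Fixed Closed))))))) (Branch Closed (Branch (Branch
 (Moved (Moved (Fixed Closed))) (Fixed (Moved (Moved (Fixed Closed))))) (Branch (Branch (Moved (Fixed (Fixed Closed))) (Fixed (Moved (Fixed Closed)))) (Moved (Fixed
 (Branch (Fixed Closed) (Moved (Moved (Fixed Closed)))))))))))) (Branch (Branch (Branch Closed (Branch (Fixed Closed) (Branch (Fixed (Moved (Fixed (Fixed Closed))))
 (Fixed (Moved (Moved (Fixed Closed))))))) (Branch (Branch (Branch Closed (Fixed (Fixed Closed))) (Moved (Fixed (Moved (Moved (Moved (Fixed Closed))))))) (Branch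
 (Fixed (Moved (Fixed (Fixed (Fixed Closed))))) (Fixed (Branch (Moved (Moved (Fixed Closed))) (Moved (Moved (Fixed (Fixed Closed))))))))) (Branch (Branch (Branch
 (Fixed Closed) (Branch (Fixed (Fixed Closed)) (Moved (Fixed (Moved (Moved (Fixed Closed))))))) (Branch Closed (Branch (Branch (Moved (Moved (Moved (Fixed Closed))))
 (Branch (Fixed (Moved (Fixed Closed))) (Fixed (Fixed Closed)))) (Branch (Moved (Fixed (Moved (Fixed Closed)))) (Moved (Fixed (Branch (Fixed Closed) (Moved (Moved
 (Fixed Closed)))))))))) (Branch (Branch (Moved (Moved (Moved (Fixed (Moved (Fixed Closed)))))) (Branch (Branch (Branch (Fixed (Fixed Closed)) (Fixed (Moved (Fixed
 Closed)))) (Fixed (Moved (Fixed (Fixed Closed))))) (Fixed (Branch (Moved (Fixed Closed)) (Fixed (Fixed (Fixed Closed))))))) (Branch (Branch (Branch (Moved (Moved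
 (Fixed Closed))) (Fixed (Moved (Moved (Fixed Closed))))) (Branch (Branch (Moved (Fixed (Fixed Closed))) (Fixed (Moved (Fixed Closed)))) (Moved (Fixed (Branch (Fixed
 Closed) (Moved (Moved (Fixed Closed)))))))) (Moved (Fixed (Branch (Fixed (Moved (Fixed Closed))) (Moved (Moved (Fixed (Moved (Fixed Closed))))))))))))"
definition seven_long :: tree where
"seven_long = Fixed (Moved (Moved (Fixed (Fixed (Moved (Fixed (Moved (Fixed (Fixed (Moved (Fixed (Fixed (Moved (Fixed (Moved (Fixed Closed))))))))))))))))"
definition seven_two :: tree where
"seven_two = Fixed (Moved (Moved (Moved (Moved (Moved (Moved (Fixed Closed)))))))"
definition seven_three :: tree where
"seven_three = Fixed (Moved (Moved (Fixed (Moved (Fixed (Fixed (Fixed Closed)))))))"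

lemma valid_tree_two: "valid 2 five_rounds tree_two" by code_simp
lemma valid_seven: "valid 0 seven_rounds seven_long" "valid 2 seven_rounds seven_two" "valid 3 seven_rounds seven_three" by code_simp+
lemma valid_tree_three: "valid 3 five_rounds tree_three" by code_simp
lemma valid_tree_long: "valid 0 five_rounds tree_long" by code_simp

section \<open>Return probabilities as polynomials in the densities\<close>

lemma val_tree_long: "val tree_long p q = p\<^sup>2 * (1 + q + 2 * q^3 + p * q + 4 * p^2 * q^2 + 3 * p^2 * q^7 + 3 * p^3 * q^3 + 6 * p^3 * q^6
   + 16 * p^4 * q^6 + 8 * p^4 * q^7 + 10 * p^4 * q^11 + 16 * p^5 * q^5 + 20 * p^5 * q^7 + 20 * p^6 * q^5 + 40 * p^6 * q^6)"
  by (simp add: tree_long_def algebra_simps power_numeral_reduce)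

lemma val_tree_two: "val tree_two p q = p\<^sup>2 * (1 + 2 * q + 4 * q^3)"
  by (simp add: tree_two_def algebra_simps power_numeral_reduce)

lemma val_tree_three: "val tree_three p q = p\<^sup>2 * (1 + q + 2 * q^3 + p * q + 4 * p * q ^ 10 + 4 * p^2 * q^2 + 6 * p^2 * q^6 + 15 * p^2 * q^7
   + 3 * p^3 * q^3 + 6 * p^3 * q^6 + 3 * p^4 * q^4)"
  by (simp add: tree_three_def algebra_simps power_numeral_reduce)

text \<open>\<open>val\<close> increases in each probability separately and
  \<open>1 - a + a / 2000\<close> decreases in \<open>a\<close>, so one rational evaluation covers a
  whole interval. The price is of the order of the width, hence short intervals where the margin is
  thin.\<close>

lemma val_interval:
  assumes "u \<le> a" "a \<le> v" "0 \<le> u" "v \<le> 1" "1 - u + u / 2000 \<le> val t (1 - v) u"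
  shows "1 - a + a / 2000 \<le> val t (1 - a) a"
proof -
  have "1 - a + a / 2000 \<le> 1 - u + u / 2000" using assms by simp
  also have "\<dots> \<le> val t (1 - v) u" by (rule assms)
  also have "\<dots> \<le> val t (1 - a) a" using assms by (intro val_mono) auto
  finally show ?thesis .
qed

text \<open>At \<open>a = 0\<close> both sides equal 1, which leaves the interval method no margin.
  The branches of lowest order in \<open>a\<close> suffice here: they alone gain about
  \<open>a\<close>.\<close>

lemma val_small:
  fixes a :: real
  assumes "0 \<le> a" "a \<le> 8 / 25"
  shows "1 - a + a / 2000 \<le> (1 - a)\<^sup>2 * (1 + a + (1 - a) * a)"
proof -
  have "(1 - a)\<^sup>2 * (1 + a + (1 - a) * a) - (1 - a + a / 2000) = a * (1999 / 2000 - 4 * a + 4 * a\<^sup>2 - a ^ 3)"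
    by (simp add: power2_eq_square power3_eq_cube algebra_simps)
  moreover have "a\<^sup>2 * a \<le> a\<^sup>2 * 1" using assms by (intro mult_left_mono) auto
  then have "a ^ 3 \<le> a\<^sup>2" by (simp add: power2_eq_square power3_eq_cube)
  moreover have "0 \<le> 1999 / 2000 - 4 * a + 3 * a\<^sup>2"
  proof -
    have "1999 / 2000 - 4 * a + 3 * a\<^sup>2 = (8 / 25 - a) * (4 - 3 * (a + 8 / 25)) + (1999 / 2000 - 32 / 25 + 192 / 625)"
      by (simp add: power2_eq_square field_simps)
    moreover have "0 \<le> (8 / 25 - a) * (4 - 3 * (a + 8 / 25))" using assms by (intro mult_nonneg_nonneg) auto
    ultimately show ?thesis by simp
  qed
  ultimately have "0 \<le> (1 - a)\<^sup>2 * (1 + a + (1 - a) * a) - (1 - a + a / 2000)"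
    using assms(1) by (simp only:) (intro mult_nonneg_nonneg, linarith+)
  then show ?thesis by simp
qed

lemma tree_long_gain:
  fixes a :: real
  assumes "0 \<le> a" "a \<le> 63 / 100"
  shows "1 - a + a / 2000 \<le> val tree_long (1 - a) a"
proof -
  \<comment> \<open>At 0.63 the margin is only about 0.0003, so the last interval has width
    0.00015.\<close>
  consider "a \<le> 8 / 25"
    | "12597 / 20000 \<le> a" "a \<le> 63 / 100"
    | "787 / 1250 \<le> a" "a \<le> 12597 / 20000"
    | "6293 / 10000 \<le> a" "a \<le> 787 / 1250"
    | "629 / 1000 \<le> a" "a \<le> 6293 / 10000"
    | "1257 / 2000 \<le> a" "a \<le> 629 / 1000"
    | "157 / 250 \<le> a" "a \<le> 1257 / 2000"
    | "392 / 625 \<le> a" "a \<le> 157 / 250"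
    | "313 / 500 \<le> a" "a \<le> 392 / 625"
    | "1249 / 2000 \<le> a" "a \<le> 313 / 500"
    | "623 / 1000 \<le> a" "a \<le> 1249 / 2000"
    | "621 / 1000 \<le> a" "a \<le> 623 / 1000"
    | "309 / 500 \<le> a" "a \<le> 621 / 1000"
    | "123 / 200 \<le> a" "a \<le> 309 / 500"
    | "61 / 100 \<le> a" "a \<le> 123 / 200"
    | "121 / 200 \<le> a" "a \<le> 61 / 100"
    | "149 / 250 \<le> a" "a \<le> 121 / 200"
    | "117 / 200 \<le> a" "a \<le> 149 / 250"
    | "57 / 100 \<le> a" "a \<le> 117 / 200"
    | "11 / 20 \<le> a" "a \<le> 57 / 100"
    | "53 / 100 \<le> a" "a \<le> 11 / 20"
    | "1 / 2 \<le> a" "a \<le> 53 / 100"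
    | "23 / 50 \<le> a" "a \<le> 1 / 2"
    | "41 / 100 \<le> a" "a \<le> 23 / 50"
    | "9 / 25 \<le> a" "a \<le> 41 / 100"
    | "3 / 10 \<le> a" "a \<le> 9 / 25"
    using assms(2) by argo
  then show ?thesis
  proof cases
    case 1
    let ?p = "1 - a"
    have "?p\<^sup>2 * (1 + a + ?p * a) \<le> val tree_long ?p a"
      unfolding val_tree_long using 1 assms by (intro mult_left_mono) auto
    then show ?thesis using val_small[OF assms(1) 1] by linarith
  qed ((erule (1) val_interval; simp add: val_tree_long power_divide)+)
qed

lemma tree_two_gain:
  fixes a :: real
  assumes "0 \<le> a" "a \<le> 63 / 100"
  shows "1 - a + a / 2000 \<le> val tree_two (1 - a) a"
proof -
  consider "a \<le> 8 / 25"
    | "59 / 100 \<le> a" "a \<le> 63 / 100"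
    | "11 / 20 \<le> a" "a \<le> 59 / 100"
    | "1 / 2 \<le> a" "a \<le> 11 / 20"
    | "9 / 20 \<le> a" "a \<le> 1 / 2"
    | "39 / 100 \<le> a" "a \<le> 9 / 20"
    | "33 / 100 \<le> a" "a \<le> 39 / 100"
    | "7 / 25 \<le> a" "a \<le> 33 / 100"
    using assms(2) by argo
  then show ?thesis
  proof cases
    case 1
    let ?p = "1 - a"
    have "?p\<^sup>2 * (1 + a + ?p * a) \<le> val tree_two ?p a"
      unfolding val_tree_two
    proof (rule mult_left_mono)
      have "?p * a \<le> 1 * a" using assms by (intro mult_right_mono) auto
      moreover have "0 \<le> 4 * a ^ 3" using assms by simp
      ultimately show "1 + a + ?p * a \<le> 1 + 2 * a + 4 * a ^ 3" by linarith
    qed simp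
    then show ?thesis using val_small[OF assms(1) 1] by linarith
  qed ((erule (1) val_interval; simp add: val_tree_two power_divide)+)
qed

lemma tree_three_gain:
  fixes a :: real
  assumes "0 \<le> a" "a \<le> 63 / 100"
  shows "1 - a + a / 2000 \<le> val tree_three (1 - a) a"
proof -
  consider "a \<le> 8 / 25"
    | "5 / 8 \<le> a" "a \<le> 63 / 100"
    | "31 / 50 \<le> a" "a \<le> 5 / 8"
    | "153 / 250 \<le> a" "a \<le> 31 / 50"
    | "3 / 5 \<le> a" "a \<le> 153 / 250"
    | "59 / 100 \<le> a" "a \<le> 3 / 5"
    | "23 / 40 \<le> a" "a \<le> 59 / 100"
    | "14 / 25 \<le> a" "a \<le> 23 / 40"
    | "27 / 50 \<le> a" "a \<le> 14 / 25"
    | "51 / 100 \<le> a" "a \<le> 27 / 50"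
    | "12 / 25 \<le> a" "a \<le> 51 / 100"
    | "11 / 25 \<le> a" "a \<le> 12 / 25"
    | "39 / 100 \<le> a" "a \<le> 11 / 25"
    | "33 / 100 \<le> a" "a \<le> 39 / 100"
    | "27 / 100 \<le> a" "a \<le> 33 / 100"
    using assms(2) by argo
  then show ?thesis
  proof cases
    case 1
    let ?p = "1 - a"
    have "?p\<^sup>2 * (1 + a + ?p * a) \<le> val tree_three ?p a"
      unfolding val_tree_three using 1 assms by (intro mult_left_mono) auto
    then show ?thesis using val_small[OF assms(1) 1] by linarith
  qed ((erule (1) val_interval; simp add: val_tree_three power_divide)+)
qed

section \<open>Shrinking the support\<close>

definition conj_by :: "('a \<Rightarrow> 'a) \<Rightarrow> ('a \<Rightarrow> 'a) \<Rightarrow> 'a \<Rightarrow> 'a" where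
  "conj_by h f = inv' h \<circ> (f \<circ> h)"

definition nested_comm :: "('a \<Rightarrow> 'a) \<Rightarrow> ('a \<Rightarrow> 'a) \<Rightarrow> 'a \<Rightarrow> 'a" where
  "nested_comm g h = conj_by h (inv' g) \<circ> (inv' g \<circ> (conj_by h g \<circ> (inv' g \<circ> (conj_by h (inv' g) \<circ> (g \<circ> (conj_by h g \<circ> g))))))"

lemma closes_round: "closes g h c0 (round_steps @ w) (False, x) = closes g h c0 w (False, nested_comm g h x)"
  by (simp add: round_steps_def nested_comm_def conj_by_def)

text \<open>The exponent 60 is the least common multiple of the orbit lengths 1 to 5.\<close>

lemma closes_five_rounds:
  assumes "closes g h (False, x) five_rounds (False, x)"
  shows "(nested_comm g h ^^ 60) x = x"
proof -
  let ?u = "nested_comm g h"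
  have red: "(?u ^^ 60) x = x" if "(?u ^^ m) x = x" "60 mod m = 0" for m
    using funpow_mod_eq[OF that(1), of 60] that(2) by simp
  have "?u x = x \<or> ?u (?u x) = x \<or> ?u (?u (?u x)) = x \<or> ?u (?u (?u (?u x))) = x \<or> ?u (?u (?u (?u (?u x)))) = x"
    using assms by (simp add: five_rounds_def numeral_eq_Suc closes_round eq_commute[of x])
  then have "(?u ^^ 1) x = x \<or> (?u ^^ 2) x = x \<or> (?u ^^ 3) x = x \<or> (?u ^^ 4) x = x \<or> (?u ^^ 5) x = x"
    by (simp add: numeral_eq_Suc)
  then show ?thesis using red[of 1] red[of 2] red[of 3] red[of 4] red[of 5] by fastforce
qed

lemma closes_seven_rounds:
  assumes "closes g h (False, x) seven_rounds (False, x)"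
  shows "(nested_comm g h ^^ 60) x \<noteq> x"
proof
  let ?u = "nested_comm g h"
  assume 60: "(?u ^^ 60) x = x"
  have "?u x \<noteq> x \<and> (?u (?u (?u (?u (?u (?u (?u x)))))) = x)"
    using assms by (simp add: seven_rounds_def numeral_eq_Suc closes_round append_assoc)
  then have 1: "?u x \<noteq> x" and 7: "(?u ^^ 7) x = x" by (simp_all add: numeral_eq_Suc)
  \<comment> \<open>Euclid's algorithm for 60 and 7, with remainders 4, 3 and 1.\<close>
  have 4: "(?u ^^ 4) x = x" using funpow_mod_eq[OF 7, of 60] 60 by simp
  have 3: "(?u ^^ 3) x = x" using funpow_mod_eq[OF 4, of 7] 7 by simp
  show False using funpow_mod_eq[OF 3, of 4] 4 1 by simp
qed

text \<open>If two permutations \<open>h\<close> agree on these points, then their nested commutators agree at \<open>x\<close>.\<close>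

definition stages :: "('a \<Rightarrow> 'a) \<Rightarrow> ('a \<Rightarrow> 'a) \<Rightarrow> 'a \<Rightarrow> 'a list" where
  "stages g h x = (let z1 = g x; z2 = conj_by h g z1; z3 = g z2; z4 = conj_by h (inv' g) z3;
     z5 = inv' g z4; z6 = conj_by h g z5; z7 = inv' g z6; z8 = conj_by h (inv' g) z7
     in [z1, z2, z3, z4, z5, z6, z7, z8])"

lemma conj_by_cong:
  assumes "bij h" "bij h0" "h y = h0 y" "h (conj_by h0 f y) = h0 (conj_by h0 f y)"
  shows "conj_by h f y = conj_by h0 f y"
proof -
  have "h (conj_by h0 f y) = f (h0 y)" using assms(2,4) by (simp add: conj_by_def bij_is_surj surj_f_inv_f)
  then have "inv' h (f (h0 y)) = conj_by h0 f y" using assms(1) by (metis bij_is_inj inv_f_f)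
  with assms(3) show ?thesis by (simp add: conj_by_def)
qed

lemma nested_comm_stages:
  assumes "bij h" "bij h0" "\<forall>z\<in>set (stages g h0 x). h z = h0 z"
  shows "nested_comm g h x = nested_comm g h0 x"
proof -
  note c = conj_by_cong[OF assms(1,2)]
  define z1 z2 z3 z4 z5 z6 z7 z8 where z: "z1 = g x" "z2 = conj_by h0 g z1" "z3 = g z2" "z4 = conj_by h0 (inv' g) z3"
     "z5 = inv' g z4" "z6 = conj_by h0 g z5" "z7 = inv' g z6" "z8 = conj_by h0 (inv' g) z7"
  have e: "h z1 = h0 z1" "h z2 = h0 z2" "h z3 = h0 z3" "h z4 = h0 z4" "h z5 = h0 z5" "h z6 = h0 z6"
     "h z7 = h0 z7" "h z8 = h0 z8"
    using assms(3) by (simp_all add: stages_def Let_def z)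
  have "conj_by h g z1 = z2" "conj_by h (inv' g) z3 = z4" "conj_by h g z5 = z6" "conj_by h (inv' g) z7 = z8"
    using c[of z1 g] c[of z3 "inv' g"] c[of z5 g] c[of z7 "inv' g"] e z(2,4,6,8) by (simp_all only:)
  then show ?thesis
    unfolding nested_comm_def comp_apply z(1)[symmetric] by (simp only: z[symmetric])
qed

section \<open>Words with boundedly many prescribed values\<close>

context perm_gens
begin

text \<open>A conditional probability, as the quotient of the equidistribution estimates for
  \<open>bs @ xs\<close> and for \<open>bs\<close>. The factor \<open>1 - 2 / d\<close> is a lower
  bound for \<open>(1 - 1 / d) / (1 + 1 / d)\<close>.\<close>

lemma conditioned:
  assumes h0: "h0 permutes {1..n}" and B: "B \<subseteq> {1..n}" and k: "card B + k \<le> k'" "k' + 2 \<le> n" and d: "d \<ge> 2"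
    and l: "l = 4 * (k' + 2)\<^sup>2 * n ^ (7 * k') * d\<^sup>2"
  shows "\<exists>I. finite I \<and> I \<noteq> {} \<and> (\<forall>ws\<in>I. foldr (\<circ>) ws id \<in> words S l) \<and>
    (\<forall>ws\<in>I. \<forall>b\<in>B. foldr (\<circ>) ws id b = h0 b) \<and>
    (\<forall>xs ys. distinct xs \<longrightarrow> distinct ys \<longrightarrow> length xs = length ys \<longrightarrow> length xs \<le> k \<longrightarrow>
        set xs \<subseteq> {1..n} - B \<longrightarrow> set ys \<subseteq> {1..n} - h0 ` B \<longrightarrow>
        (1 - 2 / real d) * real (card I) \<le> real n ^ length xs * real (card {ws \<in> I. map (foldr (\<circ>) ws id) xs = ys}))"
proof -
  have "d > 0" using d by simp
  obtain T where T: "finite T" "T \<subseteq> insert id S" "T \<noteq> {}"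
    and mix: "\<And>j xs ys. j \<le> k' \<Longrightarrow> xs \<in> tuples n j \<Longrightarrow> ys \<in> tuples n j \<Longrightarrow>
      \<bar>real (card {ws \<in> word_lists T l. map (foldr (\<circ>) ws id) xs = ys}) * real (card (tuples n j)) - real (card T) ^ l\<bar>
        \<le> real (card T) ^ l / real d"
    using mixing[OF k(2) \<open>d > 0\<close> l] by blast
  define W where "W = real (card T) ^ l"
  have W: "W > 0" using T by (auto simp: W_def card_gt_0_iff)
  define bs where "bs = sorted_list_of_set B"
  have finB: "finite B" using B finite_subset by blast
  have bs: "set bs = B" "distinct bs" "length bs = card B" using finB by (auto simp: bs_def)
  have bt: "bs \<in> tuples n (card B)" using bs B by (simp add: tuples_def)
  define cs where "cs = map h0 bs"
  have ct: "cs \<in> tuples n (card B)" unfolding cs_def by (rule tuples_map[OF h0 bt])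
  define I where "I = {ws \<in> word_lists T l. map (foldr (\<circ>) ws id) bs = cs}"
  define N0 where "N0 = real (card (tuples n (card B)))"
  have N0: "N0 > 0" using bt finite_tuples[of n "card B"] by (auto simp: N0_def card_gt_0_iff)
  have c0: "\<bar>real (card I) * N0 - W\<bar> \<le> W / real d"
    using mix[OF _ bt ct] k by (simp add: I_def N0_def W_def)
  show ?thesis
  proof (intro exI[of _ I] conjI ballI allI impI)
    show "finite I" using word_lists(1)[OF T(1), of l] by (simp add: I_def)
    have "W / real d \<le> W / 2" using W d by (intro divide_left_mono) auto
    then have "real (card I) * N0 > 0" using c0 W by linarith
    then show "I \<noteq> {}" by auto
    show "foldr (\<circ>) ws id \<in> words S l" if "ws \<in> I" for ws
      using foldr_words[of ws S] that T(2) by (auto simp: I_def word_lists_def)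
    show "foldr (\<circ>) ws id b = h0 b" if "ws \<in> I" "b \<in> B" for ws b
      using that bs(1) by (auto simp: I_def cs_def)
    fix xs ys assume xs: "distinct xs" "distinct ys" "length xs = length ys" "length xs \<le> k"
        "set xs \<subseteq> {1..n} - B" "set ys \<subseteq> {1..n} - h0 ` B"
    let ?j = "length xs"
    have x: "bs @ xs \<in> tuples n (card B + ?j)" using bs B xs by (auto simp: tuples_def)
    have y: "cs @ ys \<in> tuples n (card B + ?j)" using ct bs xs by (auto simp: tuples_def cs_def)
    define c where "c = real (card {ws \<in> I. map (foldr (\<circ>) ws id) xs = ys})"
    have "{ws \<in> I. map (foldr (\<circ>) ws id) xs = ys} = {ws \<in> word_lists T l. map (foldr (\<circ>) ws id) (bs @ xs) = cs @ ys}"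
      using bs by (auto simp: I_def cs_def)
    then have "\<bar>c * real (card (tuples n (card B + ?j))) - W\<bar> \<le> W / real d"
      using mix[OF _ x y] k xs by (simp add: c_def W_def)
    moreover have "c * real (card (tuples n (card B + ?j))) \<le> c * (N0 * real n ^ ?j)"
      using card_tuples_add[of n "card B" ?j] by (intro mult_left_mono) (simp_all add: c_def N0_def flip: of_nat_power of_nat_mult)
    ultimately have lo: "W - W / real d \<le> c * (N0 * real n ^ ?j)" by linarith
    have "(1 - 2 / real d) * (real (card I) * N0) \<le> (1 - 2 / real d) * (W + W / real d)"
      using c0 d by (intro mult_left_mono) auto
    also have "\<dots> \<le> W - W / real d"
    proof -
      have "(1 - 2 / real d) * (W + W / real d) = W - W / real d - 2 * W / (real d)\<^sup>2"
        using \<open>d > 0\<close> by (simp add: field_simps power2_eq_square)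
      then show ?thesis using W by simp
    qed
    also note lo
    finally have "((1 - 2 / real d) * real (card I)) * N0 \<le> (real n ^ ?j * c) * N0" by (simp add: mult_ac)
    then show "(1 - 2 / real d) * real (card I) \<le> real n ^ ?j * real (card {ws \<in> I. map (foldr (\<circ>) ws id) xs = ys})"
      using N0 by (simp add: c_def)
  qed
qed

end

definition moved :: "nat \<Rightarrow> (nat \<Rightarrow> nat) \<Rightarrow> nat" where
  "moved n g = card {x \<in> {1..n}. g x \<noteq> x}"

lemma fixed_moved: "card {x \<in> {1..n}. g x = x} + moved n g = n"
proof -
  have "card ({x \<in> {1..n}. g x = x} \<union> {x \<in> {1..n}. g x \<noteq> x}) = card {x \<in> {1..n}. g x = x} + moved n g"
    unfolding moved_def by (rule card_Un_disjoint) auto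
  moreover have "{x \<in> {1..n}. g x = x} \<union> {x \<in> {1..n}. g x \<noteq> x} = {1..n}" by auto
  ultimately show ?thesis by simp
qed

section \<open>One round of shrinking\<close>

context perm_gens
begin

lemma nested_comm_words:
  assumes "g \<in> words S L" "h \<in> words S l"
  shows "nested_comm g h ^^ 60 \<in> words S (480 * (L + l))"
proof -
  note ig = words_inv[OF bij_S assms(1)] and ih = words_inv[OF bij_S assms(2)]
  have c: "conj_by h f \<in> words S (l + (L + l))" if "f \<in> words S L" for f
    unfolding conj_by_def by (intro words_comp ih that assms(2))
  have "nested_comm g h \<in> words S ((l + (L + l)) + (L + ((l + (L + l)) + (L + ((l + (L + l)) + (L + ((l + (L + l)) + L)))))))"
    unfolding nested_comm_def by (intro words_comp c ig assms(1))
  then have "nested_comm g h \<in> words S (8 * (L + l))" by (rule subsetD[OF words_mono, rotated]) simp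
  from words_funpow[OF this, of 60] show ?thesis by (rule subsetD[OF words_mono, rotated]) simp
qed

text \<open>The longer word, \<open>seven_rounds\<close>, has 114 steps. The 60 iterates pass 8
  points each, giving up to 480 prescribed values; so tuples of length
  \<open>594 = 480 + 114\<close> are mixed, and \<open>60795 = 115 * 441 + 21 * 480\<close>.
  Precision \<open>2 * n\<close> costs the factor \<open>1 - 1 / n\<close>, which turns
  \<open>n\<close> into \<open>n - 1\<close>.\<close>

lemma engine_step:
  assumes g: "g permutes {1..n}" "g \<in> words S L" and n: "n \<ge> 600"
    and r: "r = 0 \<or> (r = 2 \<or> r = 3) \<and> g ^^ r = id"
    and valid_from: "valid r five_rounds t" "valid r seven_rounds st"
    and P: "P \<ge> 0" "real n * P + 60795 \<le> real (card {x \<in> {1..n}. g x = x})"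
    and Q: "Q \<ge> 0" "real n * Q + 60795 \<le> real (card {x \<in> {1..n}. g x \<noteq> x \<and> (r = 0 \<longrightarrow> (g ^^ 2) x \<noteq> x \<and> (g ^^ 3) x \<noteq> x)})"
    and pos: "val st P Q > 0"
    and l: "l = 4 * 596\<^sup>2 * n ^ (7 * 594) * (2 * n)\<^sup>2"
  shows "\<exists>g' \<in> words S (480 * (L + l)). g' \<noteq> id \<and>
    (real n - 1) * val t P Q \<le> real (card {x \<in> {1..n}. g' x = x})"
proof -
  let ?hh = "\<lambda>ws. foldr (\<circ>) ws id :: nat \<Rightarrow> nat"
  have lenlp: "length five_rounds \<le> 114" "length seven_rounds \<le> 114"
    by (simp_all add: five_rounds_def seven_rounds_def round_steps_def numeral_eq_Suc)
  have l': "l = 4 * (594 + 2)\<^sup>2 * n ^ (7 * 594) * (2 * n)\<^sup>2" using l by simp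
  have dn: "1 - 2 / real (2 * n) = 1 - 1 / real n" "1 - 1 / real n \<ge> 0" using n by auto
  have expl: "exploration n g r I ?hh (\<lambda>s. if s then h0 ` B else B) 114 60795 ((1 - 1 / real n) * real (card I)) P Q"
    if B: "card B \<le> 480" "finite B" and I: "finite I" "\<And>ws. ws \<in> I \<Longrightarrow> ?hh ws \<in> words S l"
      and unif: "\<And>xs ys. distinct xs \<Longrightarrow> distinct ys \<Longrightarrow> length xs = length ys \<Longrightarrow> length xs \<le> 114 \<Longrightarrow>
        set xs \<subseteq> {1..n} - B \<Longrightarrow> set ys \<subseteq> {1..n} - h0 ` B \<Longrightarrow>
        (1 - 2 / real (2 * n)) * real (card I) \<le> real n ^ length xs * real (card {ws \<in> I. map (?hh ws) xs = ys})"
    for I B and h0 :: "nat \<Rightarrow> nat"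
  proof
    have "card (if s then h0 ` B else B) \<le> 480" for s using card_image_le[OF B(2), of h0] B(1) by simp
    then show "Suc 114 * 441 + 21 * card (if s then h0 ` B else B) \<le> 60795" for s by (simp add: mult.commute)
    show "?hh i permutes {1..n}" if "i \<in> I" for i using I(2)[OF that] words_permutes by blast
    show "0 \<le> (1 - 1 / real n) * real (card I)" using dn(2) by (intro mult_nonneg_nonneg) auto
    show "(1 - 1 / real n) * real (card I) \<le> real n ^ length xs * real (card {i \<in> I. map (?hh i) xs = ys})"
      if "distinct xs" "distinct ys" "length xs = length ys" "length xs \<le> 114"
        "set xs \<subseteq> {1..n} - (if False then h0 ` B else B)" "set ys \<subseteq> {1..n} - (if True then h0 ` B else B)" for xs ys
      using unif[of xs ys] that dn(1) by simp
  qed (use g n r P Q I B in auto)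
  obtain I where I: "finite I" "I \<noteq> {}" "\<forall>ws\<in>I. ?hh ws \<in> words S l"
    and Iu: "\<forall>xs ys. distinct xs \<longrightarrow> distinct ys \<longrightarrow> length xs = length ys \<longrightarrow> length xs \<le> 114 \<longrightarrow>
        set xs \<subseteq> {1..n} - {} \<longrightarrow> set ys \<subseteq> {1..n} - id ` {} \<longrightarrow>
        (1 - 2 / real (2 * n)) * real (card I) \<le> real n ^ length xs * real (card {ws \<in> I. map (?hh ws) xs = ys})"
    using conditioned[OF permutes_id _ _ _ _ l', of "{}" 114] n by (elim exE conjE meta_impE) simp_all
  interpret E: exploration n g r I ?hh "\<lambda>s. if s then id ` {} else {}" 114 60795 "(1 - 1 / real n) * real (card I)" P Q
    by (rule expl) (use I in simp, simp, rule I(1), use I(3) in blast, rule Iu[rule_format])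
  obtain ws where ws: "ws \<in> I" "real n * ((1 - 1 / real n) * real (card I)) * val st P Q
      \<le> real (card I) * real (card {x \<in> {1..n}. closes g (?hh ws) (False, x) seven_rounds (False, x)})"
    by (rule E.explore_exists[OF valid_from(2) lenlp(2) I(2)])
  \<comment> \<open>Positivity is enough: one \<open>h0\<close> with one suitable orbit.\<close>
  have "real n * ((1 - 1 / real n) * real (card I)) * val st P Q > 0"
    using n I pos by (intro mult_pos_pos) (auto simp: card_gt_0_iff)
  then have "real (card I) * real (card {x \<in> {1..n}. closes g (?hh ws) (False, x) seven_rounds (False, x)}) > 0"
    using ws(2) by linarith
  then have "{x \<in> {1..n}. closes g (?hh ws) (False, x) seven_rounds (False, x)} \<noteq> {}"
    by (metis card.empty mult_zero_right of_nat_0 order_less_irrefl)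
  then obtain x0 where x0: "x0 \<in> {1..n}" "closes g (?hh ws) (False, x0) seven_rounds (False, x0)" by blast
  define h0 where "h0 = ?hh ws"
  have h0: "h0 permutes {1..n}" using bspec[OF I(3) ws(1)] words_permutes by (simp only: h0_def)
  have move: "(nested_comm g h0 ^^ 60) x0 \<noteq> x0" using closes_seven_rounds x0(2) by (simp only: h0_def not_False_eq_True)
  \<comment> \<open>All points at which agreement with \<open>h0\<close> forces the first 60
    iterates at \<open>x0\<close>; the second exploration keeps away from them.\<close>
  define B where "B = (\<Union>i<60. set (stages g h0 ((nested_comm g h0 ^^ i) x0)))"
  have "card B \<le> (\<Sum>i<60. card (set (stages g h0 ((nested_comm g h0 ^^ i) x0))))" unfolding B_def by (rule card_UN_le) simp
  also have "\<dots> \<le> (\<Sum>i<60::nat. 8)"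
    by (intro sum_mono order.trans[OF card_length]) (simp add: stages_def Let_def)
  finally have cB: "card B \<le> 480" by simp
  have perms: "g permutes {1..n}" "inv' g permutes {1..n}" "inv' h0 permutes {1..n}" "h0 permutes {1..n}"
    using g h0 by (auto intro: permutes_inv)
  have cin: "f permutes {1..n} \<Longrightarrow> conj_by h0 f permutes {1..n}" for f
    unfolding conj_by_def by (intro permutes_compose perms)
  have Uin: "nested_comm g h0 permutes {1..n}" unfolding nested_comm_def by (intro permutes_compose cin perms)
  have stin: "set (stages g h0 x) \<subseteq> {1..n}" if "x \<in> {1..n}" for x
  proof -
    have im: "p y \<in> {1..n}" if "p permutes {1..n}" "y \<in> {1..n}" for p y
      using that by (simp only: permutes_in_image)
    note i = im[OF perms(1)] im[OF perms(2)] im[OF cin[OF perms(1)]] im[OF cin[OF perms(2)]]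
    show ?thesis unfolding stages_def Let_def list.set insert_subset by (intro conjI i that empty_subsetI)
  qed
  have Bsub: "B \<subseteq> {1..n}"
    unfolding B_def by (intro UN_least stin permutes_funpow_in[OF Uin x0(1)])
  have finB: "finite B" using Bsub finite_subset by blast
  obtain J where J: "finite J" "J \<noteq> {}" "\<forall>ws\<in>J. ?hh ws \<in> words S l" "\<forall>ws\<in>J. \<forall>b\<in>B. ?hh ws b = h0 b"
    and Ju: "\<forall>xs ys. distinct xs \<longrightarrow> distinct ys \<longrightarrow> length xs = length ys \<longrightarrow> length xs \<le> 114 \<longrightarrow>
        set xs \<subseteq> {1..n} - B \<longrightarrow> set ys \<subseteq> {1..n} - h0 ` B \<longrightarrow>
        (1 - 2 / real (2 * n)) * real (card J) \<le> real n ^ length xs * real (card {ws \<in> J. map (?hh ws) xs = ys})"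
    using conditioned[OF h0 Bsub _ _ _ l', of 114] n cB by (elim exE conjE meta_impE) simp_all
  interpret F: exploration n g r J ?hh "\<lambda>s. if s then h0 ` B else B" 114 60795 "(1 - 1 / real n) * real (card J)" P Q
    by (rule expl) (rule cB, rule finB, rule J(1), use J(3) in blast, rule Ju[rule_format])
  \<comment> \<open>\<open>vertices\<close> is here the word in \<open>J\<close> that attains at
    least the average.\<close>
  obtain vertices where vertices: "vertices \<in> J" "real n * ((1 - 1 / real n) * real (card J)) * val t P Q
      \<le> real (card J) * real (card {x \<in> {1..n}. closes g (?hh vertices) (False, x) five_rounds (False, x)})"
    by (rule F.explore_exists[OF valid_from(1) lenlp(1) J(2)])
  define h where "h = ?hh vertices"
  have h: "h permutes {1..n}" "h \<in> words S l" using bspec[OF J(3) vertices(1)] words_permutes by (simp_all only: h_def)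
  have "(nested_comm g h ^^ i) x0 = (nested_comm g h0 ^^ i) x0" if "i \<le> 60" for i
    using that
  proof (induction i)
    case (Suc i)
    have "nested_comm g h ((nested_comm g h0 ^^ i) x0) = nested_comm g h0 ((nested_comm g h0 ^^ i) x0)"
    proof (rule nested_comm_stages)
      show "bij h" "bij h0" using h(1) h0 permutes_bij by blast+
      show "\<forall>z\<in>set (stages g h0 ((nested_comm g h0 ^^ i) x0)). h z = h0 z"
        using bspec[OF J(4) vertices(1)] Suc.prems unfolding B_def h_def by (simp add: Suc_le_eq)
    qed
    then show ?case using Suc by simp
  qed simp
  from this[of 60] move have "(nested_comm g h ^^ 60) x0 \<noteq> x0" by simp
  then have ne: "nested_comm g h ^^ 60 \<noteq> id" by (metis id_apply)
  have "card {x \<in> {1..n}. closes g h (False, x) five_rounds (False, x)} \<le> card {x \<in> {1..n}. (nested_comm g h ^^ 60) x = x}"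
    by (intro card_mono) (auto dest: closes_five_rounds)
  then have "real (card J) * real (card {x \<in> {1..n}. closes g h (False, x) five_rounds (False, x)}) \<le>
      real (card J) * real (card {x \<in> {1..n}. (nested_comm g h ^^ 60) x = x})" by (intro mult_left_mono) auto
  moreover have "real n * ((1 - 1 / real n) * real (card J)) * val t P Q = real (card J) * ((real n - 1) * val t P Q)"
    using n by (simp add: field_simps)
  ultimately have "real (card J) * ((real n - 1) * val t P Q) \<le> real (card J) * real (card {x \<in> {1..n}. (nested_comm g h ^^ 60) x = x})"
    using vertices(2) unfolding h_def by linarith
  moreover have "real (card J) > 0" using J by (simp add: card_gt_0_iff)
  ultimately have "(real n - 1) * val t P Q \<le> real (card {x \<in> {1..n}. (nested_comm g h ^^ 60) x = x})"
    by (simp only: mult_le_cancel_left_pos)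
  with ne nested_comm_words[OF g(2) h(2)] show ?thesis by blast
qed

end

lemma moved_pow:
  "moved n (g ^^ m) + card {x \<in> {1..n}. g x \<noteq> x \<and> (g ^^ m) x = x} \<le> moved n g"
proof -
  have fix_pow: "(g ^^ m) x = x" if "g x = x" for x using that by (induction m) auto
  have "moved n (g ^^ m) + card {x \<in> {1..n}. g x \<noteq> x \<and> (g ^^ m) x = x} =
      card ({x \<in> {1..n}. (g ^^ m) x \<noteq> x} \<union> {x \<in> {1..n}. g x \<noteq> x \<and> (g ^^ m) x = x})"
    unfolding moved_def by (rule card_Un_disjoint[symmetric]) auto
  also have "\<dots> \<le> moved n g" unfolding moved_def using fix_pow by (intro card_mono) auto
  finally show ?thesis .
qed

context perm_gens
begin

lemma shrink_core:
  assumes g: "g permutes {1..n}" "g \<in> words S L"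
    and big: "10 ^ 10 \<le> real (moved n g)" and dens: "real (moved n g) \<le> 63 / 100 * real n"
    and r: "r = 0 \<or> (r = 2 \<or> r = 3) \<and> g ^^ r = id"
    and valid_from: "valid r five_rounds t" "valid r seven_rounds st"
    and gain: "\<And>a. 0 \<le> a \<Longrightarrow> a \<le> 63 / 100 \<Longrightarrow> 1 - a + a / 2000 \<le> val t (1 - a) a"
    and ht: "height t \<le> 20" and pos: "\<And>P Q. 0 < P \<Longrightarrow> 0 < Q \<Longrightarrow> 0 < val st P Q"
    and goods: "(1 - 2 / 10 ^ 6) * real (moved n g) \<le>
      real (card {x \<in> {1..n}. g x \<noteq> x \<and> (r = 0 \<longrightarrow> (g ^^ 2) x \<noteq> x \<and> (g ^^ 3) x \<noteq> x)})"
    and l: "l = 4 * 596\<^sup>2 * n ^ (7 * 594) * (2 * n)\<^sup>2"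
  shows "\<exists>g' \<in> words S (480 * (L + l)). g' \<noteq> id \<and> real (moved n g') \<le> (1 - 1 / 10 ^ 6) * real (moved n g)"
proof -
  define N s K where "N = real n" and "s = real (moved n g)" and "K = (60795 :: real)"
  have fixed: "real (card {x \<in> {1..n}. f x = x}) = N - real (moved n f)" for f
    using fixed_moved[of n f] unfolding N_def by linarith
  have s: "10 ^ 10 \<le> s" "s \<le> 63 / 100 * N" using big dens by (simp_all only: s_def N_def)
  then have N: "N \<ge> 10 ^ 10" by simp
  \<comment> \<open>The densities of fixed and of good moved points once \<open>K\<close> points of
    each kind are set aside.\<close>
  define P Q where "P = (N - s - K) / N" and "Q = ((1 - 2 / 10 ^ 6) * s - K) / N"
  define a where "a = s / N"
  have NP: "N * P = N - s - K" "N * Q = (1 - 2 / 10 ^ 6) * s - K" "N * a = s"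
    using N by (simp_all add: P_def Q_def a_def)
  have P0: "P > 0" "Q > 0" using N s unfolding P_def Q_def K_def by (auto intro!: divide_pos_pos)
  have a: "0 \<le> a" "a \<le> 63 / 100" using s N by (auto simp: a_def field_simps)
  have PQ: "P \<le> 1 - a" "Q \<le> a"
    using N s by (auto simp: P_def Q_def a_def K_def field_simps)
  have "real 600 \<le> real n" using N unfolding N_def by simp
  then have n600: "n \<ge> 600" by (simp only: of_nat_le_iff)
  have "\<exists>g' \<in> words S (480 * (L + l)). g' \<noteq> id \<and> (real n - 1) * val t P Q \<le> real (card {x \<in> {1..n}. g' x = x})"
  proof (rule engine_step[OF g n600 r valid_from _ _ _ _ _ l])
    show "0 \<le> P" "0 \<le> Q" using P0 by simp_all
    show "real n * P + 60795 \<le> real (card {x \<in> {1..n}. g x = x})"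
      using NP(1) fixed[of g] unfolding N_def[symmetric] s_def[symmetric] K_def by linarith
    show "real n * Q + 60795 \<le> real (card {x \<in> {1..n}. g x \<noteq> x \<and> (r = 0 \<longrightarrow> (g ^^ 2) x \<noteq> x \<and> (g ^^ 3) x \<noteq> x)})"
      using NP(2) goods unfolding N_def[symmetric] s_def[symmetric] K_def by linarith
    show "0 < val st P Q" by (rule pos[OF P0])
  qed
  then obtain g' where g': "g' \<in> words S (480 * (L + l))" "g' \<noteq> id"
    and f: "(N - 1) * val t P Q \<le> N - real (moved n g')" using fixed unfolding N_def by auto
  have v1: "val t P Q \<le> 1" using P0 PQ by (intro val_le_1) auto
  have "val t (1 - a) a - val t P Q \<le> real (height t) * ((1 - a - P) + (a - Q))"
    using P0 PQ by (intro val_lipschitz) auto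
  also have "\<dots> \<le> 20 * ((1 - a - P) + (a - Q))" using ht PQ by (intro mult_right_mono) auto
  finally have "1 - a + a / 2000 - 20 * ((1 - a - P) + (a - Q)) \<le> val t P Q" using gain[OF a] by linarith
  then have "N * (1 - a + a / 2000 - 20 * ((1 - a - P) + (a - Q))) \<le> N * val t P Q"
    using N by (intro mult_left_mono) auto
  moreover have "N * (1 - a + a / 2000 - 20 * ((1 - a - P) + (a - Q))) =
      N - N * a + N * a / 2000 - 20 * (N - N * a - N * P + (N * a - N * Q))"
    by (simp add: algebra_simps)
  ultimately have "N - s + s / 2000 - 20 * (2 * K + 2 / 10 ^ 6 * s) \<le> N * val t P Q"
    unfolding NP by (simp add: algebra_simps)
  moreover have "N * val t P Q - 1 \<le> (N - 1) * val t P Q" using v1 by (simp add: algebra_simps)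
  ultimately have "real (moved n g') \<le> s - s / 2000 + 20 * (2 * K + 2 / 10 ^ 6 * s) + 1" using f by linarith
  \<comment> \<open>The gain is \<open>s / 2000\<close>; the losses are
    \<open>4 * s / 10 ^ 5\<close> from short cycles and the constant \<open>40 * K + 1\<close>. More
    than \<open>s / 10 ^ 6\<close> remains once \<open>s\<close> exceeds about
    \<open>5.3 * 10 ^ 9\<close>, whence the threshold \<open>10 ^ 10\<close>.\<close>
  also have "\<dots> \<le> (1 - 1 / 10 ^ 6) * s" using s(1) unfolding K_def by simp
  finally show ?thesis using g' unfolding s_def by blast
qed

text \<open>With \<open>d = 2\<close> the error is at most half the main term, so every count is
  positive.\<close>

lemma tuple_reach:
  assumes "k + 2 \<le> n" "j \<le> k" "xs \<in> tuples n j" "ys \<in> tuples n j"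
  shows "\<exists>h \<in> words S (16 * (k + 2)\<^sup>2 * n ^ (7 * k)). map h xs = ys"
proof -
  define l where "l = 4 * (k + 2)\<^sup>2 * n ^ (7 * k) * 2\<^sup>2"
  obtain T where T: "finite T" "T \<subseteq> insert id S" "T \<noteq> {}" and mix:
      "\<And>j xs ys. j \<le> k \<Longrightarrow> xs \<in> tuples n j \<Longrightarrow> ys \<in> tuples n j \<Longrightarrow>
      \<bar>real (card {ws \<in> word_lists T l. map (foldr (\<circ>) ws id) xs = ys}) * real (card (tuples n j)) - real (card T) ^ l\<bar>
        \<le> real (card T) ^ l / real 2"
    using mixing[OF assms(1) _ l_def] by auto
  define W where "W = real (card T) ^ l"
  have "W > 0" using T by (simp add: card_gt_0_iff W_def)
  then have "real (card {ws \<in> word_lists T l. map (foldr (\<circ>) ws id) xs = ys}) * real (card (tuples n j)) > 0"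
    using mix[OF assms(2-4)] unfolding W_def[symmetric] of_nat_numeral by linarith
  then have "{ws \<in> word_lists T l. map (foldr (\<circ>) ws id) xs = ys} \<noteq> {}"
    by (metis card.empty mult_zero_left of_nat_0 order_less_irrefl)
  then obtain ws where ws: "ws \<in> word_lists T l" "map (foldr (\<circ>) ws id) xs = ys" by blast
  have "foldr (\<circ>) ws id \<in> words S l" using foldr_words[of ws S] ws(1) T(2) by (auto simp: word_lists_def)
  moreover have "l = 16 * (k + 2)\<^sup>2 * n ^ (7 * k)" by (simp add: l_def)
  ultimately show ?thesis using ws(2) by blast
qed

end

section \<open>Three-cycles\<close>

definition three_cycle :: "'a \<Rightarrow> 'a \<Rightarrow> 'a \<Rightarrow> 'a \<Rightarrow> 'a" where
  "three_cycle p q r = (\<lambda>z. if z = p then q else if z = q then r else if z = r then p else z)"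

lemma three_cycle_transpose: "distinct [p, q, r] \<Longrightarrow> three_cycle p q r = Transposition.transpose p q \<circ> Transposition.transpose q r"
  by (auto simp: three_cycle_def fun_eq_iff Transposition.transpose_def)

lemma three_cycle_conj:
  assumes "bij h" shows "h \<circ> (three_cycle p q r \<circ> inv' h) = three_cycle (h p) (h q) (h r)"
proof
  fix z
  obtain w where z: "z = h w" using assms by (metis bij_pointE)
  have i: "h u = h v \<longleftrightarrow> u = v" for u v using inj_eq[OF bij_is_inj[OF assms]] .
  have "inv' h (h w) = w" using assms by (simp only: bij_is_inj inv_f_f)
  then show "(h \<circ> (three_cycle p q r \<circ> inv' h)) z = three_cycle (h p) (h q) (h r) z"
    unfolding z by (auto simp: three_cycle_def i)
qed

lemma commutator_three_cycle:
  assumes a: "bij a" and b: "bij b" and only: "\<And>z. a z \<noteq> z \<Longrightarrow> b z \<noteq> z \<Longrightarrow> z = x" and x: "a x \<noteq> x" "b x \<noteq> x"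
  shows "a \<circ> (b \<circ> (inv' a \<circ> inv' b)) = three_cycle x (a x) (b x)"
proof
  fix z
  have ia: "inv' a y = w \<longleftrightarrow> y = a w" and ib: "inv' b y = w \<longleftrightarrow> y = b w" for y w
    using a b by (metis bij_inv_eq_iff)+
  have ja: "a y = a w \<longleftrightarrow> y = w" and jb: "b y = b w \<longleftrightarrow> y = w" for y w
    using a b by (auto dest: bij_is_inj injD)
  have ax: "b (a x) = a x" using only[of "a x"] x ja by metis
  have bx: "a (b x) = b x" using only[of "b x"] x jb by metis
  \<comment> \<open>Writing \<open>z = b (a w)\<close> removes the inverses: \<open>a (b w)\<close>
    is compared with \<open>b (a w)\<close>, and the two agree unless \<open>w\<close>,
    \<open>a w\<close> or \<open>b (a w)\<close> is the common point \<open>x\<close>.\<close>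
  define y where "y = inv' b z"
  have z: "z = b y" using ib unfolding y_def by metis
  define w where "w = inv' a y"
  have y: "y = a w" using ia unfolding w_def by metis
  have "a (b w) = three_cycle x (a x) (b x) (b (a w))"
  proof -
    have axbx: "a x \<noteq> b x" using ax bx x ja by metis
    consider "w = x" | "a w = x" | "b (a w) = x" | "w \<noteq> x" "a w \<noteq> x" "b (a w) \<noteq> x" by blast
    then show ?thesis
    proof cases
      case 1
      then show ?thesis using ax bx x by (simp add: three_cycle_def)
    next
      case 2
      then have "b w = w" using only[of w] x by metis
      then show ?thesis using 2 x axbx by (simp add: three_cycle_def)
    next
      case 3
      then have "a (a w) = a w" using only[of "a w"] x by metis
      then have "a w = w" by (simp only: ja)
      then have "b w = x" using 3 by simp
      then show ?thesis using 3 by (simp add: three_cycle_def)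
    next
      case 4
      have "b (a w) \<noteq> a x" using 4(1) ax jb ja by metis
      moreover have "b (a w) \<noteq> b x" using 4(2) jb by metis
      ultimately have c: "three_cycle x (a x) (b x) (b (a w)) = b (a w)" using 4(3) by (simp add: three_cycle_def)
      have "a (b w) = b (a w)"
      proof (cases "a w = w")
        case True
        then have "b w \<noteq> x" using 4(3) by simp
        then have "a (b w) = b w" using only[of "b w"] True jb by metis
        with True show ?thesis by simp
      next
        case False
        then have bw: "b w = w" using only[of w] 4(1) by metis
        have "a (a w) \<noteq> a w" using False ja by metis
        then have "b (a w) = a w" using only[of "a w"] 4(2) by metis
        with bw show ?thesis by simp
      qed
      with c show ?thesis by simp
    qed
  qed
  then show "(a \<circ> (b \<circ> (inv' a \<circ> inv' b))) z = three_cycle x (a x) (b x) z"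
    unfolding comp_apply y_def[symmetric] w_def[symmetric] unfolding z y .
qed

section \<open>From small support to the whole group\<close>

context perm_gens
begin

text \<open>\<open>h\<close> fixes one moved point \<open>x\<close> and carries points fixed by
  \<open>g\<close> onto the remaining moved points. The conjugate \<open>b = h^-1 g h\<close> then
  shares with \<open>g\<close> only the moved point \<open>x\<close>.\<close>

lemma three_cycle_exists:
  assumes g: "g permutes {1..n}" "g \<in> words S L" "g \<noteq> id" and k: "moved n g \<le> k" "2 * k + 2 \<le> n"
  shows "\<exists>x y z. {x, y, z} \<subseteq> {1..n} \<and> distinct [x, y, z] \<and>
    three_cycle x y z \<in> words S (4 * (L + 16 * (k + 2)\<^sup>2 * n ^ (7 * k)))"
proof -
  define l where "l = 16 * (k + 2)\<^sup>2 * n ^ (7 * k)"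
  define A where "A = {x \<in> {1..n}. g x \<noteq> x}"
  have mv: "g z \<noteq> z \<longleftrightarrow> z \<in> A" for z
    using permutes_not_in[OF g(1), of z] by (auto simp: A_def)
  have finA: "finite A" and cA: "card A \<le> k" and AS: "A \<subseteq> {1..n}"
    using k by (auto simp: A_def moved_def)
  obtain x where x: "x \<in> A" using g(3) mv by (metis eq_id_iff)
  define xs where "xs = x # sorted_list_of_set (A - {x})"
  have xs: "set xs = A" "distinct xs" "length xs = card A"
    using x finA card_Suc_Diff1[OF finA x] by (auto simp: xs_def)
  have "card ({1..n} - A) = n - card A" using AS finA by (simp add: card_Diff_subset)
  then have "card A - 1 \<le> card ({1..n} - A)" using cA k by simp
  then obtain B where B: "B \<subseteq> {1..n} - A" "card B = card A - 1" using obtain_subset_with_card_n by metis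
  have finB: "finite B" using B finite_subset by blast
  define ys where "ys = x # sorted_list_of_set B"
  have "card A > 0" using x finA card_gt_0_iff by blast
  then have ys: "set ys = insert x B" "distinct ys" "length ys = card A"
    using B x finB by (auto simp: ys_def)
  have "xs \<in> tuples n (card A)" "ys \<in> tuples n (card A)" using xs ys AS B x by (auto simp: tuples_def)
  then obtain h where h: "h \<in> words S l" "map h ys = xs"
    using tuple_reach[of k "card A" ys xs] cA k unfolding l_def by auto
  have bh: "bij h" using words_bij[OF bij_S h(1)] .
  have hx: "h x = x" using h(2) by (simp add: xs_def ys_def)
  define b where "b = conj_by h g"
  have bm: "b z \<noteq> z \<longleftrightarrow> h z \<in> A" for z
  proof -
    have "b z = z \<longleftrightarrow> g (h z) = h z" unfolding b_def conj_by_def comp_apply using bij_inv_eq_iff[OF bh, of z "g (h z)"] by metis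
    then show ?thesis using mv by blast
  qed
  have bys: "z \<in> insert x B" if "h z \<in> A" for z
  proof -
    have "h z \<in> h ` set ys" using that h(2) xs(1) by (metis list.set_map)
    then show ?thesis using bij_is_inj[OF bh] ys(1) by (auto dest: injD)
  qed
  have only: "z = x" if "g z \<noteq> z" "b z \<noteq> z" for z
    using that bys[of z] B(1) unfolding mv bm by blast
  have gx: "g x \<noteq> x" "b x \<noteq> x" using x hx mv bm by simp_all
  have bg: "bij g" using permutes_bij[OF g(1)] .
  have bWd: "b \<in> words S (l + (L + l))"
    unfolding b_def conj_by_def by (intro words_comp words_inv[OF bij_S h(1)] g(2) h(1)) assumption
  have bb: "bij b" using words_bij[OF bij_S bWd] .
  have bp: "b permutes {1..n}" using words_permutes[OF bWd] .
  have "three_cycle x (g x) (b x) = g \<circ> (b \<circ> (inv' g \<circ> inv' b))"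
    using commutator_three_cycle[OF bg bb only gx] by simp
  also have "\<dots> \<in> words S (L + ((l + (L + l)) + (L + (l + (L + l)))))"
    by (intro words_comp g(2) bWd words_inv[OF bij_S g(2)] words_inv[OF bij_S bWd]) assumption+
  also have "L + ((l + (L + l)) + (L + (l + (L + l)))) = 4 * (L + l)" by simp
  finally have w: "three_cycle x (g x) (b x) \<in> words S (4 * (L + l))" .
  have "g (g x) \<noteq> g x" "b (b x) \<noteq> b x" using gx bg bb by (auto dest: bij_is_inj injD)
  then have "g x \<noteq> b x" using only[of "g x"] gx by metis
  moreover have "x \<in> {1..n}" using x AS by blast
  moreover then have "g x \<in> {1..n}" "b x \<in> {1..n}" using permutes_in_image[OF g(1)] permutes_in_image[OF bp] by blast+
  ultimately show ?thesis using w gx unfolding l_def[symmetric]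
    by (intro exI[of _ x] exI[of _ "g x"] exI[of _ "b x"] conjI) auto
qed

lemma all_three_cycles:
  assumes c: "three_cycle x y z \<in> words S L" "{x, y, z} \<subseteq> {1..n}" "distinct [x, y, z]" and n: "5 \<le> n"
    and pqr: "{p, q, r} \<subseteq> {1..n}" "distinct [p, q, r]"
  shows "three_cycle p q r \<in> words S (L + 2 * (16 * 25 * n ^ 21))"
proof -
  define l where "l = 16 * 25 * n ^ 21"
  \<comment> \<open>The case \<open>k = 3\<close> of \<open>tuple_reach\<close>:
    \<open>(3 + 2)^2 = 25\<close> and \<open>7 * 3 = 21\<close>.\<close>
  have "[x, y, z] \<in> tuples n 3" "[p, q, r] \<in> tuples n 3" using c pqr by (auto simp: tuples_def)
  then obtain h where h: "h \<in> words S l" "map h [x, y, z] = [p, q, r]"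
    using tuple_reach[of 3 3 "[x, y, z]" "[p, q, r]"] n unfolding l_def by auto
  have bh: "bij h" using words_bij[OF bij_S h(1)] .
  have "three_cycle p q r = h \<circ> (three_cycle x y z \<circ> inv' h)" using three_cycle_conj[OF bh, of x y z] h(2) by simp
  also have "\<dots> \<in> words S (l + (L + l))" by (intro words_comp h(1) c(1) words_inv[OF bij_S h(1)]) assumption
  also have "l + (L + l) = L + 2 * l" by simp
  finally show ?thesis unfolding l_def .
qed

text \<open>Composing with the three-cycle through \<open>y = f x\<close>, \<open>x\<close> and a
  third moved point \<open>z\<close> makes \<open>x\<close> fixed and moves no new point, so the
  support shrinks with every factor.\<close>

lemma even_words:
  assumes c: "\<And>p q r. {p, q, r} \<subseteq> {1..n} \<Longrightarrow> distinct [p, q, r] \<Longrightarrow> three_cycle p q r \<in> words S M"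
  shows "f permutes {1..n} \<Longrightarrow> evenperm f \<Longrightarrow> moved n f \<le> m \<Longrightarrow> f \<in> words S (m * M)"
proof (induction m arbitrary: f)
  case 0
  then have "{x \<in> {1..n}. f x \<noteq> x} = {}" by (simp add: moved_def)
  then have "f x = x" for x using permutes_not_in[OF 0(1), of x] by auto
  then have "f = id" by (simp add: fun_eq_iff)
  then show ?case using id_words by metis
next
  case (Suc m)
  show ?case
  proof (cases "f = id")
    case True
    then show ?thesis using id_words by metis
  next
    case False
    then obtain x where x: "f x \<noteq> x" by (metis eq_id_iff)
    have inj: "f u = f v \<longleftrightarrow> u = v" for u v using permutes_inj[OF Suc.prems(1)] by (rule inj_eq)
    have inr: "u \<in> {1..n}" if "f u \<noteq> u" for u using permutes_not_in[OF Suc.prems(1)] that by blast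
    define y where "y = f x"
    have y: "f y \<noteq> y" "x \<noteq> y" using x inj by (auto simp: y_def)
    \<comment> \<open>With only two moved points \<open>f\<close> would be a transposition, hence
      odd.\<close>
    have "\<exists>z. f z \<noteq> z \<and> z \<noteq> x \<and> z \<noteq> y"
    proof (rule ccontr)
      assume no: "\<not> ?thesis"
      then have "f y = x" using y inj by (metis y_def)
      then have "f = Transposition.transpose x y"
        using no by (auto simp: fun_eq_iff Transposition.transpose_def y_def)
      then show False using Suc.prems(2) y(2) evenperm_swap by metis
    qed
    then obtain z where z: "f z \<noteq> z" "z \<noteq> x" "z \<noteq> y" by blast
    have d: "distinct [y, x, z]" "distinct [x, y, z]" using y z by auto
    have sub: "{y, x, z} \<subseteq> {1..n}" "{x, y, z} \<subseteq> {1..n}" using inr x y z by auto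
    define f' where "f' = three_cycle y x z \<circ> f"
    have cp: "three_cycle y x z permutes {1..n}"
      unfolding three_cycle_transpose[OF d(1)] using sub by (intro permutes_compose permutes_swap_id) auto
    have f'p: "f' permutes {1..n}" unfolding f'_def by (rule permutes_compose[OF Suc.prems(1) cp])
    have pf: "permutation f" using Suc.prems(1) permutation_permutes by blast
    have ec: "evenperm (three_cycle y x z)" unfolding three_cycle_transpose[OF d(1)] using d
      by (simp only: evenperm_comp permutation_swap_id evenperm_swap) auto
    have pc: "permutation (three_cycle y x z)" using cp permutation_permutes by blast
    have ef: "evenperm f'" unfolding f'_def using evenperm_comp[OF pc pf] ec Suc.prems(2) by simp
    have "{u \<in> {1..n}. f' u \<noteq> u} \<subseteq> {u \<in> {1..n}. f u \<noteq> u} - {x}"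
    proof
      fix u assume u: "u \<in> {u \<in> {1..n}. f' u \<noteq> u}"
      have "f' x = x" by (simp add: f'_def three_cycle_def y_def)
      then have "u \<noteq> x" using u by auto
      moreover have "f u \<noteq> u"
      proof
        assume "f u = u"
        then have "three_cycle y x z u \<noteq> u" using u by (simp add: f'_def)
        then have "u = y \<or> u = x \<or> u = z" by (auto simp: three_cycle_def split: if_splits)
        then show False using \<open>f u = u\<close> x y z by auto
      qed
      ultimately show "u \<in> {u \<in> {1..n}. f u \<noteq> u} - {x}" using u by blast
    qed
    then have "moved n f' \<le> card ({u \<in> {1..n}. f u \<noteq> u} - {x})" unfolding moved_def by (rule card_mono[rotated]) simp
    also have "\<dots> \<le> m" using Suc.prems(3) x inr[of x] by (simp add: moved_def)
    finally have "f' \<in> words S (m * M)" by (rule Suc.IH[OF f'p ef])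
    moreover have "three_cycle x y z \<in> words S M" by (rule c[OF sub(2) d(2)])
    ultimately have w: "three_cycle x y z \<circ> f' \<in> words S (M + m * M)" by (rule words_comp[rotated])
    have "three_cycle x y z (three_cycle y x z u) = u" for u using d by (auto simp: three_cycle_def)
    then have "three_cycle x y z \<circ> f' = f" unfolding f'_def by (intro ext) (simp only: comp_apply)
    with w show ?thesis by (simp only: mult_Suc)
  qed
qed

text \<open>If an odd permutation occurs, some generator is odd, and multiplying by it reduces to
  the even case; this is the extra letter.\<close>

lemma carrier_bound:
  assumes c: "\<And>p q r. {p, q, r} \<subseteq> {1..n} \<Longrightarrow> distinct [p, q, r] \<Longrightarrow> three_cycle p q r \<in> words S M"
  shows "carrier G \<subseteq> words S (n * M + 1)"
proof
  fix f assume f: "f \<in> carrier G"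
  have ev: "f \<in> words S (n * M)" if "f permutes {1..n}" "evenperm f" for f
    by (rule even_words[OF c that]) (use fixed_moved[of n f] in simp_all)
  have perm: "permutation s" if "s permutes {1..n}" for s using that permutation_permutes by blast
  have fp: "f permutes {1..n}" by (rule carrier_permutes[OF f])
  show "f \<in> words S (n * M + 1)"
  proof (cases "evenperm f")
    case True
    then show ?thesis using ev[OF fp True] words_mono[of "n * M" "n * M + 1" S] by auto
  next
    case False
    have "\<exists>s\<in>S. \<not> evenperm s"
    proof (rule ccontr)
      assume no: "\<not> ?thesis"
      have "evenperm p" if "p \<in> words S a" for p a
        using that
      proof (induction a arbitrary: p)
        case 0
        then have "p = id" by (simp only: words.simps singleton_iff)
        then show ?case using evenperm_id by metis
      next
        case (Suc a)
        show ?case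
        proof (cases "p \<in> words S a")
          case False
          then obtain t g where p: "p = t \<circ> g" and t: "t \<in> S \<or> inv' t \<in> S \<and> bij t" and g: "g \<in> words S a" using Suc.prems by auto
          have "permutation t \<and> evenperm t"
            using t
          proof
            assume "t \<in> S"
            then show ?thesis using no S_permutes perm by blast
          next
            assume a: "inv' t \<in> S \<and> bij t"
            then have "permutation (inv' t)" "evenperm (inv' t)" using no S_permutes perm by blast+
            then show ?thesis using permutation_inverse evenperm_inv inv_inv_eq a by metis
          qed
          then show ?thesis unfolding p using evenperm_comp[of t g] Suc.IH[OF g] perm[OF words_permutes[OF g]] by blast
        qed (rule Suc.IH)
      qed
      then show False using carrier_words[OF f] False by blast
    qed
    then obtain s where s: "s \<in> S" "\<not> evenperm s" by blast
    have sp: "s permutes {1..n}" using S_permutes s by blast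
    have "evenperm (s \<circ> f)" using evenperm_comp[OF perm[OF sp] perm[OF fp]] s False by simp
    then have w: "s \<circ> f \<in> words S (n * M)" by (rule ev[OF permutes_compose[OF fp sp]])
    have "inv' s \<circ> (s \<circ> f) \<in> words S (1 + n * M)" by (rule words_comp[OF words_inv[OF bij_S words_1[OF s(1)]] w])
    moreover have "inv' s \<circ> (s \<circ> f) = f" using permutes_inv_o(2)[OF sp] by (simp only: comp_assoc[symmetric] id_comp)
    ultimately show ?thesis by (simp only: add.commute)
  qed
qed

text \<open>The initial length \<open>1 + l\<close> keeps every later length at least
  \<open>l\<close>, so \<open>480 * (X + l) \<le> 1000 * X\<close> and each round costs a constant
  factor. Supports only shrink, so the density bound persists.\<close>

lemma shrink_iterate:
  assumes step: "\<And>g L. g \<in> words S L \<Longrightarrow> g \<noteq> id \<Longrightarrow> 10 ^ 10 \<le> real (moved n g) \<Longrightarrow> real (moved n g) \<le> 63 / 100 * real n \<Longrightarrow>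
      \<exists>g' \<in> words S (480 * (L + l)). g' \<noteq> id \<and> real (moved n g') \<le> (1 - 1 / 10 ^ 6) * real (moved n g)"
    and g: "g \<in> S" "g \<noteq> id" "real (moved n g) \<le> 63 / 100 * real n"
  shows "\<exists>g' \<in> words S (1000 ^ j * (1 + l)). g' \<noteq> id \<and> real (moved n g') \<le> 63 / 100 * real n \<and>
     (real (moved n g') < 10 ^ 10 \<or> real (moved n g') \<le> (1 - 1 / 10 ^ 6) ^ j * real n)"
proof (induction j)
  case 0
  have "g \<in> words S (1 + l)" using words_1[OF g(1)] words_mono[of 1 "1 + l" S] by auto
  then show ?case using g by (intro bexI[of _ g]) auto
next
  case (Suc j)
  then obtain g' where g': "g' \<in> words S (1000 ^ j * (1 + l))" "g' \<noteq> id" "real (moved n g') \<le> 63 / 100 * real n"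
    and or: "real (moved n g') < 10 ^ 10 \<or> real (moved n g') \<le> (1 - 1 / 10 ^ 6) ^ j * real n" by blast
  show ?case
  proof (cases "real (moved n g') < 10 ^ 10")
    case True
    have "1000 ^ j * (1 + l) \<le> 1000 ^ Suc j * (1 + l)" by simp
    then have "g' \<in> words S (1000 ^ Suc j * (1 + l))" using g'(1) words_mono by blast
    with g' True show ?thesis by blast
  next
    case False
    then obtain f where f: "f \<in> words S (480 * (1000 ^ j * (1 + l) + l))" "f \<noteq> id"
      and m: "real (moved n f) \<le> (1 - 1 / 10 ^ 6) * real (moved n g')"
      using step[OF g'(1,2) _ g'(3)] by (meson not_less)
    have "l \<le> 1000 ^ j * (1 + l)" using mult_le_mono[of 1 "1000 ^ j" l "1 + l"] by simp
    moreover have "480 * (X + l) \<le> 1000 * X" if "l \<le> X" for X :: nat using that by simp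
    ultimately have "480 * (1000 ^ j * (1 + l) + l) \<le> 1000 * (1000 ^ j * (1 + l))" by blast
    then have "480 * (1000 ^ j * (1 + l) + l) \<le> 1000 ^ Suc j * (1 + l)" by (simp only: power_Suc mult.assoc)
    then have f': "f \<in> words S (1000 ^ Suc j * (1 + l))" using f(1) words_mono by blast
    have "(1 - 1 / 10 ^ 6) * real (moved n g') \<le> (1 - 1 / 10 ^ 6) * ((1 - 1 / 10 ^ 6) ^ j * real n)"
      using or False by (intro mult_left_mono) auto
    moreover have "(1 - 1 / 10 ^ 6) * real (moved n g') \<le> 1 * real (moved n g')" by (intro mult_right_mono) auto
    ultimately show ?thesis using f' f(2) m g'(3) by (intro bexI[of _ f]) auto
  qed
qed

end

section \<open>Cayley graphs and the final bound\<close>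

text \<open>Edges multiply on the left, so a word read from right to left traces a walk; a letter
  whose inverse lies in \<open>S\<close> runs along an edge backwards.\<close>

lemma walk_words:
  assumes "p \<in> words S L" "S \<subseteq> carrier G" "u \<in> carrier G" and G: "G = sym_group n \<or> G = alt_group n"
    and gen: "generate G S = carrier G"
  shows "p \<circ> u \<in> carrier G \<and> (\<exists>xs. walk (cayley_graph G S) u xs (p \<circ> u) \<and> length xs - 1 \<le> L)"
  using assms(1)
proof (induction L arbitrary: p)
  case 0
  then have "p = id" by (simp only: words.simps singleton_iff)
  then have "p \<circ> u = u" by (simp only: id_comp)
  moreover have "walk (cayley_graph G S) u [u] u" using assms(3) by (simp add: walk_def cayley_graph_def)
  ultimately show ?case using assms(3) by (metis One_nat_def diff_Suc_1 le_refl length_Cons list.size(3))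
next
  case (Suc L)
  interpret perm_gens n G S using assms by unfold_locales
  show ?case
  proof (cases "p \<in> words S L")
    case True
    then show ?thesis using Suc.IH[OF True] le_SucI by blast
  next
    case False
    then obtain t g where p: "p = t \<circ> g" and t: "t \<in> S \<or> inv' t \<in> S \<and> bij t" and g: "g \<in> words S L" using Suc.prems by auto
    obtain xs where v: "g \<circ> u \<in> carrier G" and xs: "walk (cayley_graph G S) u xs (g \<circ> u)" "length xs - 1 \<le> L"
      using Suc.IH[OF g] by blast
    interpret grp: Group.group G using assms(4) sym_group_is_group alt_group_is_group by metis
    have tG: "t \<in> carrier G"
      using t
    proof
      assume a: "inv' t \<in> S \<and> bij t"
      then have "inv\<^bsub>G\<^esub> (inv' t) = t" using G_simps(3)[of "inv' t"] S inv_inv_eq by (metis subsetD)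
      then show ?thesis using a S grp.inv_closed by (metis subsetD)
    qed (use S in blast)
    have w: "t \<circ> (g \<circ> u) \<in> carrier G" using grp.m_closed[OF tG v] by (simp only: G_simps)
    have "{g \<circ> u, t \<circ> (g \<circ> u)} \<in> snd (cayley_graph G S)"
      using t
    proof
      assume "t \<in> S"
      then show ?thesis using v by (auto simp only: cayley_graph_def snd_conv G_simps)
    next
      assume a: "inv' t \<in> S \<and> bij t"
      have "inv' t \<circ> (t \<circ> (g \<circ> u)) = g \<circ> u" using a by (simp add: comp_assoc[symmetric] bij_is_inj)
      then have "{t \<circ> (g \<circ> u), inv' t \<circ> (t \<circ> (g \<circ> u))} \<in> snd (cayley_graph G S)"
        unfolding cayley_graph_def snd_conv G_simps using a w by blast
      with \<open>inv' t \<circ> (t \<circ> (g \<circ> u)) = g \<circ> u\<close> show ?thesis by (simp only: insert_commute)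
    qed
    then have "walk (cayley_graph G S) u (xs @ [t \<circ> (g \<circ> u)]) (t \<circ> (g \<circ> u))"
      using xs(1) w by (auto simp: walk_def successively_append_iff cayley_graph_def)
    moreover have "length (xs @ [t \<circ> (g \<circ> u)]) - 1 \<le> Suc L"
      using xs by (auto simp: walk_def)
    ultimately show ?thesis using w unfolding p comp_assoc by blast
  qed
qed

lemma gdiam_le:
  assumes "perm_gens n G S" "carrier G \<subseteq> words S L"
  shows "gdiam (cayley_graph G S) \<le> enat L"
proof -
  interpret perm_gens n G S by (rule assms)
  have "gdist (cayley_graph G S) u v \<le> enat L" if u: "u \<in> carrier G" and v: "v \<in> carrier G" for u v
  proof -
    interpret grp: Group.group G using G sym_group_is_group alt_group_is_group by metis
    have "v \<circ> inv' u \<in> carrier G" using grp.m_closed[OF v grp.inv_closed[OF u]] u by (simp only: G_simps)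
    then have "v \<circ> inv' u \<in> words S L" using assms(2) by blast
    from walk_words[OF this S u G gen] obtain xs where
      xs: "walk (cayley_graph G S) u xs (v \<circ> inv' u \<circ> u)" "length xs - 1 \<le> L" by blast
    have "v \<circ> inv' u \<circ> u = v" using permutes_inv_o(2)[OF carrier_permutes[OF u]] by (simp only: comp_assoc comp_id)
    then have "gdist (cayley_graph G S) u v \<le> enat (length xs - 1)"
      unfolding gdist_def using xs(1) by (intro INF_lower) simp
    also have "\<dots> \<le> enat L" using xs(2) by simp
    finally show ?thesis .
  qed
  then show ?thesis unfolding gdiam_def by (intro SUP_least) (simp add: cayley_graph_def)
qed

lemma finite_bound:
  assumes "perm_gens n G S"
  shows "\<exists>L. carrier G \<subseteq> words S L"
proof -
  interpret perm_gens n G S by (rule assms)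
  have "finite {p. p permutes {1..n}}" by (rule finite_permutations) simp
  moreover have "carrier G \<subseteq> {p. p permutes {1..n}}" using carrier_permutes by blast
  ultimately have fin: "finite (carrier G)" by (rule finite_subset[rotated])
  obtain l where l: "\<And>p. p \<in> carrier G \<Longrightarrow> p \<in> words S (l p)" using carrier_words by metis
  have "p \<in> words S (Max (l ` carrier G))" if "p \<in> carrier G" for p
    using l[OF that] words_mono[of "l p" "Max (l ` carrier G)" S] that fin by auto
  then show ?thesis by blast
qed

text \<open>Below a fixed degree there are finitely many groups and generating sets, so the maximum
  of their bounds can be absorbed into the constant.\<close>

lemma small_bound: "\<exists>L. \<forall>n<m. \<forall>G S. perm_gens n G S \<longrightarrow> carrier G \<subseteq> words S L"
proof -
  define Z where "Z = (\<lambda>(n, b, S). (n, if b then sym_group n else alt_group n, S)) `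
     (SIGMA n : {..<m}. UNIV \<times> Pow {p :: nat \<Rightarrow> nat. p permutes {1..n}})"
  have finZ: "finite Z" unfolding Z_def by (intro finite_imageI finite_SigmaI finite_cartesian_product) (auto intro: finite_permutations)
  obtain l where l: "\<And>n G S. perm_gens n G S \<Longrightarrow> carrier G \<subseteq> words S (l n G S)" using finite_bound by metis
  define L where "L = Max ((\<lambda>(n, G, S). l n G S) ` Z)"
  have "carrier G \<subseteq> words S L" if n: "n < m" and p: "perm_gens n G S" for n G S
  proof -
    interpret perm_gens n G S by (rule p)
    have "S \<in> Pow {p. p permutes {1..n}}" using S_permutes by blast
    then have "(n, G, S) \<in> Z" unfolding Z_def
      using G n by (auto intro: image_eqI[of _ _ "(n, True, S)"] image_eqI[of _ _ "(n, False, S)"])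
    then have "l n G S \<le> L" unfolding L_def using finZ by (intro Max_ge) force+
    then show ?thesis using l[OF p] words_mono by blast
  qed
  then show ?thesis by blast
qed

section \<open>Polynomial growth\<close>

definition poly_bounded :: "(nat \<Rightarrow> nat) \<Rightarrow> bool" where
  "poly_bounded f \<longleftrightarrow> (\<exists>(e::nat) K. \<forall>n\<ge>1. real (f n) \<le> K * real n ^ e)"

lemma poly_bounded_const: "poly_bounded (\<lambda>n. a)"
  unfolding poly_bounded_def by (rule exI[of _ 0], rule exI[of _ "real a"]) simp

lemma poly_bounded_id: "poly_bounded (\<lambda>n. n)"
  unfolding poly_bounded_def by (rule exI[of _ 1], rule exI[of _ 1]) simp

lemma poly_bounded_mult:
  assumes "poly_bounded f" "poly_bounded g" shows "poly_bounded (\<lambda>n. f n * g n)"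
proof -
  obtain e K e' K' where 1: "\<And>n. n \<ge> 1 \<Longrightarrow> real (f n) \<le> K * real n ^ e" and 2: "\<And>n. n \<ge> 1 \<Longrightarrow> real (g n) \<le> K' * real n ^ e'"
    using assms unfolding poly_bounded_def by blast
  have "real (f n * g n) \<le> K * K' * real n ^ (e + e')" if "n \<ge> 1" for n
  proof -
    have "real (f n) * real (g n) \<le> (K * real n ^ e) * (K' * real n ^ e')"
      using 1[OF that] 2[OF that] by (intro mult_mono) (auto intro: order.trans[of 0 "real (f n)"])
    then show ?thesis by (simp add: power_add mult_ac)
  qed
  then show ?thesis unfolding poly_bounded_def by blast
qed

lemma poly_bounded_add:
  assumes "poly_bounded f" "poly_bounded g" shows "poly_bounded (\<lambda>n. f n + g n)"
proof -
  obtain e K e' K' where 1: "\<And>n. n \<ge> 1 \<Longrightarrow> real (f n) \<le> K * real n ^ e" and 2: "\<And>n. n \<ge> 1 \<Longrightarrow> real (g n) \<le> K' * real n ^ e'"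
    using assms unfolding poly_bounded_def by blast
  have "real (f n + g n) \<le> (\<bar>K\<bar> + \<bar>K'\<bar>) * real n ^ (e + e')" if n: "n \<ge> 1" for n
  proof -
    have up: "real n ^ e \<le> real n ^ (e + e')" "real n ^ e' \<le> real n ^ (e + e')"
      using n by (auto intro!: power_increasing)
    have "K * real n ^ e \<le> \<bar>K\<bar> * real n ^ (e + e')" "K' * real n ^ e' \<le> \<bar>K'\<bar> * real n ^ (e + e')"
      using up by (auto intro!: mult_mono)
    then show ?thesis using 1[OF n] 2[OF n] by (simp add: distrib_right)
  qed
  then show ?thesis unfolding poly_bounded_def by blast
qed

lemma poly_bounded_power: "poly_bounded f \<Longrightarrow> poly_bounded (\<lambda>n. f n ^ k)"
  by (induction k) (simp_all add: poly_bounded_const poly_bounded_mult)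

text \<open>As \<open>(1 - 1 / 10 ^ 6) ^ (10 ^ 6)\<close> is at most \<open>1 / e\<close>, this many
  rounds bring \<open>n\<close> down to at most 1.\<close>

definition rounds :: "nat \<Rightarrow> nat" where
  "rounds n = nat \<lceil>10 ^ 6 * ln (real n)\<rceil>"

lemma rounds_decay:
  assumes "n \<ge> 1" shows "(1 - 1 / 10 ^ 6) ^ rounds n * real n \<le> 1"
proof -
  have "10 ^ 6 * ln (real n) \<le> real (rounds n)" unfolding rounds_def by linarith
  have "(1 - 1 / 10 ^ 6 :: real) \<le> exp (- (1 / 10 ^ 6))" using exp_ge_add_one_self[of "- (1 / 10 ^ 6)"] by simp
  then have "(1 - 1 / 10 ^ 6 :: real) ^ rounds n \<le> exp (- (1 / 10 ^ 6)) ^ rounds n" by (intro power_mono) simp_all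
  also have "\<dots> = exp (- (real (rounds n) / 10 ^ 6))" by (simp add: exp_of_nat_mult[symmetric])
  also have "\<dots> \<le> exp (- ln (real n))" using \<open>10 ^ 6 * ln (real n) \<le> real (rounds n)\<close> by simp
  also have "\<dots> = 1 / real n" using assms by (simp add: exp_minus field_simps)
  finally have "(1 - 1 / 10 ^ 6 :: real) ^ rounds n \<le> 1 / real n" .
  then show ?thesis using assms by (simp add: pos_le_divide_eq)
qed

text \<open>A constant to a logarithmic power is a power of \<open>n\<close>, here with exponent
  \<open>10 ^ 6 * ln 1000\<close>; the crude bound \<open>ln 1000 \<le> 1000\<close> gives
  \<open>10 ^ 9\<close>.\<close>

lemma poly_bounded_rounds: "poly_bounded (\<lambda>n. 1000 ^ rounds n)"
proof -
  have "real (1000 ^ rounds n) \<le> 1000 * real n ^ (10 ^ 9)" if n: "n \<ge> 1" for n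
  proof -
    have "real (rounds n) \<le> 10 ^ 6 * ln (real n) + 1" unfolding rounds_def using n by (simp add: of_nat_nat)
    then have "real (rounds n) * ln 1000 \<le> (10 ^ 6 * ln (real n) + 1) * ln 1000" by (intro mult_right_mono) auto
    also have "\<dots> = ln 1000 + ln (real n) * (10 ^ 6 * ln 1000)" by (simp add: algebra_simps)
    also have "\<dots> \<le> ln 1000 + ln (real n) * (10 ^ 6 * 1000)"
      using ln_le_minus_one[of "1000 :: real"] n by (intro add_left_mono mult_left_mono) auto
    finally have "exp (real (rounds n) * ln 1000) \<le> exp (ln 1000 + ln (real n) * (10 ^ 6 * 1000))" by simp
    moreover have "exp (real (rounds n) * ln 1000) = real (1000 ^ rounds n)" by (simp add: exp_of_nat_mult)
    moreover have "exp (ln 1000 + ln (real n) * (10 ^ 6 * 1000)) = 1000 * exp (real (10 ^ 9) * ln (real n))"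
      by (simp add: exp_add mult.commute)
    moreover have "exp (real (10 ^ 9) * ln (real n)) = real n ^ (10 ^ 9)"
      unfolding exp_of_nat_mult using n by simp
    ultimately show ?thesis by simp
  qed
  then show ?thesis unfolding poly_bounded_def by blast
qed

lemma val_seven_pos: "0 < P \<Longrightarrow> 0 < Q \<Longrightarrow> 0 < val seven_long P Q" "0 < P \<Longrightarrow> 0 < Q \<Longrightarrow> 0 < val seven_two P Q"
  "0 < P \<Longrightarrow> 0 < Q \<Longrightarrow> 0 < val seven_three P Q"
  by (simp_all add: seven_long_def seven_two_def seven_three_def)

lemma height_trees: "height tree_long \<le> 20" "height tree_two \<le> 20" "height tree_three \<le> 20"
  by (simp_all add: tree_long_def tree_two_def tree_three_def)

context perm_gens
begin

lemma shrink:
  assumes gW: "g \<in> words S L" and ne: "g \<noteq> id"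
    and big: "10 ^ 10 \<le> real (moved n g)" and dens: "real (moved n g) \<le> 63 / 100 * real n"
    and l: "l = 4 * 596\<^sup>2 * n ^ (7 * 594) * (2 * n)\<^sup>2"
  shows "\<exists>g' \<in> words S (480 * (L + l)). g' \<noteq> id \<and> real (moved n g') \<le> (1 - 1 / 10 ^ 6) * real (moved n g)"
proof -
  have g: "g permutes {1..n}" by (rule words_permutes[OF gW])
  define E where "E m = card {x \<in> {1..n}. g x \<noteq> x \<and> (g ^^ m) x = x}" for m
  have pw: "?thesis" if m: "m \<le> 3" "g ^^ m \<noteq> id" "real (moved n g) / 10 ^ 6 \<le> real (E m)" for m
  proof (intro bexI[of _ "g ^^ m"] conjI)
    show "g ^^ m \<noteq> id" by (rule m)
    show "real (moved n (g ^^ m)) \<le> (1 - 1 / 10 ^ 6) * real (moved n g)"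
      using moved_pow[of n m g] m(3) unfolding E_def by (simp add: algebra_simps)
    have "3 * L \<le> 480 * (L + l)" by simp
    with mult_le_mono1[OF m(1), of L] have "m * L \<le> 480 * (L + l)" by (rule order.trans)
    then show "g ^^ m \<in> words S (480 * (L + l))" using words_funpow[OF gW] words_mono by blast
  qed
  note core = shrink_core[OF g gW big dens _ _ _ _ _ _ _ l]
  consider "g ^^ 2 = id" | "g ^^ 3 = id" | "g ^^ 2 \<noteq> id" "g ^^ 3 \<noteq> id" by blast
  then show ?thesis
  proof cases
    case 1
    show ?thesis
      by (rule core[of 2 tree_two seven_two]) (use 1 valid_tree_two valid_seven tree_two_gain height_trees val_seven_pos in \<open>simp_all add: moved_def\<close>)
  next
    case 2
    show ?thesis
      by (rule core[of 3 tree_three seven_three]) (use 2 valid_tree_three valid_seven tree_three_gain height_trees val_seven_pos in \<open>simp_all add: moved_def\<close>)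
  next
    case 3
    show ?thesis
    \<comment> \<open>If the square or the cube already fixes this share of the moved points, it is
      the smaller element. Otherwise all but \<open>2 / 10 ^ 6\<close> of the moved points lie on
      cycles of length at least 4.\<close>
    proof (cases "real (moved n g) / 10 ^ 6 \<le> real (E 2) \<or> real (moved n g) / 10 ^ 6 \<le> real (E 3)")
      case True
      then show ?thesis using pw[of 2] pw[of 3] 3 by auto
    next
      case False
      let ?H = "{x \<in> {1..n}. g x \<noteq> x \<and> ((0::nat) = 0 \<longrightarrow> (g ^^ 2) x \<noteq> x \<and> (g ^^ 3) x \<noteq> x)}"
      have "{x \<in> {1..n}. g x \<noteq> x} \<subseteq> ?H \<union> ({x \<in> {1..n}. g x \<noteq> x \<and> (g ^^ 2) x = x} \<union> {x \<in> {1..n}. g x \<noteq> x \<and> (g ^^ 3) x = x})"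
        by blast
      then have "moved n g \<le> card (?H \<union> ({x \<in> {1..n}. g x \<noteq> x \<and> (g ^^ 2) x = x} \<union> {x \<in> {1..n}. g x \<noteq> x \<and> (g ^^ 3) x = x}))"
        unfolding moved_def by (intro card_mono) auto
      also have "\<dots> \<le> card ?H + (E 2 + E 3)"
        unfolding E_def by (rule order.trans[OF card_Un_le add_left_mono[OF card_Un_le]])
      finally have H: "(1 - 2 / 10 ^ 6) * real (moved n g) \<le> real (card ?H)"
        using False by (simp add: algebra_simps)
      show ?thesis
        by (rule core[of 0 tree_long seven_long]) (use valid_tree_long valid_seven tree_long_gain height_trees val_seven_pos H in simp_all)
    qed
  qed
qed

end

definition step_len :: "nat \<Rightarrow> nat" where
  "step_len n = 4 * 596\<^sup>2 * n ^ (7 * 594) * (2 * n)\<^sup>2"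

text \<open>The factor 4 is for the commutator that gives one three-cycle, the last summand for its
  conjugation to any other.\<close>

definition cycle_len :: "nat \<Rightarrow> nat \<Rightarrow> nat" where
  "cycle_len k n = 4 * (1000 ^ rounds n * (1 + step_len n) + 16 * (k + 2)\<^sup>2 * n ^ (7 * k)) + 2 * (16 * 25 * n ^ 21)"

definition total_len :: "nat \<Rightarrow> nat \<Rightarrow> nat" where
  "total_len k n = n * cycle_len k n + 1"

lemma poly_bounded_total: "poly_bounded (total_len k)"
  unfolding total_len_def cycle_len_def step_len_def
  by (intro poly_bounded_add poly_bounded_mult poly_bounded_rounds poly_bounded_id poly_bounded_const poly_bounded_power)

lemma (in perm_gens) large_bound:
  assumes k: "real k = 10 ^ 10" and n: "2 * k + 10 \<le> n"
    and g: "g \<in> S" "g \<noteq> id" "real (moved n g) \<le> 63 / 100 * real n"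
  shows "carrier G \<subseteq> words S (total_len k n)"
proof -
  have "\<exists>g' \<in> words S (1000 ^ rounds n * (1 + step_len n)). g' \<noteq> id \<and> real (moved n g') \<le> 63 / 100 * real n \<and>
     (real (moved n g') < 10 ^ 10 \<or> real (moved n g') \<le> (1 - 1 / 10 ^ 6) ^ rounds n * real n)"
    by (rule shrink_iterate[OF _ g]) (rule shrink[OF _ _ _ _ step_len_def]; assumption)
  then obtain g' where g': "g' \<in> words S (1000 ^ rounds n * (1 + step_len n))" "g' \<noteq> id"
    and or: "real (moved n g') < 10 ^ 10 \<or> real (moved n g') \<le> (1 - 1 / 10 ^ 6) ^ rounds n * real n" by blast
  have "n \<ge> 1" using n by simp
  have "real (moved n g') \<le> 10 ^ 10"
    using or
  proof
    assume "real (moved n g') \<le> (1 - 1 / 10 ^ 6) ^ rounds n * real n"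
    also note rounds_decay[OF \<open>n \<ge> 1\<close>]
    finally show ?thesis by (rule order.trans) simp
  qed (rule less_imp_le)
  then have "real (moved n g') \<le> real k" by (simp only: k)
  then have m: "moved n g' \<le> k" by (simp only: of_nat_le_iff)
  have "2 * k + 2 \<le> n" "5 \<le> n" using n by simp_all
  obtain x y z where c: "{x, y, z} \<subseteq> {1..n}" "distinct [x, y, z]"
    "three_cycle x y z \<in> words S (4 * (1000 ^ rounds n * (1 + step_len n) + 16 * (k + 2)\<^sup>2 * n ^ (7 * k)))"
    using three_cycle_exists[OF words_permutes[OF g'(1)] g' m \<open>2 * k + 2 \<le> n\<close>] by blast
  show ?thesis
    unfolding total_len_def cycle_len_def
    by (rule carrier_bound, rule all_three_cycles[OF c(3,1,2) \<open>5 \<le> n\<close>])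
qed

theorem theorem1p3:
  shows "\<exists>c::real. c > 0 \<and> (\<exists>K::real. \<forall>n::nat. \<forall>G S.
           (G = sym_group n \<or> G = alt_group n) \<longrightarrow>
           S \<subseteq> carrier G \<longrightarrow> generate G S = carrier G \<longrightarrow>
           (\<exists>g\<in>S. g \<noteq> \<one>\<^bsub>G\<^esub> \<and> real (card (supp n g)) \<le> 0.63 * real n) \<longrightarrow>
           ereal_of_enat (gdiam (cayley_graph G S)) \<le> ereal (K * real n powr c))"
proof -
  have "real (10 ^ 10) = 10 ^ 10" by (simp only: of_nat_power of_nat_numeral)
  then obtain k :: nat where k: "real k = 10 ^ 10" ..
  obtain e K where eK: "\<And>n. n \<ge> 1 \<Longrightarrow> real (total_len k n) \<le> K * real n ^ e"
    using poly_bounded_total[of k, unfolded poly_bounded_def] by (elim exE) (rule that, blast)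
  obtain l where l: "\<And>n G S. n < 2 * k + 10 \<Longrightarrow> perm_gens n G S \<Longrightarrow> carrier G \<subseteq> words S l"
    using small_bound[of "2 * k + 10"] by (elim exE) (rule that, blast)
  \<comment> \<open>\<open>e\<close> may be 0, so 1 is added to make the exponent positive;
    \<open>real l\<close> covers the degrees below the threshold.\<close>
  have main: "ereal_of_enat (gdiam (cayley_graph G S)) \<le> ereal ((\<bar>K\<bar> + real l) * real n powr (real e + 1))"
    if G: "G = sym_group n \<or> G = alt_group n" and S: "S \<subseteq> carrier G" "generate G S = carrier G"
      and g: "g \<in> S" "g \<noteq> \<one>\<^bsub>G\<^esub>" "real (card (supp n g)) \<le> 0.63 * real n" for n G S g
  proof -
    have pg: "perm_gens n G S" using G S by unfold_locales
    interpret perm_gens n G S by (rule pg)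
    have gid: "g \<noteq> id" using g(2) by (simp only: G_simps not_False_eq_True)
    \<comment> \<open>In degree 0 the bound would be 0, but there the identity is the only
      permutation.\<close>
    have n: "n \<ge> 1"
    proof (rule ccontr)
      assume "\<not> ?thesis"
      then have "{1..n} = {}" by simp
      then have "g permutes {}" using S_permutes[OF g(1)] by simp
      then show False using gid by (simp only: permutes_empty not_True_eq_False)
    qed
    have "real (moved n g) \<le> 63 / 100 * real n" using g(3) by (simp add: moved_def supp_def)
    obtain L where L: "carrier G \<subseteq> words S L" "real L \<le> (\<bar>K\<bar> + real l) * real n powr (real e + 1)"
    proof (cases "n < 2 * k + 10")
      case True
      have "real l * 1 \<le> (\<bar>K\<bar> + real l) * real n powr (real e + 1)"
        using n by (intro mult_mono ge_one_powr_ge_zero) auto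
      then show ?thesis using that[of l] l[OF True pg] by simp
    next
      case False
      have "real n ^ e = real n powr real e" using n by (simp add: powr_realpow)
      also have "\<dots> \<le> real n powr (real e + 1)" using n by (intro powr_mono) auto
      finally have pw: "real n ^ e \<le> real n powr (real e + 1)" .
      have "real (total_len k n) \<le> K * real n ^ e" by (rule eK[OF n])
      also have "\<dots> \<le> (\<bar>K\<bar> + real l) * real n powr (real e + 1)"
        using pw by (intro mult_mono) auto
      finally show ?thesis
        using that[of "total_len k n"] large_bound[OF k _ g(1) gid \<open>real (moved n g) \<le> 63 / 100 * real n\<close>] False by simp
    qed
    have "ereal_of_enat (gdiam (cayley_graph G S)) \<le> ereal_of_enat (enat L)"
      using gdiam_le[OF pg L(1)] by (simp only: ereal_of_enat_le_iff)
    also have "\<dots> = ereal (real L)" by simp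
    also have "\<dots> \<le> ereal ((\<bar>K\<bar> + real l) * real n powr (real e + 1))" using L(2) by simp
    finally show ?thesis .
  qed
  show ?thesis
    by (rule exI[of _ "real e + 1"], rule conjI, simp, rule exI[of _ "\<bar>K\<bar> + real l"]) (use main in blast)
qed

end
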